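(* Let $k$ be a perfect field of characteristic $2$ and let $C/k$ be a hyperelliptic curve of genus $g\ge2$ given by a smooth model in the weighted projective plane (weights $1,g+1,1$) \[ Y^2+H_1(X,Z)Y=H_0(X,Z), \] with $H_1,H_0\in k[X,Z]$ homogeneous of degrees $g+1$ and $2g+2$. Then the Jacobian of $C$ has no $k$-rational point of order $2$ if and only if $H_1(X,Z)$ is a power of an irreducible polynomial of odd degree in $k[X,Z]$.
   Formalization: "A power of an irreducible polynomial" is taken up to a nonzero constant factor of k; taken literally the claim fails, e.g. over F_4 with g=2, H_1=cX^3 (c a generator of F_4^* ), H_0=X^5Z+XZ^5. *)

theory Defs
  imports
    "HOL-Computational_Algebra.Computational_Algebra"
    "HOL-Algebra.Algebraic_Closure_Type"
    "HOL-Algebra.Free_Abelian_Groups"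
    "HOL-Algebra.Multiplicative_Group"
begin


section \<open>Polynomials in several variables\<close>

text \<open>
  The ring $k[X,Z]$ is the type \<open>'k poly poly\<close> and $k[X,Z,Y]$ is
  \<open>'k poly poly poly\<close>; the innermost variable is $X$, the next one is $Z$ and the
  outermost one, if present, is $Y$. Thus the coefficient of $X^i Z^j$ in \<open>P\<close> is
  \<open>coeff (coeff P j) i\<close>. The variables $X$, $Y$, $Z$ have weights $1$, $g+1$, $1$, and
  triples are always written in the order $(X, Y, Z)$. As usual, the zero polynomial counts
  as homogeneous of every degree.
\<close>

definition homogeneous :: "nat \<Rightarrow> 'a::zero poly poly \<Rightarrow> bool" where
  "homogeneous d P \<longleftrightarrow> (\<forall>i j. coeff (coeff P j) i \<noteq> 0 \<longrightarrow> i + j = d)"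

definition total_degree :: "'a::zero poly poly \<Rightarrow> nat" where
  "total_degree P = Max {i + j | i j. coeff (coeff P j) i \<noteq> 0}"

definition weighted_form :: "nat \<Rightarrow> nat \<Rightarrow> 'a::zero poly poly poly \<Rightarrow> bool" where
  "weighted_form g d F \<longleftrightarrow>
     (\<forall>i j l. coeff (coeff (coeff F l) j) i \<noteq> 0 \<longrightarrow> i + j + (g + 1) * l = d)"

text \<open>Evaluation after mapping the coefficients along a homomorphism \<open>\<phi>\<close>.\<close>

definition eval2 :: "('a::zero \<Rightarrow> 'b::comm_ring_1) \<Rightarrow> 'a poly poly \<Rightarrow> 'b \<Rightarrow> 'b \<Rightarrow> 'b" where
  "eval2 \<phi> P x z = poly (map_poly (\<lambda>p. poly (map_poly \<phi> p) x) P) z"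

fun eval3 :: "('a::zero \<Rightarrow> 'b::comm_ring_1) \<Rightarrow> 'a poly poly poly \<Rightarrow> 'b \<times> 'b \<times> 'b \<Rightarrow> 'b" where
  "eval3 \<phi> F (x, y, z) = poly (map_poly (\<lambda>P. eval2 \<phi> P x z) F) y"

definition perfect_field :: "'a::field itself \<Rightarrow> bool" where
  "perfect_field _ \<longleftrightarrow> CHAR('a) = 0 \<or> (\<forall>a::'a. \<exists>b. b ^ CHAR('a) = a)"


section \<open>The curve over the algebraic closure\<close>

definition curve_poly :: "'k::field poly poly \<Rightarrow> 'k poly poly \<Rightarrow> 'k poly poly poly" where
  "curve_poly H1 H0 = [:- H0, H1, 1:]"

lemma eval3_curve_poly:
  fixes \<phi> :: "'k::field \<Rightarrow> 'b::comm_ring_1"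
  assumes "\<phi> 0 = 0" "\<phi> 1 = 1" "\<And>a. \<phi> (- a) = - \<phi> a"
  shows "eval3 \<phi> (curve_poly H1 H0) (x, y, z) =
           y\<^sup>2 + eval2 \<phi> H1 x z * y - eval2 \<phi> H0 x z"
proof -
  have minus: "map_poly f (- p) = - map_poly f p"
    if "f 0 = 0" "\<And>a. f (- a) = - f a" for f :: "'c::ab_group_add \<Rightarrow> 'b" and p
    by (rule poly_eqI) (simp add: coeff_map_poly that)
  have [simp]: "eval2 \<phi> 0 x z = 0" "eval2 \<phi> 1 x z = 1"
    using assms by (simp_all add: eval2_def map_poly_pCons one_pCons)
  have [simp]: "eval2 \<phi> (- P) x z = - eval2 \<phi> P x z" for P
    using assms by (simp add: eval2_def minus)
  show ?thesis
    by (simp add: curve_poly_def map_poly_pCons algebra_simps power2_eq_square)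
qed

text \<open>
  The Jacobian criterion at all geometric points. It is stated on the cone over the curve:
  a point of the cone other than the origin has $(X,Z) \neq (0,0)$, the multiplicative group
  acts freely there, and the curve is the quotient, so that the curve is smooth if and only
  if the punctured cone is.
\<close>

definition smooth_model :: "'k::field poly poly \<Rightarrow> 'k poly poly \<Rightarrow> bool" where
  "smooth_model H1 H0 \<longleftrightarrow>
     (let F = curve_poly H1 H0;
          F_X = map_poly (map_poly pderiv) F;
          F_Z = map_poly pderiv F;
          F_Y = pderiv F
      in \<forall>p. p \<noteq> (0, 0, 0) \<and> eval3 to_ac F p = 0 \<longrightarrow>
            eval3 to_ac F_X p \<noteq> 0 \<or> eval3 to_ac F_Y p \<noteq> 0 \<or> eval3 to_ac F_Z p \<noteq> 0)"

text \<open>Points of the weighted projective plane are represented by their classes of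
  homogeneous coordinates.\<close>

type_synonym 'a wpoint = "('a \<times> 'a \<times> 'a) set"

fun wproj :: "nat \<Rightarrow> 'a::field \<times> 'a \<times> 'a \<Rightarrow> 'a wpoint" where
  "wproj g (x, y, z) = {(c * x, c ^ (g + 1) * y, c * z) | c. c \<noteq> 0}"

definition curve_points ::
    "nat \<Rightarrow> 'k::field poly poly \<Rightarrow> 'k poly poly \<Rightarrow> 'k alg_closure wpoint set" where
  "curve_points g H1 H0 =
     {wproj g p | p. p \<noteq> (0, 0, 0) \<and> eval3 to_ac (curve_poly H1 H0) p = 0}"


section \<open>The function field, local rings and orders of vanishing\<close>

text \<open>
  Write $K$ for the algebraic closure of $k$. The function field $K(C) = K(x)(y)$, where
  $y^2 + H_1(x,1) y = H_0(x,1)$, is realised as a subfield of an algebraic closure of $K(x)$.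
  The other root of the quadratic equation is $-y - H_1(x,1)$; choosing it instead only
  applies the hyperelliptic involution to the embedding. A rational function on $C$ is a
  quotient of two forms of the same weighted degree, evaluated at the generic point $(x:y:1)$.
\<close>

type_synonym 'a fun_ext = "'a poly fract alg_closure"

definition fun_const :: "'a::field \<Rightarrow> 'a fun_ext" where
  "fun_const c = to_ac (to_fract [:c:])"

definition fun_x :: "'a::field fun_ext" where
  "fun_x = to_ac (to_fract [:0, 1:])"

definition fun_y :: "'k::field poly poly \<Rightarrow> 'k poly poly \<Rightarrow> 'k alg_closure fun_ext" where
  "fun_y H1 H0 = (SOME y. eval3 (fun_const \<circ> to_ac) (curve_poly H1 H0) (fun_x, y, 1) = 0)"

definition generic_value ::
    "'k::field poly poly \<Rightarrow> 'k poly poly \<Rightarrow> 'k alg_closure poly poly poly \<Rightarrow>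
     'k alg_closure fun_ext" where
  "generic_value H1 H0 F = eval3 fun_const F (fun_x, fun_y H1 H0, 1)"

definition function_field ::
    "nat \<Rightarrow> 'k::field poly poly \<Rightarrow> 'k poly poly \<Rightarrow> 'k alg_closure fun_ext set" where
  "function_field g H1 H0 =
     {generic_value H1 H0 F / generic_value H1 H0 G | F G d.
        weighted_form g d F \<and> weighted_form g d G \<and> generic_value H1 H0 G \<noteq> 0}"

definition local_ring ::
    "nat \<Rightarrow> 'k::field poly poly \<Rightarrow> 'k poly poly \<Rightarrow> 'k alg_closure wpoint \<Rightarrow>
     'k alg_closure fun_ext set" where
  "local_ring g H1 H0 P =
     {generic_value H1 H0 F / generic_value H1 H0 G | F G d.
        weighted_form g d F \<and> weighted_form g d G \<and> (\<forall>p\<in>P. eval3 id G p \<noteq> 0)}"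

definition max_ideal ::
    "nat \<Rightarrow> 'k::field poly poly \<Rightarrow> 'k poly poly \<Rightarrow> 'k alg_closure wpoint \<Rightarrow>
     'k alg_closure fun_ext set" where
  "max_ideal g H1 H0 P =
     {generic_value H1 H0 F / generic_value H1 H0 G | F G d.
        weighted_form g d F \<and> weighted_form g d G \<and> (\<forall>p\<in>P. eval3 id G p \<noteq> 0) \<and>
        (\<forall>p\<in>P. eval3 id F p = 0)}"

text \<open>Powers of an ideal \<open>M\<close> of a subring \<open>R\<close>: finite sums of products.\<close>

primrec ideal_power :: "'a::comm_ring_1 set \<Rightarrow> 'a set \<Rightarrow> nat \<Rightarrow> 'a set" where
  "ideal_power R M 0 = R"
| "ideal_power R M (Suc n) =
     {sum_list fs | fs. set fs \<subseteq> {a * b | a b. a \<in> M \<and> b \<in> ideal_power R M n}}"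

definition local_order ::
    "nat \<Rightarrow> 'k::field poly poly \<Rightarrow> 'k poly poly \<Rightarrow> 'k alg_closure wpoint \<Rightarrow>
     'k alg_closure fun_ext \<Rightarrow> nat" where
  "local_order g H1 H0 P f =
     (GREATEST n. f \<in> ideal_power (local_ring g H1 H0 P) (max_ideal g H1 H0 P) n)"

text \<open>The order at \<open>P\<close> of a nonzero rational function, extended from the local ring to its
  field of fractions by $\mathrm{ord}_P(a/b) = \mathrm{ord}_P(a) - \mathrm{ord}_P(b)$.\<close>

definition ord_at ::
    "nat \<Rightarrow> 'k::field poly poly \<Rightarrow> 'k poly poly \<Rightarrow> 'k alg_closure wpoint \<Rightarrow>
     'k alg_closure fun_ext \<Rightarrow> int" where
  "ord_at g H1 H0 P f =
     (THE m. \<exists>a b. a \<in> local_ring g H1 H0 P - {0} \<and> b \<in> local_ring g H1 H0 P - {0} \<and>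
        f = a / b \<and> m = int (local_order g H1 H0 P a) - int (local_order g H1 H0 P b))"


section \<open>Divisor classes and the Jacobian\<close>

definition div_degree :: "('p \<Rightarrow>\<^sub>0 int) \<Rightarrow> int" where
  "div_degree D = (\<Sum>P\<in>Poly_Mapping.keys D. Poly_Mapping.lookup D P)"

definition degree_zero_divisors ::
    "nat \<Rightarrow> 'k::field poly poly \<Rightarrow> 'k poly poly \<Rightarrow> ('k alg_closure wpoint \<Rightarrow>\<^sub>0 int) monoid" where
  "degree_zero_divisors g H1 H0 =
     (let Div = free_Abelian_group (curve_points g H1 H0)
      in Div\<lparr>carrier := {D \<in> carrier Div. div_degree D = 0}\<rparr>)"

definition principal_divisors ::
    "nat \<Rightarrow> 'k::field poly poly \<Rightarrow> 'k poly poly \<Rightarrow> ('k alg_closure wpoint \<Rightarrow>\<^sub>0 int) set" where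
  "principal_divisors g H1 H0 =
     {D \<in> carrier (free_Abelian_group (curve_points g H1 H0)).
        \<exists>f \<in> function_field g H1 H0 - {0}.
          \<forall>P \<in> curve_points g H1 H0. Poly_Mapping.lookup D P = ord_at g H1 H0 P f}"

text \<open>
  The group $J(K) = \mathrm{Pic}^0(C_K)$ of geometric points of the Jacobian, and the subset
  $J(k)$ of its $k$-rational points. For perfect $k$ the latter are the points fixed by
  $\mathrm{Gal}(K/k)$. A class in $J(k)$ is a Galois-stable divisor class; it is not required
  to contain a Galois-stable divisor.
\<close>

definition jacobian ::
    "nat \<Rightarrow> 'k::field poly poly \<Rightarrow> 'k poly poly \<Rightarrow>
     ('k alg_closure wpoint \<Rightarrow>\<^sub>0 int) set monoid" where
  "jacobian g H1 H0 = degree_zero_divisors g H1 H0 Mod principal_divisors g H1 H0"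

definition galois_group :: "('k::field alg_closure \<Rightarrow> 'k alg_closure) set" where
  "galois_group =
     {\<sigma>. bij \<sigma> \<and> (\<forall>a b. \<sigma> (a + b) = \<sigma> a + \<sigma> b) \<and> (\<forall>a b. \<sigma> (a * b) = \<sigma> a * \<sigma> b) \<and>
         (\<forall>a. \<sigma> (to_ac a) = to_ac a)}"

definition galois_point :: "('a \<Rightarrow> 'a) \<Rightarrow> 'a wpoint \<Rightarrow> 'a wpoint" where
  "galois_point \<sigma> P = map_prod \<sigma> (map_prod \<sigma> \<sigma>) ` P"

definition galois_divisor :: "('a \<Rightarrow> 'a) \<Rightarrow> ('a wpoint \<Rightarrow>\<^sub>0 int) \<Rightarrow> ('a wpoint \<Rightarrow>\<^sub>0 int)" where
  "galois_divisor \<sigma> D = frag_extend (frag_of \<circ> galois_point \<sigma>) D"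

definition jacobian_rational_points ::
    "nat \<Rightarrow> 'k::field poly poly \<Rightarrow> 'k poly poly \<Rightarrow> ('k alg_closure wpoint \<Rightarrow>\<^sub>0 int) set set" where
  "jacobian_rational_points g H1 H0 =
     {c \<in> carrier (jacobian g H1 H0). \<forall>\<sigma> \<in> galois_group. galois_divisor \<sigma> ` c = c}"

end

theory Submission
  imports Defs
begin

text \<open>
  In characteristic \<open>2\<close> the ramification points of the map \<open>C \<rightarrow> P\<^sup>1\<close> are the points over the
  zeros of \<open>H1\<close>, one over each zero. Let \<open>\<iota>\<close> be the hyperelliptic involution and \<open>D\<^sub>0\<close> a fibre
  of the map; every divisor satisfies \<open>D + \<iota>D \<sim> deg(D) D\<^sub>0\<close>. If \<open>2D \<sim> 0\<close> then \<open>D - \<iota>D = div f\<close>,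
  where \<open>f\<close> can be scaled to have norm \<open>1\<close>, and by Hilbert 90 \<open>D\<close> is equivalent to an
  \<open>\<iota>\<close>-invariant divisor, hence to the sum of a set \<open>S\<close> of ramification points minus \<open>|S|/2\<close>
  fibres. Conversely such a sum is not principal unless \<open>S\<close> is empty: if \<open>div f\<close> is
  \<open>\<iota>\<close>-invariant, then \<open>f / \<iota>(f)\<close> is a constant of square \<open>1\<close>, hence \<open>1\<close>, so that \<open>f\<close> is a
  function of \<open>x\<close> and has even order at the ramification points. Therefore the rational classes
  of order \<open>2\<close> correspond to the nonempty Galois-stable sets of zeros of \<open>H1\<close> of even
  cardinality. There is none if and only if the zeros form a single Galois orbit of odd length.
\<close>

text \<open>Functions live in an algebraic closure of \<open>K(x)\<close>, and an order of vanishing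
  is defined by a largest ideal power and a unique difference. So no order can be computed before
  each local ring is known to be a discrete valuation ring, and the involution and the Galois action
  must be realized by automorphisms of the large closure; these come from one extension theorem,
  proved by Zorn's lemma. Smoothness acts at the points over zeros of \<open>H1\<close>: the local
  equation there is of Eisenstein type, so \<open>y\<close> is irrational over \<open>K(x)\<close>
  and the coordinate of the line is the square of a uniformizer up to a unit. Smoothness also forces
  \<open>H1\<close> to be nonzero; otherwise the function field would be inseparable over
  \<open>K(x)\<close> and every function fixed by the involution. That principal divisors have
  degree zero is obtained from norms to \<open>K(x)\<close>; that regular functions are constant
  follows from it. Perfectness of \<open>k\<close> makes irreducible factors separable, so the orbit
  of a root is as long as the degree. A zero at infinity belongs to the factor \<open>Z\<close>, of
  degree one.\<close>

locale rhom =
  fixes \<phi> :: "'a::comm_ring_1 \<Rightarrow> 'b::comm_ring_1"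
  assumes one [simp]: "\<phi> 1 = 1"
    and add: "\<phi> (a + b) = \<phi> a + \<phi> b"
    and mult: "\<phi> (a * b) = \<phi> a * \<phi> b"
begin

lemma zero [simp]: "\<phi> 0 = 0"
  using add[of 0 0] by simp

lemma minus: "\<phi> (- a) = - \<phi> a"
  using add[of a "- a"] by (simp add: eq_neg_iff_add_eq_0 add.commute)

lemma diff: "\<phi> (a - b) = \<phi> a - \<phi> b"
  using add[of a "- b"] minus[of b] by simp

lemma power: "\<phi> (a ^ n) = \<phi> a ^ n"
  by (induction n) (simp_all add: mult)

lemma sum: "\<phi> (\<Sum>i\<in>A. f i) = (\<Sum>i\<in>A. \<phi> (f i))"
  by (induction A rule: infinite_finite_induct) (simp_all add: add)

lemma dvd: "a dvd b \<Longrightarrow> \<phi> a dvd \<phi> b"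
  by (auto simp: dvd_def mult)

lemma map_poly: "rhom (map_poly \<phi>)"
  by unfold_locales (auto intro!: poly_eqI simp: coeff_map_poly add mult coeff_mult sum)

lemma poly: "\<phi> (poly p x) = poly (map_poly \<phi> p) (\<phi> x)"
  by (induction p) (simp_all add: map_poly_pCons add mult)

end

lemma rhom_comp: "rhom \<phi> \<Longrightarrow> rhom \<psi> \<Longrightarrow> rhom (\<lambda>a. \<psi> (\<phi> a))"
  by (simp add: rhom_def)

lemma rhom_id: "rhom (\<lambda>a. a)" "rhom id"
  by (simp_all add: rhom_def)

lemma rhom_poly: "rhom (\<lambda>p. poly p x)"
  by (simp add: rhom_def)

lemma rhom_const: "rhom (\<lambda>c. [:c:])"
  by (simp add: rhom_def one_pCons mult.commute)

lemma rhom_to_ac: "rhom to_ac"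
  by (simp add: rhom_def)

lemma rhom_to_fract: "rhom to_fract"
  by (simp add: rhom_def)

lemma rhom_inverse:
  fixes \<phi> :: "'a::field \<Rightarrow> 'b::field"
  assumes "rhom \<phi>"
  shows "\<phi> (inverse a) = inverse (\<phi> a)"
proof (cases "a = 0")
  case False
  interpret rhom \<phi> by fact
  have "\<phi> a * \<phi> (inverse a) = 1"
    using False mult[of a "inverse a"] by simp
  then show ?thesis by (metis inverse_unique)
qed (simp add: rhom.zero[OF assms])

lemma rhom_divide:
  fixes \<phi> :: "'a::field \<Rightarrow> 'b::field"
  assumes "rhom \<phi>"
  shows "\<phi> (a / b) = \<phi> a / \<phi> b"
  by (simp add: divide_inverse rhom.mult[OF assms] rhom_inverse[OF assms])

lemma rhom_eq_0_iff:
  fixes \<phi> :: "'a::field \<Rightarrow> 'b::field"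
  assumes "rhom \<phi>"
  shows "\<phi> a = 0 \<longleftrightarrow> a = 0"
proof -
  interpret rhom \<phi> by fact
  show ?thesis
    using mult[of a "inverse a"] by (cases "a = 0") auto
qed

lemma rhom_inj:
  fixes \<phi> :: "'a::field \<Rightarrow> 'b::field"
  assumes "rhom \<phi>"
  shows "inj \<phi>"
  by (rule injI) (metis rhom.diff[OF assms] rhom_eq_0_iff[OF assms] eq_iff_diff_eq_0)

lemma rhom_inv:
  assumes "rhom \<phi>" "bij \<phi>"
  shows "rhom (inv_into UNIV \<phi>)"
proof -
  interpret rhom \<phi> by fact
  have eq: "inv_into UNIV \<phi> b = a" if "\<phi> a = b" for a b
    using that assms(2) by (metis bij_inv_eq_iff)
  have surj: "\<phi> (inv_into UNIV \<phi> b) = b" for b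
    using assms(2) by (simp add: bij_is_surj surj_f_inv_f)
  show ?thesis
    by unfold_locales (auto intro!: eq simp: add mult surj)
qed

subsection \<open>Evaluation\<close>

lemma eval2_0 [simp]: "eval2 \<phi> 0 x z = 0"
  by (simp add: eval2_def)

lemma eval2_pCons:
  assumes "rhom \<phi>"
  shows "eval2 \<phi> (pCons p P) x z = poly (map_poly \<phi> p) x + z * eval2 \<phi> P x z"
  unfolding eval2_def by (subst map_poly_pCons) (simp_all add: rhom.zero[OF assms])

lemma rhom_eval2: "rhom \<phi> \<Longrightarrow> rhom (\<lambda>P. eval2 \<phi> P x z)"
  unfolding eval2_def
  by (rule rhom_comp[OF rhom.map_poly rhom_poly], rule rhom_comp[OF rhom.map_poly rhom_poly])

lemma eval3_0 [simp]: "eval3 \<phi> 0 (x, y, z) = 0"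
  by simp

lemma eval3_pCons:
  "eval3 \<phi> (pCons P F) (x, y, z) = eval2 \<phi> P x z + y * eval3 \<phi> F (x, y, z)"
  by (simp add: map_poly_pCons)

lemma rhom_eval3: "rhom \<phi> \<Longrightarrow> rhom (\<lambda>F. eval3 \<phi> F p)"
proof (cases p)
  case (fields x y z)
  assume "rhom \<phi>"
  then show ?thesis
    unfolding fields eval3.simps
    by (intro rhom_comp[OF rhom.map_poly rhom_poly] rhom_eval2)
qed

text \<open>The common tool for moving an evaluation elsewhere: specializing a parameter, embedding
  constants, passing from polynomials to functions and applying automorphisms are all instances with
  a suitable \<open>\<psi>\<close>.\<close>

lemma hom_eval2:
  assumes "rhom \<phi>" "rhom \<psi>"
  shows "\<psi> (eval2 \<phi> P x z) = eval2 (\<lambda>a. \<psi> (\<phi> a)) P (\<psi> x) (\<psi> z)"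
proof -
  interpret \<psi>: rhom \<psi> by fact
  note comp = rhom_comp[OF assms]
  show ?thesis
  proof (induction P)
    case (pCons p P)
    have "\<psi> (poly (map_poly \<phi> p) x) = poly (map_poly (\<lambda>a. \<psi> (\<phi> a)) p) (\<psi> x)"
      by (simp add: \<psi>.poly map_poly_map_poly rhom.zero[OF assms(1)] o_def)
    then show ?case
      using pCons by (simp add: eval2_pCons assms comp \<psi>.add \<psi>.mult)
  qed simp
qed

lemma hom_eval3:
  assumes "rhom \<phi>" "rhom \<psi>"
  shows "\<psi> (eval3 \<phi> F (x, y, z)) = eval3 (\<lambda>a. \<psi> (\<phi> a)) F (\<psi> x, \<psi> y, \<psi> z)"
proof -
  interpret \<psi>: rhom \<psi> by fact
  show ?thesis
    by (induction F) (simp_all add: eval3_pCons hom_eval2[OF assms] \<psi>.add \<psi>.mult del: eval3.simps)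
qed

lemma eval2_map:
  assumes "rhom \<phi>" "rhom \<chi>"
  shows "eval2 \<phi> (map_poly (map_poly \<chi>) P) x z = eval2 (\<lambda>a. \<phi> (\<chi> a)) P x z"
  by (induction P)
     (simp_all add: map_poly_pCons eval2_pCons assms rhom_comp map_poly_map_poly rhom.zero o_def)

lemma eval3_map:
  assumes "rhom \<phi>" "rhom \<chi>"
  shows "eval3 \<phi> (map_poly (map_poly (map_poly \<chi>)) F) (x, y, z) =
    eval3 (\<lambda>a. \<phi> (\<chi> a)) F (x, y, z)"
  by (induction F) (simp_all add: map_poly_pCons eval3_pCons eval2_map[OF assms] del: eval3.simps)

lemma eval2_altdef:
  assumes "rhom \<phi>"
  shows "eval2 \<phi> P x z =
    (\<Sum>j\<le>degree P. \<Sum>i\<le>degree (coeff P j). \<phi> (coeff (coeff P j) i) * x ^ i * z ^ j)"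
proof -
  have [simp]: "\<phi> 0 = 0" using assms by (rule rhom.zero)
  have "poly (map_poly \<phi> p) x = (\<Sum>i\<le>degree p. \<phi> (coeff p i) * x ^ i)" for p
    by (induction p rule: pCons_induct)
      (auto simp: map_poly_pCons sum.atMost_Suc_shift sum_distrib_left algebra_simps simp del: sum.atMost_Suc)
  note inner = this
  have "poly (map_poly f P) z = (\<Sum>j\<le>degree P. f (coeff P j) * z ^ j)"
    if [simp]: "f 0 = 0" for f :: "'a poly \<Rightarrow> 'b"
    by (induction P rule: pCons_induct)
      (auto simp: map_poly_pCons sum.atMost_Suc_shift sum_distrib_left algebra_simps simp del: sum.atMost_Suc)
  from this[of "\<lambda>p. poly (map_poly \<phi> p) x"] show ?thesis
    by (simp add: eval2_def inner sum_distrib_right)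
qed

section \<open>Homogeneous and weighted forms under evaluation\<close>

lemma eval2_scale:
  assumes "rhom \<phi>" "homogeneous d P"
  shows "eval2 \<phi> P (c * x) (c * z) = c ^ d * eval2 \<phi> P x z"
  unfolding eval2_altdef[OF assms(1)] sum_distrib_left
proof (intro sum.cong refl)
  fix j i
  show "\<phi> (coeff (coeff P j) i) * (c * x) ^ i * (c * z) ^ j
    = c ^ d * (\<phi> (coeff (coeff P j) i) * x ^ i * z ^ j)"
  proof (cases "coeff (coeff P j) i = 0")
    case True
    then show ?thesis by (simp add: rhom.zero[OF assms(1)])
  next
    case False
    then have "i + j = d" using assms(2) by (auto simp: homogeneous_def)
    then show ?thesis
      by (simp add: power_mult_distrib power_add[symmetric] algebra_simps flip: \<open>i + j = d\<close>)
        (simp add: power_add algebra_simps)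
  qed
qed

text \<open>Splitting off the part free of \<open>Y\<close> gives induction on the degree in
  \<open>Y\<close>. The case \<open>F = 0\<close> stands apart because \<open>d - (g + 1)\<close> is
  a truncated subtraction, while the zero form has every weight, also one below
  \<open>g + 1\<close>.\<close>

lemma weighted_form_pCons:
  "weighted_form g d (pCons P F) \<longleftrightarrow>
     (P = 0 \<or> homogeneous d P) \<and> (F = 0 \<or> d \<ge> g + 1 \<and> weighted_form g (d - (g + 1)) F)"
  (is "?L \<longleftrightarrow> ?R")
proof
  assume L: ?L
  have "homogeneous d P"
    unfolding homogeneous_def
  proof (intro allI impI)
    fix i j assume "coeff (coeff P j) i \<noteq> 0"
    then show "i + j = d"
      using L[unfolded weighted_form_def, rule_format, of 0 j i] by simp
  qed
  moreover have F: "i + j + (g + 1) * l + (g + 1) = d"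
    if "coeff (coeff (coeff F l) j) i \<noteq> 0" for i j l
    using L[unfolded weighted_form_def, rule_format, of "Suc l" j i] that by simp
  have "d \<ge> g + 1 \<and> weighted_form g (d - (g + 1)) F" if "F \<noteq> 0"
  proof -
    from that obtain l where "coeff F l \<noteq> 0" by (metis leading_coeff_0_iff)
    then obtain j where "coeff (coeff F l) j \<noteq> 0" by (metis leading_coeff_0_iff)
    then obtain i where "coeff (coeff (coeff F l) j) i \<noteq> 0" by (metis leading_coeff_0_iff)
    from F[OF this] F show ?thesis by (force simp: weighted_form_def)
  qed
  ultimately show ?R by blast
next
  assume R: ?R
  show ?L
    unfolding weighted_form_def
  proof (intro allI impI)
    fix i j l assume nz: "coeff (coeff (coeff (pCons P F) l) j) i \<noteq> 0"
    show "i + j + (g + 1) * l = d"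
    proof (cases l)
      case 0
      then show ?thesis using nz R by (auto simp: homogeneous_def)
    next
      case (Suc m)
      then have "d \<ge> g + 1" "weighted_form g (d - (g + 1)) F" using nz R by auto
      moreover from this have "i + j + (g + 1) * m = d - (g + 1)"
        using nz Suc by (auto simp: weighted_form_def)
      ultimately show ?thesis using Suc by simp
    qed
  qed
qed

lemma eval3_scale:
  assumes "rhom \<phi>" "weighted_form g d F"
  shows "eval3 \<phi> F (c * x, c ^ (g + 1) * y, c * z) = c ^ d * eval3 \<phi> F (x, y, z)"
  using assms(2)
proof (induction F arbitrary: d)
  case (pCons P F)
  have "eval2 \<phi> P (c * x) (c * z) = c ^ d * eval2 \<phi> P x z"
    using pCons.prems by (auto simp: weighted_form_pCons intro: eval2_scale[OF assms(1)])
  moreover have eq: "c ^ (g + 1) * eval3 \<phi> F (c * x, c ^ (g + 1) * y, c * z) = c ^ d * eval3 \<phi> F (x, y, z)"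
  proof (cases "F = 0")
    case False
    with pCons.prems have d: "d \<ge> g + 1" and wf: "weighted_form g (d - (g + 1)) F"
      by (auto simp: weighted_form_pCons)
    have "c ^ d = c ^ (g + 1) * c ^ (d - (g + 1))" using d by (simp add: power_add[symmetric] del: power_Suc)
    then show ?thesis using pCons.IH[OF wf] by (simp add: mult.assoc del: eval3.simps)
  qed simp
  have "c ^ (g + 1) * y * eval3 \<phi> F (c * x, c ^ (g + 1) * y, c * z) =
      c ^ d * (y * eval3 \<phi> F (x, y, z))"
    using arg_cong[OF eq, of "\<lambda>t. y * t"] by (simp only: ac_simps)
  ultimately show ?case
    by (simp only: eval3_pCons distrib_left)
qed simp

lemma weighted_form_0 [simp]: "weighted_form g d 0"
  by (simp add: weighted_form_def)

lemma weighted_form_add: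
  "weighted_form g d F \<Longrightarrow> weighted_form g d G \<Longrightarrow> weighted_form g d (F + G)"
  unfolding weighted_form_def by (metis add_0 coeff_add)

lemma weighted_form_mult:
  assumes "weighted_form g d F" "weighted_form g e G"
  shows "weighted_form g (d + e) (F * G)"
  unfolding weighted_form_def
proof (intro allI impI)
  fix i j l assume "coeff (coeff (coeff (F * G) l) j) i \<noteq> 0"
  then have "(\<Sum>l'\<le>l. \<Sum>j'\<le>j. \<Sum>i'\<le>i. coeff (coeff (coeff F l') j') i' *
      coeff (coeff (coeff G (l - l')) (j - j')) (i - i')) \<noteq> 0"
    by (simp add: coeff_mult coeff_sum)
  then obtain l' j' i' where le: "l' \<le> l" "j' \<le> j" "i' \<le> i" and
    "coeff (coeff (coeff F l') j') i' * coeff (coeff (coeff G (l - l')) (j - j')) (i - i') \<noteq> 0"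
    by (metis (no_types, lifting) sum.neutral atMost_iff)
  then have "coeff (coeff (coeff F l') j') i' \<noteq> 0"
    "coeff (coeff (coeff G (l - l')) (j - j')) (i - i') \<noteq> 0" by auto
  then have "i' + j' + (g + 1) * l' = d" "(i - i') + (j - j') + (g + 1) * (l - l') = e"
    using assms by (auto simp: weighted_form_def)
  moreover have "(g + 1) * l = (g + 1) * l' + (g + 1) * (l - l')"
    using le by (metis add_mult_distrib2 le_add_diff_inverse)
  ultimately show "i + j + (g + 1) * l = d + e"
    using le by linarith
qed

lemma weighted_form_power: "weighted_form g d F \<Longrightarrow> weighted_form g (n * d) (F ^ n)"
proof (induction n)
  case 0
  then show ?case by (simp add: weighted_form_def coeff_1)
next
  case (Suc n)
  then show ?case using weighted_form_mult[of g d F "n * d" "F ^ n"] by simp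
qed

lemma weighted_form_gens:
  "weighted_form g 0 [:[:[:c:]:]:]"
  "weighted_form g 1 [:[:[:0, c:], [:d:]:]:]"
  "weighted_form g (g + 1) [:0, 1:]"
proof -
  show "weighted_form g 0 [:[:[:c:]:]:]"
    by (auto simp: weighted_form_def coeff_pCons split: nat.splits)
  show "weighted_form g 1 [:[:[:0, c:], [:d:]:]:]"
    by (auto simp: weighted_form_def coeff_pCons split: nat.splits)
  show "weighted_form g (g + 1) [:0, 1:]"
    by (auto simp: weighted_form_def coeff_pCons coeff_1 split: nat.splits if_splits)
qed

lemma eval3_gens:
  assumes "rhom \<phi>"
  shows "eval3 \<phi> [:[:[:c:]:]:] (x, y, z) = \<phi> c"
    "eval3 \<phi> [:[:[:0, c:], [:d:]:]:] (x, y, z) = \<phi> c * x + \<phi> d * z"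
    "eval3 \<phi> [:0, 1:] (x, y, z) = y"
proof -
  have [simp]: "eval2 \<phi> 1 x z = 1" using rhom.one[OF rhom_eval2[OF assms]] .
  show "eval3 \<phi> [:[:[:c:]:]:] (x, y, z) = \<phi> c"
    "eval3 \<phi> [:[:[:0, c:], [:d:]:]:] (x, y, z) = \<phi> c * x + \<phi> d * z"
    "eval3 \<phi> [:0, 1:] (x, y, z) = y"
    using rhom.zero[OF assms]
    by (simp_all add: eval3_pCons eval2_pCons[OF assms] map_poly_pCons  algebra_simps del: eval3.simps)
qed

section \<open>Extension of automorphisms to an algebraic closure\<close>

text \<open>A partial isomorphism between subrings of a field is encoded by its graph.\<close>

definition partial_iso :: "('l::field \<times> 'l) set \<Rightarrow> bool" where
  "partial_iso \<Gamma> \<longleftrightarrow> (1, 1) \<in> \<Gamma> \<and>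
     (\<forall>a b c d. (a, b) \<in> \<Gamma> \<longrightarrow> (c, d) \<in> \<Gamma> \<longrightarrow> (a - c, b - d) \<in> \<Gamma> \<and> (a * c, b * d) \<in> \<Gamma>) \<and>
     (\<forall>a b. (a, b) \<in> \<Gamma> \<longrightarrow> (a = 0 \<longleftrightarrow> b = 0))"

text \<open>The partial isomorphism applied to coefficients. Pairs of polynomials are carried along
  together, so that every computation over the domain is mirrored over the range.\<close>

definition poly_graph :: "('l::field \<times> 'l) set \<Rightarrow> ('l poly \<times> 'l poly) set" where
  "poly_graph \<Gamma> = {(P, Q). \<forall>i. (coeff P i, coeff Q i) \<in> \<Gamma>}"

locale partial_iso_graph =
  fixes \<Gamma> :: "('l::field \<times> 'l) set"
  assumes good: "partial_iso \<Gamma>"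
begin

lemma one: "(1, 1) \<in> \<Gamma>"
  and diff: "(a, b) \<in> \<Gamma> \<Longrightarrow> (c, d) \<in> \<Gamma> \<Longrightarrow> (a - c, b - d) \<in> \<Gamma>"
  and mult: "(a, b) \<in> \<Gamma> \<Longrightarrow> (c, d) \<in> \<Gamma> \<Longrightarrow> (a * c, b * d) \<in> \<Gamma>"
  and eq_0: "(a, b) \<in> \<Gamma> \<Longrightarrow> a = 0 \<longleftrightarrow> b = 0"
  using good unfolding partial_iso_def by blast+

lemma zero: "(0, 0) \<in> \<Gamma>"
  using diff[OF one one] by simp

lemma add: "(a, b) \<in> \<Gamma> \<Longrightarrow> (c, d) \<in> \<Gamma> \<Longrightarrow> (a + c, b + d) \<in> \<Gamma>"
  using diff[OF _ diff[OF zero], of a b c d] by simp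

lemma sum: "(\<And>i. i \<in> A \<Longrightarrow> (f i, h i) \<in> \<Gamma>) \<Longrightarrow> (\<Sum>i\<in>A. f i, \<Sum>i\<in>A. h i) \<in> \<Gamma>"
  by (induction A rule: infinite_finite_induct) (auto intro: add zero)

abbreviation "PG \<equiv> poly_graph \<Gamma>"

lemma coeffs: "(P, Q) \<in> PG \<Longrightarrow> (coeff P i, coeff Q i) \<in> \<Gamma>"
  by (auto simp: poly_graph_def)

lemma poly_diff: "(P, Q) \<in> PG \<Longrightarrow> (R, S) \<in> PG \<Longrightarrow> (P - R, Q - S) \<in> PG"
  by (auto simp: poly_graph_def intro: diff)

lemma poly_add: "(P, Q) \<in> PG \<Longrightarrow> (R, S) \<in> PG \<Longrightarrow> (P + R, Q + S) \<in> PG"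
  by (auto simp: poly_graph_def intro: add)

lemma poly_mult: "(P, Q) \<in> PG \<Longrightarrow> (R, S) \<in> PG \<Longrightarrow> (P * R, Q * S) \<in> PG"
  by (auto simp: poly_graph_def coeff_mult intro!: sum mult)

lemma poly_monom: "(a, b) \<in> \<Gamma> \<Longrightarrow> (monom a n, monom b n) \<in> PG"
  by (auto simp: poly_graph_def zero)

lemma poly_smult: "(a, b) \<in> \<Gamma> \<Longrightarrow> (P, Q) \<in> PG \<Longrightarrow> (smult a P, smult b Q) \<in> PG"
  by (auto simp: poly_graph_def intro: mult)

lemma poly_eq_0: "(P, Q) \<in> PG \<Longrightarrow> P = 0 \<longleftrightarrow> Q = 0"
  unfolding poly_eq_iff coeff_0 using coeffs eq_0 by metis

lemma degree_eq:
  assumes "(P, Q) \<in> PG"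
  shows "degree P = degree Q"
proof -
  have "coeff P i = 0 \<longleftrightarrow> coeff Q i = 0" for i
    by (rule eq_0[OF coeffs[OF assms]])
  then show ?thesis by (intro degree_cong) auto
qed

lemma lead_coeffs: "(P, Q) \<in> PG \<Longrightarrow> (lead_coeff P, lead_coeff Q) \<in> \<Gamma>"
  using coeffs degree_eq by metis

text \<open>The domain of \<open>\<Gamma>\<close> is only a ring, so division with remainder costs
  powers of the leading coefficient. Related polynomials have equal degrees and related leading
  coefficients, hence the same division steps work on both sides at once.\<close>

lemma pseudo_division:
  assumes "(m1, m2) \<in> PG" "m1 \<noteq> 0" "(P, Q) \<in> PG"
  shows "\<exists>k A B R S. (A, B) \<in> PG \<and> (R, S) \<in> PG \<and> smult (lead_coeff m1 ^ k) P = A * m1 + R \<and>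
    smult (lead_coeff m2 ^ k) Q = B * m2 + S \<and> (R = 0 \<or> degree R < degree m1)"
  using assms(3)
\<comment> \<open>This measure separates the zero polynomial from the nonzero constants, which also
  have degree 0; for constant \<open>m1\<close> the last step passes from one to the other.\<close>
proof (induction "if P = 0 then 0 else Suc (degree P)" arbitrary: P Q rule: less_induct)
  case less
  have zero_PG: "(0, 0) \<in> PG" by (simp add: poly_graph_def zero)
  show ?case
  proof (cases "P = 0 \<or> degree P < degree m1")
    case True
    have "smult (lead_coeff m1 ^ 0) P = 0 * m1 + P" "smult (lead_coeff m2 ^ 0) Q = 0 * m2 + Q"
      by simp_all
    then show ?thesis using True zero_PG less.prems by blast
  next
    case False
    define e where "e = degree P - degree m1"
    define M1 where "M1 = monom (lead_coeff P) e"
    define M2 where "M2 = monom (lead_coeff Q) e"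
    define P' where "P' = smult (lead_coeff m1) P - M1 * m1"
    define Q' where "Q' = smult (lead_coeff m2) Q - M2 * m2"
    have M: "(M1, M2) \<in> PG"
      unfolding M1_def M2_def by (intro poly_monom lead_coeffs less.prems)
    have PQ': "(P', Q') \<in> PG"
      unfolding P'_def Q'_def
      by (intro poly_diff poly_smult poly_mult M lead_coeffs assms less.prems)
    have dM: "degree (M1 * m1) = degree P"
      using False assms by (simp add: M1_def e_def degree_mult_eq degree_monom_eq monom_eq_0_iff)
    have "coeff (M1 * m1) (degree P) = lead_coeff P * lead_coeff m1"
      using dM lead_coeff_mult[of M1 m1] lead_coeff_monom[of "lead_coeff P" e]
      by (simp add: M1_def del: lead_coeff_monom)
    then have "coeff P' (degree P) = 0" by (simp add: P'_def mult.commute)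
    moreover have "degree P' \<le> degree P"
      unfolding P'_def by (intro degree_diff_le) (auto simp: dM)
    ultimately have "P' = 0 \<or> degree P' < degree P"
      by (intro eq_zero_or_degree_less)
    then have "(if P' = 0 then 0 else Suc (degree P')) < (if P = 0 then 0 else Suc (degree P))"
      using False by auto
    from less.hyps[OF this PQ'] obtain k A B R S where IH: "(A, B) \<in> PG" "(R, S) \<in> PG"
      "smult (lead_coeff m1 ^ k) P' = A * m1 + R" "smult (lead_coeff m2 ^ k) Q' = B * m2 + S"
      "R = 0 \<or> degree R < degree m1"
      by blast
    have pow: "(lead_coeff m1 ^ k, lead_coeff m2 ^ k) \<in> \<Gamma>"
      by (induction k) (auto intro: one mult lead_coeffs assms(1))
    have "(smult (lead_coeff m1 ^ k) M1 + A, smult (lead_coeff m2 ^ k) M2 + B) \<in> PG"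
      by (intro poly_add poly_smult M pow IH)
    moreover have "smult (lead_coeff m1 ^ Suc k) P = (smult (lead_coeff m1 ^ k) M1 + A) * m1 + R"
      using IH(3) by (simp add: P'_def smult_diff_right algebra_simps)
    moreover have "smult (lead_coeff m2 ^ Suc k) Q = (smult (lead_coeff m2 ^ k) M2 + B) * m2 + S"
      using IH(4) by (simp add: Q'_def smult_diff_right algebra_simps)
    ultimately show ?thesis using IH by blast
  qed
qed

text \<open>Adjoins \<open>a\<close> to the domain with image \<open>b\<close>. The new graph
  consists of the values of related polynomials at \<open>a\<close> and \<open>b\<close>; what has
  to be shown is that one value is zero exactly when the other is.\<close>

lemma extend:
  assumes m: "(m1, m2) \<in> PG" "m1 \<noteq> 0" "poly m1 a = 0" "poly m2 b = 0"
    and minimal': "\<forall>P Q. (P, Q) \<in> PG \<longrightarrow> P \<noteq> 0 \<longrightarrow> poly P a = 0 \<longrightarrow> degree m1 \<le> degree P"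
  shows "\<exists>\<Gamma>'. partial_iso \<Gamma>' \<and> \<Gamma> \<subseteq> \<Gamma>' \<and> (a, b) \<in> \<Gamma>'"
proof -
  note minimal = minimal'[rule_format]
  have m2: "m2 \<noteq> 0" using m poly_eq_0 by blast
  have pow_nz: "lead_coeff m1 ^ k \<noteq> 0" "lead_coeff m2 ^ k \<noteq> 0" for k
    using m m2 by auto
  \<comment> \<open>Minimality at \<open>a\<close> passes to \<open>b\<close>. A pair of least
    degree vanishing at \<open>b\<close> divides the given one. By minimality of \<open>m1\<close>
    its first member \<open>N1\<close> is nonzero at \<open>a\<close>, so the cofactor
    \<open>A\<close> has the root \<open>a\<close> and already the full degree of \<open>m1\<close>.
    Then the pair is constant, which contradicts the root \<open>b\<close>.\<close>
  have small: "P = 0" if PQ: "(P, Q) \<in> PG" "poly Q b = 0" "degree P < degree m1" for P Q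
  proof (rule ccontr)
    assume "P \<noteq> 0"
    define W where "W n \<longleftrightarrow> (\<exists>P Q. (P, Q) \<in> PG \<and> poly Q b = 0 \<and> P \<noteq> 0 \<and> degree P = n)" for n
    define n where "n = (LEAST n. W n)"
    have "W (degree P)" using PQ \<open>P \<noteq> 0\<close> by (auto simp: W_def)
    then have "W n" "n \<le> degree P" unfolding n_def by (rule LeastI, rule Least_le)
    then obtain N1 N2 where N: "(N1, N2) \<in> PG" "poly N2 b = 0" "N1 \<noteq> 0" "degree N1 = n"
      by (auto simp: W_def)
    obtain k A B R S where div: "(A, B) \<in> PG" "(R, S) \<in> PG"
      "smult (lead_coeff N1 ^ k) m1 = A * N1 + R" "smult (lead_coeff N2 ^ k) m2 = B * N2 + S"
      "R = 0 \<or> degree R < degree N1"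
      using pseudo_division[OF N(1,3) m(1)] by blast
    have "poly S b = 0"
      using arg_cong[OF div(4), of "\<lambda>p. poly p b"] m N by simp
    have "R = 0"
    proof (rule ccontr)
      assume "R \<noteq> 0"
      then have "W (degree R)" using div \<open>poly S b = 0\<close> by (auto simp: W_def)
      then have "n \<le> degree R" unfolding n_def by (rule Least_le)
      then show False using div \<open>R \<noteq> 0\<close> N by simp
    qed
    then have eq: "smult (lead_coeff N1 ^ k) m1 = A * N1" using div by simp
    have "A * N1 \<noteq> 0" using eq[symmetric] m N(3) by auto
    then have A: "A \<noteq> 0" by auto
    have deg: "degree m1 = degree A + degree N1"
      using arg_cong[OF eq, of degree] degree_mult_eq[OF A N(3)] N(3) by simp
    have "poly A a * poly N1 a = 0"
      using arg_cong[OF eq, of "\<lambda>p. poly p a"] m by simp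
    moreover have "poly N1 a \<noteq> 0"
      using minimal[OF N(1,3)] N \<open>n \<le> degree P\<close> PQ(3) by auto
    ultimately have "poly A a = 0" by simp
    then have "degree m1 \<le> degree A" using minimal[OF div(1) A] by simp
    then have "degree N1 = 0" using deg by simp
    then have "degree N2 = 0" using degree_eq N by simp
    then obtain c where "N2 = [:c:]" by (metis degree_eq_zeroE)
    then show False using N poly_eq_0[OF N(1)] by simp
  qed
  define \<Gamma>' where "\<Gamma>' = {(poly P a, poly Q b) | P Q. (P, Q) \<in> PG}"
  have const: "([:c:], [:d:]) \<in> PG" if "(c, d) \<in> \<Gamma>" for c d
    using poly_monom[OF that, of 0] by (simp add: monom_0)
  have "([:0, 1:], [:0, 1:]) \<in> PG"
    using poly_monom[OF one, of 1] by (simp add: monom_altdef)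
  then have "(a, b) \<in> \<Gamma>'" unfolding \<Gamma>'_def by force
  moreover have "\<Gamma> \<subseteq> \<Gamma>'"
  proof (rule subrelI)
    fix c d assume "(c, d) \<in> \<Gamma>"
    from const[OF this] show "(c, d) \<in> \<Gamma>'" unfolding \<Gamma>'_def by force
  qed
  moreover have "partial_iso \<Gamma>'"
    unfolding partial_iso_def
  proof (intro conjI allI impI)
    show "(1, 1) \<in> \<Gamma>'" using const[OF one] by (force simp: \<Gamma>'_def)
  next
    fix c d c' d' assume "(c, d) \<in> \<Gamma>'" "(c', d') \<in> \<Gamma>'"
    then obtain P Q P' Q' where *: "(P, Q) \<in> PG" "(P', Q') \<in> PG"
      "c = poly P a" "d = poly Q b" "c' = poly P' a" "d' = poly Q' b"
      by (auto simp: \<Gamma>'_def)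
    show "(c - c', d - d') \<in> \<Gamma>'" using poly_diff[OF *(1,2)] * by (force simp: \<Gamma>'_def)
    show "(c * c', d * d') \<in> \<Gamma>'" using poly_mult[OF *(1,2)] * by (force simp: \<Gamma>'_def)
  next
    fix c d assume "(c, d) \<in> \<Gamma>'"
    then obtain P Q where *: "(P, Q) \<in> PG" "c = poly P a" "d = poly Q b"
      by (auto simp: \<Gamma>'_def)
    \<comment> \<open>Up to nonzero factors the two values are those of the remainders, and by the
      two minimality statements each of them vanishes exactly when \<open>R\<close> is zero.\<close>
    obtain k A B R S where div: "(A, B) \<in> PG" "(R, S) \<in> PG"
      "smult (lead_coeff m1 ^ k) P = A * m1 + R" "smult (lead_coeff m2 ^ k) Q = B * m2 + S"
      "R = 0 \<or> degree R < degree m1"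
      using pseudo_division[OF m(1,2) *(1)] by blast
    have Ra: "lead_coeff m1 ^ k * c = poly R a"
      using arg_cong[OF div(3), of "\<lambda>p. poly p a"] m * by simp
    have Sb: "lead_coeff m2 ^ k * d = poly S b"
      using arg_cong[OF div(4), of "\<lambda>p. poly p b"] m * by simp
    have "poly R a = 0 \<longleftrightarrow> R = 0"
      using minimal[OF div(2)] div(5) by (cases "R = 0") auto
    moreover have "poly S b = 0 \<longleftrightarrow> R = 0"
      using small[OF div(2)] div(5) poly_eq_0[OF div(2)] by (cases "R = 0") auto
    ultimately show "c = 0 \<longleftrightarrow> d = 0"
      using Ra Sb pow_nz[of k] by (metis mult_eq_0_iff)
  qed
  ultimately show ?thesis by blast
qed

end

text \<open>Take a pair of least degree whose first member vanishes at \<open>a\<close>. Its second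
  member has a root since the field is algebraically closed, so \<open>extend\<close> applies, and
  by maximality it adds nothing new.\<close>

lemma maximal_partial_iso_total:
  fixes \<Gamma> :: "('l::alg_closed_field \<times> 'l) set"
  assumes good: "partial_iso \<Gamma>"
    and maximal: "\<And>\<Gamma>'. partial_iso \<Gamma>' \<Longrightarrow> \<Gamma> \<subseteq> \<Gamma>' \<Longrightarrow> \<Gamma>' = \<Gamma>"
    and algebraic: "\<And>a. \<exists>P Q. (P, Q) \<in> poly_graph \<Gamma> \<and> P \<noteq> 0 \<and> poly P a = 0"
  shows "\<exists>b. (a, b) \<in> \<Gamma>"
proof -
  interpret partial_iso_graph \<Gamma> by unfold_locales fact
  define W where "W n \<longleftrightarrow> (\<exists>P Q. (P, Q) \<in> PG \<and> P \<noteq> 0 \<and> poly P a = 0 \<and> degree P = n)" for n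
  define n where "n = (LEAST n. W n)"
  have "\<exists>n. W n" using algebraic[of a] by (auto simp: W_def)
  then have "W n" unfolding n_def by (rule LeastI_ex)
  then obtain m1 m2 where m: "(m1, m2) \<in> PG" "m1 \<noteq> 0" "poly m1 a = 0" "degree m1 = n"
    by (auto simp: W_def)
  have minimal: "\<forall>P Q. (P, Q) \<in> PG \<longrightarrow> P \<noteq> 0 \<longrightarrow> poly P a = 0 \<longrightarrow> degree m1 \<le> degree P"
    unfolding m(4) n_def by (intro allI impI Least_le) (unfold W_def, blast)
  have "degree m1 \<noteq> 0"
    using m by (metis degree_eq_zeroE poly_const_conv pCons_0_0)
  then have "degree m2 > 0" using degree_eq[OF m(1)] by simp
  then obtain b where "poly m2 b = 0" using alg_closed_imp_poly_has_root by blast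
  from extend[OF m(1-3) this minimal] obtain \<Gamma>'
    where "partial_iso \<Gamma>'" "\<Gamma> \<subseteq> \<Gamma>'" "(a, b) \<in> \<Gamma>'" by blast
  with maximal[of \<Gamma>'] show ?thesis by blast
qed

lemma partial_iso_converse: "partial_iso \<Gamma> \<Longrightarrow> partial_iso (\<Gamma>\<inverse>)"
  unfolding partial_iso_def by blast

lemma poly_graph_converse: "poly_graph (\<Gamma>\<inverse>) = (poly_graph \<Gamma>)\<inverse>"
  by (auto simp: poly_graph_def)

lemma partial_iso_Union:
  assumes "C \<noteq> {}" "subset.chain A C" "\<And>\<Gamma>. \<Gamma> \<in> C \<Longrightarrow> partial_iso \<Gamma>"
  shows "partial_iso (\<Union>C)"
  unfolding partial_iso_def
proof (intro conjI allI impI)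
  show "(1, 1) \<in> \<Union>C" using assms(1,3) unfolding partial_iso_def by blast
next
  fix a b c d assume "(a, b) \<in> \<Union>C" "(c, d) \<in> \<Union>C"
  then obtain U V where "U \<in> C" "(a, b) \<in> U" "V \<in> C" "(c, d) \<in> V" by blast
  moreover have "U \<subseteq> V \<or> V \<subseteq> U" using assms(2) calculation by (auto simp: subset_chain_def)
  ultimately obtain Z where "Z \<in> C" "(a, b) \<in> Z" "(c, d) \<in> Z" by blast
  then show "(a - c, b - d) \<in> \<Union>C" "(a * c, b * d) \<in> \<Union>C"
    using assms(3)[of Z] unfolding partial_iso_def by blast+
next
  fix a b assume "(a, b) \<in> \<Union>C"
  then show "a = 0 \<longleftrightarrow> b = 0" using assms(3) unfolding partial_iso_def by blast
qed

text \<open>The polynomials vanishing at \<open>r\<close> are the multiples of one of least degree,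
  \<open>m\<close>. An irreducible one among them is \<open>m\<close> up to a unit.\<close>

lemma irreducible_dvd_if_common_root:
  fixes \<phi> :: "'a::field \<Rightarrow> 'l::field" and p q :: "'a poly"
  assumes \<phi>: "rhom \<phi>" and irr: "irreducible p"
    and p: "poly (map_poly \<phi> p) r = 0" and q: "poly (map_poly \<phi> q) r = 0"
  shows "p dvd q"
proof -
  interpret \<phi>: rhom \<phi> by fact
  interpret \<phi>p: rhom "map_poly \<phi>" by (rule \<phi>.map_poly)
  define W where "W n \<longleftrightarrow> (\<exists>m. m \<noteq> 0 \<and> poly (map_poly \<phi> m) r = 0 \<and> degree m = n)" for n
  have "p \<noteq> 0" using irr by auto
  then have "W (degree p)" using p unfolding W_def by blast
  then have "W (LEAST n. W n)" by (rule LeastI)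
  then obtain m where m: "m \<noteq> 0" "poly (map_poly \<phi> m) r = 0" "degree m = (LEAST n. W n)"
    by (auto simp: W_def)
  have dvd: "m dvd f" if "poly (map_poly \<phi> f) r = 0" for f
  proof (rule ccontr)
    assume "\<not> m dvd f"
    then have "f mod m \<noteq> 0" by (simp add: dvd_eq_mod_eq_0)
    moreover have "poly (map_poly \<phi> (f mod m)) r = 0"
    proof -
      have "poly (map_poly \<phi> (f div m * m + f mod m)) r = 0" using that by simp
      then show ?thesis unfolding \<phi>p.add \<phi>p.mult using m(2) by simp
    qed
    ultimately have "degree m \<le> degree (f mod m)"
      unfolding m(3) by (intro Least_le) (auto simp: W_def)
    with \<open>f mod m \<noteq> 0\<close> show False using degree_mod_less[OF m(1), of f] by simp
  qed
  have "\<not> m dvd 1"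
  proof
    assume "m dvd 1"
    then obtain t where "1 = m * t" by (auto simp: dvd_def)
    from arg_cong[OF this, of "\<lambda>h. poly (map_poly \<phi> h) r"] m show False
      by (simp add: \<phi>p.mult)
  qed
  obtain t where t: "p = m * t" using dvd[OF p] by (auto simp: dvd_def)
  then have "t dvd 1" using irr \<open>\<not> m dvd 1\<close> by (auto simp: irreducible_def)
  then have "p dvd m" unfolding t by (metis mult_dvd_mono dvd_refl mult.right_neutral)
  with dvd[OF q] show ?thesis by (rule dvd_trans[rotated])
qed

text \<open>The source of every automorphism below: the hyperelliptic involution, the lifts of
  Galois elements to functions, and the Galois elements permuting the roots of an irreducible
  polynomial. Starting from the graph of \<open>\<sigma>\<close>, the pair \<open>(r1, r2)\<close>
  is adjoined first, so that the maximal extension respects it.\<close>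

theorem alg_closure_automorphism_extension:
  fixes \<sigma> :: "'a::field \<Rightarrow> 'a" and p :: "'a poly"
  assumes \<sigma>: "rhom \<sigma>" "bij \<sigma>" and irr: "irreducible p"
    and r1: "poly (map_poly to_ac p) r1 = 0"
    and r2: "poly (map_poly to_ac (map_poly \<sigma> p)) r2 = 0"
  shows "\<exists>\<tau>. rhom \<tau> \<and> bij \<tau> \<and> (\<forall>c. \<tau> (to_ac c) = to_ac (\<sigma> c)) \<and> \<tau> r1 = r2"
proof -
  interpret \<sigma>: rhom \<sigma> by fact
  interpret \<sigma>p: rhom "map_poly \<sigma>" by (rule \<sigma>.map_poly)
  interpret tp: rhom "map_poly to_ac" by (rule rhom.map_poly[OF rhom_to_ac])
  define \<Gamma>0 where "\<Gamma>0 = {(to_ac c, to_ac (\<sigma> c)) | c. True}"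
  have "partial_iso \<Gamma>0"
    unfolding partial_iso_def \<Gamma>0_def
  proof (intro conjI allI impI)
    show "(1, 1) \<in> {(to_ac c, to_ac (\<sigma> c)) | c. True}"
      using \<sigma>.one by (metis (mono_tags, lifting) mem_Collect_eq to_ac_1)
  qed (auto simp: rhom_eq_0_iff[OF \<sigma>(1)] simp flip: to_ac_diff to_ac_mult \<sigma>.diff \<sigma>.mult)
  then interpret g0: partial_iso_graph \<Gamma>0 by unfold_locales
  have PG0: "(map_poly to_ac q, map_poly to_ac (map_poly \<sigma> q)) \<in> poly_graph \<Gamma>0" for q
    by (auto simp: poly_graph_def \<Gamma>0_def coeff_map_poly)
  have PG0_D: "\<exists>q. P = map_poly to_ac q" if "(P, Q) \<in> poly_graph \<Gamma>0" for P Q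
  proof -
    have "coeff P i = to_ac (of_ac (coeff P i))" for i
      using that by (auto simp: poly_graph_def \<Gamma>0_def) (metis of_ac_to_ac prod.inject)
    then have "P = map_poly to_ac (map_poly of_ac P)"
      by (intro poly_eqI) (simp add: coeff_map_poly)
    then show ?thesis by blast
  qed
  have deg_to_ac: "degree (map_poly to_ac q) = degree q" for q :: "'a poly"
    by (rule degree_map_poly) simp
  have nz_to_ac: "map_poly to_ac q = 0 \<longleftrightarrow> q = 0" for q :: "'a poly"
    by (auto simp: poly_eq_iff coeff_map_poly)
  have minimal: "\<forall>P Q. (P, Q) \<in> poly_graph \<Gamma>0 \<longrightarrow> P \<noteq> 0 \<longrightarrow> poly P r1 = 0 \<longrightarrow>
      degree (map_poly to_ac p) \<le> degree P"
  proof (intro allI impI)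
    fix P Q assume PQ: "(P, Q) \<in> poly_graph \<Gamma>0" "P \<noteq> 0" "poly P r1 = 0"
    obtain q where q: "P = map_poly to_ac q" using PG0_D[OF PQ(1)] by blast
    have "p dvd q"
      using irreducible_dvd_if_common_root[OF rhom_to_ac irr r1] PQ(3) q by blast
    then have "degree p \<le> degree q" using PQ q by (intro dvd_imp_degree_le) (auto simp: nz_to_ac)
    then show "degree (map_poly to_ac p) \<le> degree P" by (simp add: q deg_to_ac)
  qed
  have "p \<noteq> 0" using irr by auto
  then obtain \<Gamma>1 where \<Gamma>1: "partial_iso \<Gamma>1" "\<Gamma>0 \<subseteq> \<Gamma>1" "(r1, r2) \<in> \<Gamma>1"
    using g0.extend[OF PG0 _ r1 r2 minimal] by (auto simp: nz_to_ac)
  define A where "A = {\<Gamma>. partial_iso \<Gamma> \<and> \<Gamma>1 \<subseteq> \<Gamma>}"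
  have "\<exists>M\<in>A. \<forall>U\<in>A. M \<subseteq> U \<longrightarrow> U = M"
  proof (rule subset_Zorn_nonempty)
    show "A \<noteq> {}" using \<Gamma>1 by (auto simp: A_def)
  next
    fix C assume C: "C \<noteq> {}" "subset.chain A C"
    then have "C \<subseteq> A" by (auto simp: subset_chain_def)
    then show "\<Union>C \<in> A"
      using partial_iso_Union[OF C] C(1) by (fastforce simp: A_def)
  qed
  then obtain M where M: "partial_iso M" "\<Gamma>1 \<subseteq> M"
    and max: "\<And>U. partial_iso U \<Longrightarrow> M \<subseteq> U \<Longrightarrow> U = M"
    by (auto simp: A_def)
  interpret M: partial_iso_graph M by unfold_locales fact
  have \<Gamma>0M: "\<Gamma>0 \<subseteq> M" using M \<Gamma>1 by blast
  then have PG0M: "poly_graph \<Gamma>0 \<subseteq> poly_graph M" by (auto simp: poly_graph_def)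
  have total: "\<exists>b. (a, b) \<in> M" for a
  proof (rule maximal_partial_iso_total[OF M(1) max])
    fix a :: "'a alg_closure"
    obtain q where "q \<noteq> 0" "poly (map_poly to_ac q) a = 0" using alg_closure_algebraic .
    then show "\<exists>P Q. (P, Q) \<in> poly_graph M \<and> P \<noteq> 0 \<and> poly P a = 0"
      using PG0 PG0M nz_to_ac by blast
  qed
  \<comment> \<open>Surjectivity is totality of the converse graph, which is again a maximal partial
    isomorphism.\<close>
  have surj: "\<exists>a. (a, b) \<in> M" for b
  proof -
    have "\<exists>a. (b, a) \<in> M\<inverse>"
    proof (rule maximal_partial_iso_total[OF partial_iso_converse[OF M(1)]])
      fix U assume "partial_iso U" "M\<inverse> \<subseteq> U"
      then have "U\<inverse> = M" by (intro max partial_iso_converse) auto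
      then show "U = M\<inverse>" by auto
    next
      fix a :: "'a alg_closure"
      obtain q where q: "q \<noteq> 0" "poly (map_poly to_ac q) a = 0" using alg_closure_algebraic .
      \<comment> \<open>The converse graph relates a polynomial to its preimage under
        \<open>\<sigma>\<close>, so the coefficients of \<open>q\<close> have to be pulled
        back.\<close>
      define q' where "q' = map_poly (inv_into UNIV \<sigma>) q"
      have "map_poly \<sigma> q' = q"
        using \<sigma> by (intro poly_eqI)
          (simp add: q'_def coeff_map_poly rhom.zero[OF rhom_inv] bij_is_surj surj_f_inv_f)
      then have "(map_poly to_ac q, map_poly to_ac q') \<in> poly_graph (M\<inverse>)"
        using PG0[of q'] PG0M by (auto simp: poly_graph_converse)
      then show "\<exists>P Q. (P, Q) \<in> poly_graph (M\<inverse>) \<and> P \<noteq> 0 \<and> poly P a = 0"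
        using q nz_to_ac by blast
    qed
    then show ?thesis by auto
  qed
  have unique: "b = b'" if "(a, b) \<in> M" "(a, b') \<in> M" for a b b'
    using M.eq_0[OF M.diff[OF that]] by simp
  have unique': "a = a'" if "(a, b) \<in> M" "(a', b) \<in> M" for a a' b
    using M.eq_0[OF M.diff[OF that]] by simp
  define \<tau> where "\<tau> a = (THE b. (a, b) \<in> M)" for a
  have \<tau>: "\<tau> a = b \<longleftrightarrow> (a, b) \<in> M" for a b
    unfolding \<tau>_def using total[of a] unique by (metis the_equality)
  have \<tau>M: "(a, \<tau> a) \<in> M" for a using \<tau> by blast
  have "rhom \<tau>"
    by unfold_locales (simp_all add: \<tau> M.one M.add M.mult \<tau>M)
  moreover have "bij \<tau>"
    unfolding bij_def inj_def surj_def using \<tau> \<tau>M surj unique' by metis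
  moreover have "\<tau> (to_ac c) = to_ac (\<sigma> c)" for c
    using \<Gamma>0M by (auto simp: \<tau> \<Gamma>0_def)
  moreover have "\<tau> r1 = r2" using \<Gamma>1 M by (auto simp: \<tau>)
  ultimately show ?thesis by blast
qed

section \<open>Discrete valuation rings inside a field\<close>

text \<open>Ring and maximal ideal are plain subsets of the field, as in the definition of the order
  of vanishing. The uniformizer \<open>t\<close> is a parameter because different kinds of points
  need different ones.\<close>

locale dvr_set =
  fixes R M :: "'l::field set" and t :: 'l
  assumes R_0: "0 \<in> R" and R_1: "1 \<in> R"
    and R_add: "a \<in> R \<Longrightarrow> b \<in> R \<Longrightarrow> a + b \<in> R"
    and R_mult: "a \<in> R \<Longrightarrow> b \<in> R \<Longrightarrow> a * b \<in> R"
    and t: "t \<in> R" "t \<noteq> 0"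
    and M: "M = {t * r | r. r \<in> R}" and one_notin_M: "1 \<notin> M"
    and decomp: "f \<in> R \<Longrightarrow> f \<noteq> 0 \<Longrightarrow> \<exists>n u. u \<noteq> 0 \<and> u \<in> R \<and> inverse u \<in> R \<and> f = t ^ n * u"
begin

definition ring_unit :: "'l \<Rightarrow> bool" where
  "ring_unit u \<longleftrightarrow> u \<noteq> 0 \<and> u \<in> R \<and> inverse u \<in> R"

definition has_ord :: "'l \<Rightarrow> int \<Rightarrow> bool" where
  "has_ord f n \<longleftrightarrow> (\<exists>u. ring_unit u \<and> f = t powi n * u)"

lemma unit_1: "ring_unit 1"
  by (simp add: ring_unit_def R_1)

lemma unit_mult: "ring_unit u \<Longrightarrow> ring_unit v \<Longrightarrow> ring_unit (u * v)"
  by (simp add: ring_unit_def R_mult)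

lemma unit_inverse: "ring_unit u \<Longrightarrow> ring_unit (inverse u)"
  by (simp add: ring_unit_def)

lemma R_power: "a \<in> R \<Longrightarrow> a ^ n \<in> R"
  by (induction n) (auto intro: R_1 R_mult)

lemma inverse_t: "inverse t \<notin> R"
  using t one_notin_M unfolding M by (auto simp: field_simps)

lemma has_ord_power: "ring_unit u \<Longrightarrow> has_ord (t ^ n * u) (int n)"
  unfolding has_ord_def by (intro exI[of _ u]) simp

lemma unit_powi:
  assumes "ring_unit (t powi n)"
  shows "n = 0"
proof (rule ccontr)
  assume "n \<noteq> 0"
  \<comment> \<open>For either sign of \<open>n\<close> the power with exponent
    \<open>nat \<bar>n\<bar>\<close> is invertible in \<open>R\<close>; multiplying its inverse by
    the power with one factor less leaves \<open>inverse t\<close>.\<close>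
  have "inverse t = t ^ (nat \<bar>n\<bar> - 1) * inverse (t ^ nat \<bar>n\<bar>)"
    using t \<open>n \<noteq> 0\<close> by (cases "nat \<bar>n\<bar>") (auto simp: field_simps)
  moreover have "inverse (t ^ nat \<bar>n\<bar>) \<in> R"
    using assms by (cases "n \<ge> 0") (auto simp: ring_unit_def power_int_def power_inverse)
  ultimately have "inverse t \<in> R" by (metis R_mult R_power t(1))
  then show False using inverse_t by blast
qed

lemma has_ord_unique:
  assumes "has_ord f n" "has_ord f m"
  shows "n = m"
proof -
  obtain u v where *: "ring_unit u" "ring_unit v" "f = t powi n * u" "f = t powi m * v"
    using assms by (auto simp: has_ord_def)
  then have "t powi (n - m) = v * inverse u"
    using t by (auto simp: power_int_diff ring_unit_def field_simps)
  then have "ring_unit (t powi (n - m))" using * unit_mult unit_inverse by metis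
  then show ?thesis using unit_powi by fastforce
qed

lemma has_ord_mult:
  assumes "has_ord f n" "has_ord h m"
  shows "has_ord (f * h) (n + m)"
proof -
  obtain u v where "ring_unit u" "ring_unit v" "f = t powi n * u" "h = t powi m * v"
    using assms by (auto simp: has_ord_def)
  then have "f * h = t powi (n + m) * (u * v)" "ring_unit (u * v)"
    using t unit_mult by (auto simp: power_int_add)
  then show ?thesis unfolding has_ord_def by blast
qed

lemma has_ord_inverse:
  assumes "has_ord f n"
  shows "has_ord (inverse f) (- n)"
proof -
  obtain u where "ring_unit u" "f = t powi n * u"
    using assms by (auto simp: has_ord_def)
  then have "inverse f = t powi (- n) * inverse u" "ring_unit (inverse u)"
    using unit_inverse by (auto simp: power_int_minus)
  then show ?thesis unfolding has_ord_def by blast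
qed

lemma has_ord_nonneg:
  assumes "has_ord f n"
  shows "f \<in> R \<longleftrightarrow> n \<ge> 0"
proof
  assume "n \<ge> 0"
  then show "f \<in> R" using assms R_power[OF t(1)]
    by (auto simp: has_ord_def ring_unit_def power_int_def intro!: R_mult)
next
  assume f: "f \<in> R"
  have "f \<noteq> 0" using assms t by (auto simp: has_ord_def ring_unit_def)
  from decomp[OF f this] obtain m u where "ring_unit u" "f = t ^ m * u"
    unfolding ring_unit_def by blast
  then have "has_ord f (int m)" by (auto simp: has_ord_def)
  then show "n \<ge> 0" using has_ord_unique[OF assms] by fastforce
qed

lemma ideal_power_eq: "ideal_power R M n = {t ^ n * r | r. r \<in> R}"
proof (induction n)
  case 0
  then show ?case by auto
next
  case (Suc n)
  have sum: "sum_list fs \<in> {t ^ Suc n * r | r. r \<in> R}"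
    if "set fs \<subseteq> {a * b | a b. a \<in> M \<and> b \<in> ideal_power R M n}" for fs
    using that
  proof (induction fs)
    case Nil
    then show ?case using R_0 by force
  next
    case (Cons f fs)
    then obtain r where r: "sum_list fs = t ^ Suc n * r" "r \<in> R" by auto
    from Cons obtain p q where "f = (t * p) * (t ^ n * q)" "p \<in> R" "q \<in> R"
      using M Suc by auto
    then have "sum_list (f # fs) = t ^ Suc n * (p * q + r)" "p * q + r \<in> R"
      using r R_mult R_add by (auto simp: algebra_simps)
    then show ?case by blast
  qed
  have "t ^ Suc n * r \<in> ideal_power R M (Suc n)" if "r \<in> R" for r
  proof -
    have "t \<in> M" using M R_1 by force
    moreover have "t ^ n * r \<in> ideal_power R M n" using Suc that by blast
    ultimately have "set [t * (t ^ n * r)] \<subseteq> {a * b | a b. a \<in> M \<and> b \<in> ideal_power R M n}" by auto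
    then have "sum_list [t * (t ^ n * r)] \<in> ideal_power R M (Suc n)"
      unfolding ideal_power.simps by blast
    then show ?thesis by (simp add: mult.assoc)
  qed
  then show ?case using sum by auto
qed

lemma Greatest_ideal_power:
  assumes "has_ord f (int n)"
  shows "(GREATEST n. f \<in> ideal_power R M n) = n"
proof (rule Greatest_equality)
  show "f \<in> ideal_power R M n"
    using assms by (auto simp: has_ord_def ring_unit_def ideal_power_eq)
next
  fix m assume "f \<in> ideal_power R M m"
  then obtain r where r: "r \<in> R" "f = t ^ m * r" by (auto simp: ideal_power_eq)
  have "f \<noteq> 0" using assms t by (auto simp: has_ord_def ring_unit_def)
  with r obtain k u where "ring_unit u" "r = t ^ k * u"
    using decomp[OF r(1)] unfolding ring_unit_def by auto
  then have "has_ord f (int (m + k))"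
    using r t by (auto simp: has_ord_def power_int_def nat_add_distrib power_add intro!: exI[of _ u])
  then show "m \<le> n" using has_ord_unique[OF assms] by fastforce
qed

text \<open>Evaluates the definite description behind \<open>ord_at\<close>: every presentation as a
  quotient of ring elements gives the same difference, by uniqueness of
  \<open>has_ord\<close>.\<close>

lemma the_ord:
  assumes "has_ord f n"
  shows "(THE m. \<exists>a b. a \<in> R - {0} \<and> b \<in> R - {0} \<and> f = a / b \<and>
     m = int (GREATEST n. a \<in> ideal_power R M n) - int (GREATEST n. b \<in> ideal_power R M n)) = n"
proof (rule the_equality)
  obtain u where u: "ring_unit u" "f = t powi n * u" using assms by (auto simp: has_ord_def)
  \<comment> \<open>A positive order goes into the numerator and a negative one into the
    denominator; the other power has exponent 0.\<close>
  define a b where "a = t ^ nat n * u" and "b = t ^ nat (- n)"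
  have ord: "has_ord a (int (nat n))" "has_ord b (int (nat (- n)))"
    using has_ord_power[OF u(1), of "nat n"] has_ord_power[OF unit_1, of "nat (- n)"]
    by (simp_all add: a_def b_def)
  have "a \<in> R - {0}" "b \<in> R - {0}"
    using u t R_mult R_power by (auto simp: a_def b_def ring_unit_def)
  moreover have "f = a / b"
    using u t by (cases "n \<ge> 0") (auto simp: a_def b_def power_int_def field_simps)
  moreover have "n = int (GREATEST n. a \<in> ideal_power R M n) - int (GREATEST n. b \<in> ideal_power R M n)"
    unfolding Greatest_ideal_power[OF ord(1)] Greatest_ideal_power[OF ord(2)] by simp
  ultimately show "\<exists>a b. a \<in> R - {0} \<and> b \<in> R - {0} \<and> f = a / b \<and>
     n = int (GREATEST n. a \<in> ideal_power R M n) - int (GREATEST n. b \<in> ideal_power R M n)"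
    by blast
next
  fix m assume "\<exists>a b. a \<in> R - {0} \<and> b \<in> R - {0} \<and> f = a / b \<and>
     m = int (GREATEST n. a \<in> ideal_power R M n) - int (GREATEST n. b \<in> ideal_power R M n)"
  then obtain a b where ab: "a \<in> R" "a \<noteq> 0" "b \<in> R" "b \<noteq> 0" "f = a / b"
     "m = int (GREATEST n. a \<in> ideal_power R M n) - int (GREATEST n. b \<in> ideal_power R M n)"
    by blast
  have "\<exists>k. has_ord c (int k)" if "c \<in> R" "c \<noteq> 0" for c
    using decomp[OF that] by (auto simp: has_ord_def ring_unit_def)
  then obtain i j where ij: "has_ord a (int i)" "has_ord b (int j)" using ab by blast
  have "has_ord f (int i - int j)"
    using has_ord_mult[OF ij(1) has_ord_inverse[OF ij(2)]] ab by (simp add: divide_inverse)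
  then have "n = int i - int j" using has_ord_unique[OF assms] by blast
  then show "m = n" using ab Greatest_ideal_power ij by simp
qed

end

section \<open>Derivatives of forms, transcendence over the constants and the field
  \<open>K(x)\<close>\<close>

text \<open>The chain rule along a polynomial path \<open>(S, T)\<close> in the plane. The
  derivative in the inner variable \<open>X\<close> is \<open>map_poly pderiv\<close>, the one in
  \<open>Z\<close> is \<open>pderiv\<close>.\<close>

lemma pderiv_eval2:
  fixes \<phi> :: "'a::field \<Rightarrow> 'b::idom"
  assumes "rhom \<phi>"
  shows "pderiv (eval2 (\<lambda>c. [:\<phi> c:]) P S T) =
    eval2 (\<lambda>c. [:\<phi> c:]) (map_poly pderiv P) S T * pderiv S +
    eval2 (\<lambda>c. [:\<phi> c:]) (pderiv P) S T * pderiv T"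
proof -
  interpret C: rhom "\<lambda>c. [:\<phi> c:]" by (rule rhom_comp[OF assms rhom_const])
  interpret CM: rhom "map_poly (\<lambda>c. [:\<phi> c:])" by (rule C.map_poly)
  interpret E: rhom "\<lambda>P. eval2 (\<lambda>c. [:\<phi> c:]) P S T" by (rule rhom_eval2[OF C.rhom_axioms])
  have inner: "pderiv (poly (map_poly (\<lambda>c. [:\<phi> c:]) p) S) =
      poly (map_poly (\<lambda>c. [:\<phi> c:]) (pderiv p)) S * pderiv S" for p
    by (induction p)
       (simp_all add: map_poly_pCons pderiv_pCons pderiv_add pderiv_mult CM.add algebra_simps)
  show ?thesis
    by (induction P)
       (simp_all add: map_poly_pCons pderiv_pCons eval2_pCons[OF C.rhom_axioms] pderiv_add pderiv_mult
         E.add inner algebra_simps)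
qed

text \<open>Differentiate \<open>P(xT, zT) = T^d P(x, z)\<close> with respect to \<open>T\<close>
  and set \<open>T = 1\<close>.\<close>

lemma euler_identity:
  fixes \<phi> :: "'a::field \<Rightarrow> 'b::idom"
  assumes "rhom \<phi>" "homogeneous d P"
  shows "of_nat d * eval2 \<phi> P x z =
    x * eval2 \<phi> (map_poly pderiv P) x z + z * eval2 \<phi> (pderiv P) x z"
proof -
  have C: "rhom (\<lambda>c. [:\<phi> c:])" by (rule rhom_comp[OF assms(1) rhom_const])
  have at1: "poly (eval2 (\<lambda>c. [:\<phi> c:]) Q [:0, x:] [:0, z:]) 1 = eval2 \<phi> Q x z" for Q
    using hom_eval2[OF C rhom_poly[of 1], of Q "[:0, x:]" "[:0, z:]"] by simp
  have "eval2 (\<lambda>c. [:\<phi> c:]) P [:0, x:] [:0, z:] =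
      [:0, 1:] ^ d * eval2 (\<lambda>c. [:\<phi> c:]) P [:x:] [:z:]"
    using eval2_scale[OF C assms(2), of "[:0, 1:]" "[:x:]" "[:z:]"] by simp
  also have "eval2 (\<lambda>c. [:\<phi> c:]) P [:x:] [:z:] = [:eval2 \<phi> P x z:]"
    using hom_eval2[OF assms(1) rhom_const, of P x z] by simp
  also have "[:0, 1:] ^ d * [:eval2 \<phi> P x z:] = monom (eval2 \<phi> P x z) d"
    by (simp add: monom_altdef)
  finally have "pderiv (eval2 (\<lambda>c. [:\<phi> c:]) P [:0, x:] [:0, z:]) =
      monom (of_nat d * eval2 \<phi> P x z) (d - 1)"
    by (simp add: pderiv_monom)
  then have "of_nat d * eval2 \<phi> P x z = poly (pderiv (eval2 (\<lambda>c. [:\<phi> c:]) P [:0, x:] [:0, z:])) 1"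
    by (simp add: poly_monom)
  also have "\<dots> = x * eval2 \<phi> (map_poly pderiv P) x z + z * eval2 \<phi> (pderiv P) x z"
    unfolding pderiv_eval2[OF assms(1)] by (simp add: at1 pderiv_pCons mult.commute)
  finally show ?thesis .
qed

text \<open>A nonconstant polynomial over the constants has a linear factor, and no linear factor
  vanishes at a nonconstant \<open>w\<close>; so factors can be removed until a constant is
  left.\<close>

lemma transcendental_over_alg_closed:
  fixes \<phi> :: "'a::alg_closed_field \<Rightarrow> 'b::field"
  assumes "rhom \<phi>" "w \<notin> range \<phi>" "poly (map_poly \<phi> p) w = 0"
  shows "p = 0"
  using assms(3)
proof (induction "degree p" arbitrary: p rule: less_induct)
  case less
  interpret \<phi>: rhom \<phi> by fact
  interpret \<phi>p: rhom "map_poly \<phi>" by (rule \<phi>.map_poly)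
  show ?case
  proof (cases "degree p = 0")
    case True
    then obtain c where "p = [:c:]" by (rule degree_eq_zeroE)
    then show ?thesis
      using less.prems by (auto simp: map_poly_pCons rhom_eq_0_iff[OF assms(1)])
  next
    case False
    then obtain r where "poly p r = 0" using alg_closed_imp_poly_has_root by blast
    then obtain q where q: "p = [:- r, 1:] * q" by (auto simp: poly_eq_0_iff_dvd dvd_def)
    have "q \<noteq> 0" using False q by auto
    have "degree q < degree p"
      unfolding q by (subst degree_mult_eq) (use \<open>q \<noteq> 0\<close> in auto)
    moreover have "poly (map_poly \<phi> q) w = 0"
    proof -
      have "(w - \<phi> r) * poly (map_poly \<phi> q) w = 0"
        using less.prems unfolding q \<phi>p.mult by (auto simp: map_poly_pCons \<phi>.minus)
      moreover have "w - \<phi> r \<noteq> 0" using assms(2) by auto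
      ultimately show ?thesis by (meson mult_eq_0_iff)
    qed
    ultimately have "q = 0" by (rule less.hyps)
    with \<open>q \<noteq> 0\<close> show ?thesis by blast
  qed
qed

text \<open>Lowest terms at the single place 0, which is what the local arguments at a point of the
  line ask for.\<close>

lemma remove_common_zero:
  fixes p q :: "'a::field poly"
  assumes "p \<noteq> 0 \<or> q \<noteq> 0"
  shows "\<exists>k p' q'. p = [:0, 1:] ^ k * p' \<and> q = [:0, 1:] ^ k * q' \<and> (poly p' 0 \<noteq> 0 \<or> poly q' 0 \<noteq> 0)"
  using assms
proof (induction "degree p + degree q" arbitrary: p q rule: less_induct)
  case less
  show ?case
  proof (cases "poly p 0 \<noteq> 0 \<or> poly q 0 \<noteq> 0")
    case True
    then show ?thesis by (intro exI[of _ 0] exI[of _ p] exI[of _ q]) simp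
  next
    case False
    then obtain p1 q1 where eq: "p = [:0, 1:] * p1" "q = [:0, 1:] * q1"
      by (auto simp: poly_eq_0_iff_dvd dvd_def)
    have deg: "degree ([:0, 1:] * r) = (if r = 0 then 0 else Suc (degree r))" for r :: "'a poly"
      by simp
    have nz: "p1 \<noteq> 0 \<or> q1 \<noteq> 0" using less.prems eq by auto
    then have "degree p1 + degree q1 < degree p + degree q"
      unfolding eq deg by auto
    from less.hyps[OF this nz] obtain k p' q' where
      "p1 = [:0, 1:] ^ k * p'" "q1 = [:0, 1:] ^ k * q'" "poly p' 0 \<noteq> 0 \<or> poly q' 0 \<noteq> 0"
      by blast
    then show ?thesis
      by (intro exI[of _ "Suc k"] exI[of _ p'] exI[of _ q']) (simp only: eq power_Suc mult.assoc simp_thms)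
  qed
qed

lemma remove_zero:
  fixes p :: "'a::field poly"
  assumes "p \<noteq> 0"
  shows "\<exists>k p'. p = [:0, 1:] ^ k * p' \<and> poly p' 0 \<noteq> 0"
  using remove_common_zero[of p p] assms by auto

lemma rhom_fun_const: "rhom fun_const"
  unfolding fun_const_def
  by (rule rhom_comp[OF rhom_const], rule rhom_comp[OF rhom_to_fract], rule rhom_to_ac)

lemma fun_const_eq_0_iff [simp]: "fun_const c = 0 \<longleftrightarrow> c = 0"
  by (simp add: fun_const_def)

lemma fun_const_eq_iff [simp]: "fun_const c = fun_const d \<longleftrightarrow> c = d"
  by (simp add: fun_const_def)

lemma linear_in_fun_x: "fun_const a * fun_x + fun_const b = to_ac (to_fract [:b, a:])"
proof -
  have "[:b, a:] = [:a:] * [:0, 1:] + [:b:]" by simp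
  then show ?thesis unfolding fun_const_def fun_x_def
    by (simp only: to_ac_add to_ac_mult to_fract_add to_fract_mult)
qed

lemma linear_in_fun_x_eq_0_iff: "fun_const a * fun_x + fun_const b = 0 \<longleftrightarrow> a = 0 \<and> b = 0"
  by (auto simp: linear_in_fun_x)

lemma to_ac_to_fract_eq: "to_ac (to_fract p) = poly (map_poly fun_const p) fun_x"
proof (induction p)
  case (pCons a p)
  have "pCons a p = [:a:] + [:0, 1:] * p" by simp
  then have "to_ac (to_fract (pCons a p)) = fun_const a + fun_x * to_ac (to_fract p)"
    unfolding fun_const_def fun_x_def by (simp only: to_ac_add to_ac_mult to_fract_add to_fract_mult)
  then show ?case using pCons by (simp add: map_poly_pCons rhom.zero[OF rhom_fun_const])
qed simp

abbreviation rational_functions :: "'k::field fun_ext set" where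
  "rational_functions \<equiv> range to_ac"

section \<open>The curve and its generic point in characteristic 2\<close>

locale curve =
  fixes g :: nat and H1 H0 :: "'k::field poly poly"
  assumes char2: "CHAR('k) = 2" and g: "g \<ge> 2"
    and hom1: "homogeneous (g + 1) H1" and hom0: "homogeneous (2 * g + 2) H0"
    and smooth: "smooth_model H1 H0"
begin

definition h1 :: "'k alg_closure \<Rightarrow> 'k alg_closure \<Rightarrow> 'k alg_closure" where
  "h1 = eval2 to_ac H1"

definition h0 :: "'k alg_closure \<Rightarrow> 'k alg_closure \<Rightarrow> 'k alg_closure" where
  "h0 = eval2 to_ac H0"

definition on_curve :: "'k alg_closure \<times> 'k alg_closure \<times> 'k alg_closure \<Rightarrow> bool" where
  "on_curve = (\<lambda>(x, y, z). (x, z) \<noteq> (0, 0) \<and> y\<^sup>2 + h1 x z * y = h0 x z)"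

abbreviation fx :: "'k alg_closure fun_ext" where "fx \<equiv> fun_x"
abbreviation fy :: "'k alg_closure fun_ext" where "fy \<equiv> fun_y H1 H0"

definition gen_h1 :: "'k alg_closure fun_ext" where
  "gen_h1 = eval2 (\<lambda>c. fun_const (to_ac c)) H1 fx 1"

definition gen_h0 :: "'k alg_closure fun_ext" where
  "gen_h0 = eval2 (\<lambda>c. fun_const (to_ac c)) H0 fx 1"

lemma two_eq_0: "(2 :: 'k alg_closure) = 0"
  using of_nat_CHAR[where 'a = "'k alg_closure"] by (simp add: char2)

lemma two_eq_0_fun: "(2 :: 'k alg_closure fun_ext) = 0"
proof -
  have "(2 :: 'k alg_closure fun_ext) = fun_const 2"
    using rhom.add[OF rhom_fun_const, of 1 1] by (simp add: rhom.one[OF rhom_fun_const])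
  also have "\<dots> = 0" using two_eq_0 by (subst fun_const_eq_0_iff)
  finally show ?thesis .
qed

lemma add_self: "(a :: 'k alg_closure) + a = 0"
  using two_eq_0 by (metis mult_2 mult_zero_left)

lemma add_self_fun: "(a :: 'k alg_closure fun_ext) + a = 0"
  using two_eq_0_fun by (metis mult_2 mult_zero_left)

lemma uminus_eq: "- (a :: 'k alg_closure) = a"
  using add_self by (metis add_eq_0_iff)

lemma uminus_eq_fun: "- (a :: 'k alg_closure fun_ext) = a"
  using add_self_fun by (metis add_eq_0_iff)

lemma h_scale: "h1 (c * x) (c * z) = c ^ (g + 1) * h1 x z" "h0 (c * x) (c * z) = c ^ (2 * g + 2) * h0 x z"
  unfolding h1_def h0_def
  by (rule eval2_scale[OF rhom_to_ac hom1]) (rule eval2_scale[OF rhom_to_ac hom0])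

lemma h_0 [simp]: "h1 0 0 = 0" "h0 0 0 = 0"
  using h_scale[of 0 1 1] by simp_all

text \<open>If \<open>X\<close> and \<open>Z\<close> vanish, so do both forms, and the equation
  leaves only \<open>Y^2 = 0\<close>. Hence requiring \<open>(X, Z)\<close> to be nonzero excludes
  the origin and nothing else.\<close>

lemma on_curve_iff:
  "on_curve p \<longleftrightarrow> p \<noteq> (0, 0, 0) \<and> eval3 to_ac (curve_poly H1 H0) p = 0"
proof (cases p)
  case (fields x y z)
  have "eval3 to_ac (curve_poly H1 H0) p = y\<^sup>2 + h1 x z * y - h0 x z"
    unfolding fields h1_def h0_def by (rule eval3_curve_poly) auto
  then show ?thesis by (auto simp: fields on_curve_def)
qed

lemma curve_points_eq: "curve_points g H1 H0 = wproj g ` {p. on_curve p}"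
  unfolding curve_points_def on_curve_iff by blast

lemma fun_y_equation: "fy\<^sup>2 + gen_h1 * fy = gen_h0"
proof -
  have ev: "eval3 (fun_const \<circ> to_ac) (curve_poly H1 H0) (fx, y, 1) = y\<^sup>2 + gen_h1 * y - gen_h0" for y
    unfolding gen_h1_def gen_h0_def o_def
    by (subst eval3_curve_poly) (simp_all add: rhom.zero[OF rhom_fun_const] rhom.one[OF rhom_fun_const]
         rhom.minus[OF rhom_fun_const])
  have "degree [:- gen_h0, gen_h1, 1:] > 0" by simp
  then obtain y where "poly [:- gen_h0, gen_h1, 1:] y = 0"
    using alg_closed_imp_poly_has_root by blast
  then have "y\<^sup>2 + gen_h1 * y - gen_h0 = 0" by (simp add: power2_eq_square algebra_simps)
  then have "eval3 (fun_const \<circ> to_ac) (curve_poly H1 H0) (fx, fy, 1) = 0"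
    unfolding fun_y_def ev by (rule someI)
  then show ?thesis unfolding ev by simp
qed

text \<open>By Euler's identity, the criterion at a point may be checked with a derivative in any
  direction transversal to the line through the point.\<close>

lemma smooth_direction:
  assumes "on_curve (x0, y0, z0)" "\<alpha> * x0 + \<beta> * z0 = 1"
    and A: "A = eval2 (\<lambda>c. [:to_ac c:]) H1 [:x0, \<beta>:] [:z0, - \<alpha>:]"
    and B: "B = eval2 (\<lambda>c. [:to_ac c:]) H0 [:x0, \<beta>:] [:z0, - \<alpha>:]"
    and "2 * y0 + poly A 0 = 0"
  shows "poly (pderiv B) 0 - poly (pderiv A) 0 * y0 \<noteq> 0"
proof
  assume sing: "poly (pderiv B) 0 - poly (pderiv A) 0 * y0 = 0"
  define e where "e = (\<lambda>P. eval2 to_ac P x0 z0)"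
  have C: "rhom (\<lambda>c. [:to_ac c:])" by (rule rhom_comp[OF rhom_to_ac rhom_const])
  have at0: "poly (eval2 (\<lambda>c. [:to_ac c:]) Q [:x0, \<beta>:] [:z0, - \<alpha>:]) 0 = e Q" for Q
    using hom_eval2[OF C rhom_poly[of 0], of Q "[:x0, \<beta>:]" "[:z0, - \<alpha>:]"] by (simp add: e_def)
  define FX where "FX = e (map_poly pderiv H1) * y0 - e (map_poly pderiv H0)"
  define FZ where "FZ = e (pderiv H1) * y0 - e (pderiv H0)"
  have FY: "2 * y0 + e H1 = 0" using assms(5) unfolding A at0 .
  have dir: "\<beta> * FX - \<alpha> * FZ = 0"
    using sing unfolding A B pderiv_eval2[OF rhom_to_ac]
    by (simp add: at0 pderiv_pCons FX_def FZ_def algebra_simps)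
  have curve: "y0\<^sup>2 + e H1 * y0 = e H0" using assms(1) by (simp add: on_curve_def h1_def h0_def e_def)
  have eu: "of_nat (g + 1) * e H1 = x0 * e (map_poly pderiv H1) + z0 * e (pderiv H1)"
       "of_nat (2 * g + 2) * e H0 = x0 * e (map_poly pderiv H0) + z0 * e (pderiv H0)"
    unfolding e_def by (rule euler_identity[OF rhom_to_ac hom1], rule euler_identity[OF rhom_to_ac hom0])
  have "x0 * FX + z0 * FZ = (of_nat (g + 1) * e H1) * y0 - of_nat (2 * g + 2) * e H0"
    unfolding eu FX_def FZ_def by (simp add: algebra_simps)
  \<comment> \<open>Replacing \<open>H0\<close> by \<open>y0^2 + H1 y0\<close> turns the Euler
    relation into a multiple of the derivative in \<open>Y\<close>, which vanishes at the
    point.\<close>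
  also have "\<dots> = - of_nat (g + 1) * y0 * (2 * y0 + e H1)"
    unfolding curve[symmetric] by (simp add: algebra_simps power2_eq_square)
  finally have eul: "x0 * FX + z0 * FZ = 0" using FY by simp
  \<comment> \<open>Two linear equations for \<open>FX\<close> and \<open>FZ\<close> are now
    available. Their determinant is \<open>- (\<alpha> * x0 + \<beta> * z0) = - 1\<close>, so both
    unknowns vanish.\<close>
  have "FX = (\<alpha> * x0 + \<beta> * z0) * FX" using assms(2) by simp
  also have "\<dots> = \<alpha> * (x0 * FX + z0 * FZ) + z0 * (\<beta> * FX - \<alpha> * FZ)" by (simp add: algebra_simps)
  finally have FX: "FX = 0" using eul dir by simp
  have "FZ = (\<alpha> * x0 + \<beta> * z0) * FZ" using assms(2) by simp
  also have "\<dots> = \<beta> * (x0 * FX + z0 * FZ) - x0 * (\<beta> * FX - \<alpha> * FZ)" by (simp add: algebra_simps)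
  finally have FZ: "FZ = 0" using eul dir by simp
  interpret E: rhom e unfolding e_def by (rule rhom_eval2[OF rhom_to_ac])
  have minus: "map_poly pderiv (- P) = - map_poly pderiv P" for P :: "'k poly poly"
    by (rule poly_eqI) (simp add: coeff_map_poly pderiv_minus)
  have ev: "eval3 to_ac [:a, b, c:] (x0, y0, z0) = e a + y0 * (e b + y0 * e c)" for a b c
    by (simp add: e_def eval3_pCons del: eval3.simps)
  have ev2: "eval3 to_ac [:a, b:] (x0, y0, z0) = e a + y0 * e b" for a b
    by (simp add: e_def eval3_pCons del: eval3.simps)
  let ?F = "curve_poly H1 H0"
  have "map_poly (map_poly pderiv) ?F = [:- map_poly pderiv H0, map_poly pderiv H1, 0:]"
    by (simp add: curve_poly_def map_poly_pCons minus one_pCons)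
  then have "eval3 to_ac (map_poly (map_poly pderiv) ?F) (x0, y0, z0) = 0"
    using FX by (simp add: ev ev2 E.minus FX_def algebra_simps del: eval3.simps)
  moreover have "map_poly pderiv ?F = [:- pderiv H0, pderiv H1, 0:]"
    by (simp add: curve_poly_def map_poly_pCons pderiv_minus)
  then have "eval3 to_ac (map_poly pderiv ?F) (x0, y0, z0) = 0"
    using FZ by (simp add: ev ev2 E.minus FZ_def algebra_simps del: eval3.simps)
  moreover have "pderiv ?F = [:H1, 2, 0:]"
    by (simp add: curve_poly_def pderiv_pCons one_pCons numeral_poly)
  then have "eval3 to_ac (pderiv ?F) (x0, y0, z0) = 0"
  proof -
    have "e 2 = 2" using E.add[of 1 1] by simp
    then show ?thesis using FY \<open>pderiv ?F = _\<close> by (simp add: ev ev2 algebra_simps del: eval3.simps)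
  qed
  ultimately show False
    using smooth assms(1) unfolding smooth_model_def Let_def on_curve_iff by blast
qed

end

lemma range_to_ac_closed:
  "a \<in> range to_ac \<Longrightarrow> b \<in> range to_ac \<Longrightarrow> a + b \<in> range to_ac"
  "a \<in> range to_ac \<Longrightarrow> b \<in> range to_ac \<Longrightarrow> a - b \<in> range to_ac"
  "a \<in> range to_ac \<Longrightarrow> b \<in> range to_ac \<Longrightarrow> a * b \<in> range to_ac"
  "a \<in> range to_ac \<Longrightarrow> b \<in> range to_ac \<Longrightarrow> a / b \<in> range to_ac"
  "a \<in> range to_ac \<Longrightarrow> - a \<in> range to_ac"
  "a \<in> range to_ac \<Longrightarrow> inverse a \<in> range to_ac"
  "a \<in> range to_ac \<Longrightarrow> a ^ n \<in> range to_ac"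
  "0 \<in> range to_ac" "1 \<in> range to_ac"
  by (auto simp flip: to_ac_add to_ac_diff to_ac_mult to_ac_divide to_ac_minus to_ac_inverse to_ac_power)

lemma fun_const_rational: "fun_const c \<in> rational_functions" and fun_x_rational: "fun_x \<in> rational_functions"
  by (simp_all add: fun_const_def fun_x_def)

lemma poly_rational: "w \<in> rational_functions \<Longrightarrow> poly (map_poly fun_const p) w \<in> rational_functions"
  by (induction p)
     (simp_all add: map_poly_pCons rhom.zero[OF rhom_fun_const] range_to_ac_closed fun_const_rational)

text \<open>
  A local coordinate system at the point \<open>(x\<^sub>0 : y\<^sub>0 : z\<^sub>0)\<close>. Let \<open>M = \<alpha> X + \<beta> Z\<close>, which is
  \<open>1\<close> at the point, and \<open>L = z\<^sub>0 X - x\<^sub>0 Z\<close>, which vanishes there. With \<open>u = L / M\<close> and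
  \<open>v = Y / M\<^bsup>g+1\<^esup>\<close> one has \<open>X / M = x\<^sub>0 + \<beta> u\<close> and \<open>Z / M = z\<^sub>0 - \<alpha> u\<close>. This treats finite
  and infinite points alike, and the point always has coordinates \<open>u = 0\<close>, \<open>v = y\<^sub>0\<close>.
\<close>

locale chart = curve g H1 H0 for g and H1 H0 :: "'k::field poly poly" +
  fixes x0 y0 z0 \<alpha> \<beta> :: "'k alg_closure"
  assumes point: "on_curve (x0, y0, z0)" and transversal: "\<alpha> * x0 + \<beta> * z0 = 1"
begin

definition mm :: "'k alg_closure fun_ext" where
  "mm = fun_const \<alpha> * fx + fun_const \<beta>"

definition ll :: "'k alg_closure fun_ext" where
  "ll = fun_const z0 * fx - fun_const x0"

definition u :: "'k alg_closure fun_ext" where "u = ll / mm"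
definition v :: "'k alg_closure fun_ext" where "v = fy / mm ^ (g + 1)"

text \<open>\<open>A\<close> and \<open>B\<close> are \<open>H1\<close> and \<open>H0\<close>
  restricted to the line \<open>M = 1\<close> with parameter \<open>u\<close>, so that the curve in
  the chart reads \<open>v^2 + A(u) v = B(u)\<close>.\<close>

definition A :: "'k alg_closure poly" where
  "A = eval2 (\<lambda>c. [:to_ac c:]) H1 [:x0, \<beta>:] [:z0, - \<alpha>:]"
definition B :: "'k alg_closure poly" where
  "B = eval2 (\<lambda>c. [:to_ac c:]) H0 [:x0, \<beta>:] [:z0, - \<alpha>:]"

text \<open>\<open>K[u]\<close> and \<open>K[u][v]\<close> are modelled by polynomials:
  \<open>evu\<close> and \<open>ev\<close> evaluate at the generic point, \<open>val0\<close> at the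
  given point \<open>u = 0\<close>, \<open>v = y0\<close>. That \<open>val0\<close> depends only on
  the function \<open>ev a\<close> is proved later, in \<open>ev_eq\<close>, from the irrationality
  of \<open>v\<close>.\<close>

definition evu :: "'k alg_closure poly \<Rightarrow> 'k alg_closure fun_ext" where
  "evu p = poly (map_poly fun_const p) u"

definition ev :: "'k alg_closure poly poly \<Rightarrow> 'k alg_closure fun_ext" where
  "ev a = poly (map_poly evu a) v"

definition val0 :: "'k alg_closure poly poly \<Rightarrow> 'k alg_closure" where
  "val0 a = poly (poly a [:y0:]) 0"

lemma rhom_evu: "rhom evu"
  unfolding evu_def by (rule rhom_comp[OF rhom.map_poly[OF rhom_fun_const] rhom_poly])

interpretation U: rhom evu by (rule rhom_evu)

lemma rhom_ev: "rhom ev"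
  unfolding ev_def by (rule rhom_comp[OF rhom.map_poly[OF rhom_evu] rhom_poly])

interpretation EV: rhom ev by (rule rhom_ev)

lemma rhom_val0: "rhom val0"
  unfolding val0_def by (rule rhom_comp[OF rhom_poly rhom_poly])

interpretation AT: rhom val0 by (rule rhom_val0)
interpretation FC: rhom fun_const by (rule rhom_fun_const)

lemma evu_const [simp]: "evu [:c:] = fun_const c"
  by (simp add: evu_def map_poly_pCons)

lemma evu_T [simp]: "evu [:0, 1:] = u"
  by (simp add: evu_def map_poly_pCons)

lemma evu_linear: "evu [:a, b:] = fun_const a + fun_const b * u"
  by (simp add: evu_def map_poly_pCons mult.commute)

lemma ev_const [simp]: "ev [:p:] = evu p"
  by (simp add: ev_def map_poly_pCons)

lemma ev_pCons: "ev (pCons p a) = evu p + v * ev a"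
  by (simp add: ev_def map_poly_pCons)

lemma val0_const [simp]: "val0 [:p:] = poly p 0"
  by (simp add: val0_def)

lemma val0_pCons: "val0 (pCons p a) = poly p 0 + y0 * val0 a"
  by (simp add: val0_def)

lemma mm_nz: "mm \<noteq> 0"
  using transversal unfolding mm_def by (auto simp: linear_in_fun_x_eq_0_iff)

lemma ll_altdef: "ll = fun_const z0 * fx + fun_const (- x0)"
  by (simp add: ll_def FC.minus)

lemma ll_nz: "ll \<noteq> 0"
  using point unfolding ll_altdef by (auto simp: linear_in_fun_x_eq_0_iff on_curve_def)

lemma u_nz: "u \<noteq> 0"
  using mm_nz ll_nz by (simp add: u_def)

lemma mm_rational: "mm \<in> rational_functions" and ll_rational: "ll \<in> rational_functions"
  unfolding mm_def ll_altdef linear_in_fun_x by auto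

lemma u_rational: "u \<in> rational_functions"
  unfolding u_def by (intro range_to_ac_closed mm_rational ll_rational)

lemma evu_rational: "evu p \<in> rational_functions"
  unfolding evu_def by (rule poly_rational[OF u_rational])

lemma transversal': "fun_const \<alpha> * fun_const x0 + fun_const \<beta> * fun_const z0 = 1"
  using transversal by (metis FC.add FC.mult FC.one)

lemma evu_X: "evu [:x0, \<beta>:] = fx / mm"
proof -
  have "fun_const x0 * mm + fun_const \<beta> * ll = (fun_const \<alpha> * fun_const x0 + fun_const \<beta> * fun_const z0) * fx"
    by (simp add: mm_def ll_def algebra_simps)
  then have "fun_const x0 * mm + fun_const \<beta> * ll = fx" by (simp add: transversal')
  then show ?thesis using mm_nz by (simp add: evu_linear u_def field_simps)
qed

lemma evu_Z: "evu [:z0, - \<alpha>:] = 1 / mm"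
proof -
  have "fun_const z0 * mm - fun_const \<alpha> * ll = fun_const \<alpha> * fun_const x0 + fun_const \<beta> * fun_const z0"
    by (simp add: mm_def ll_def algebra_simps)
  then have "fun_const z0 * mm - fun_const \<alpha> * ll = 1" by (simp only: transversal')
  then show ?thesis using mm_nz by (simp add: evu_linear u_def FC.minus field_simps)
qed

text \<open>By transversality \<open>L\<close> and \<open>M\<close> are linearly independent. Hence
  \<open>u\<close> is transcendental over \<open>K\<close> and \<open>evu\<close> is
  injective.\<close>

lemma u_not_const: "u \<notin> range fun_const"
proof
  assume "u \<in> range fun_const"
  then obtain a where "u = fun_const a" by auto
  then have "ll - fun_const a * mm = 0" using mm_nz by (simp add: u_def field_simps)
  then have "fun_const (z0 - a * \<alpha>) * fx + fun_const (- x0 - a * \<beta>) = 0"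
    by (simp add: ll_def mm_def FC.diff FC.mult FC.minus algebra_simps)
  then have "z0 = a * \<alpha>" "- x0 = a * \<beta>" by (simp_all add: linear_in_fun_x_eq_0_iff)
  then have "\<beta> * z0 = \<alpha> * (- x0)" by simp
  then show False using transversal by simp
qed

lemma evu_eq_0_iff [simp]: "evu p = 0 \<longleftrightarrow> p = 0"
  using transcendental_over_alg_closed[OF rhom_fun_const u_not_const] by (auto simp: evu_def)

lemma evu_eq_iff [simp]: "evu p = evu q \<longleftrightarrow> p = q"
  using evu_eq_0_iff[of "p - q"] by (simp only: U.diff right_minus_eq)

lemma C_to_ac: "rhom (\<lambda>c. [:to_ac c:])"
  by (rule rhom_comp[OF rhom_to_ac rhom_const])

lemma evu_A: "evu A = gen_h1 / mm ^ (g + 1)" and evu_B: "evu B = gen_h0 / mm ^ (2 * g + 2)"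
proof -
  have C: "rhom (\<lambda>c. fun_const (to_ac c))" by (rule rhom_comp[OF rhom_to_ac rhom_fun_const])
  have "evu (eval2 (\<lambda>c. [:to_ac c:]) P [:x0, \<beta>:] [:z0, - \<alpha>:]) =
      eval2 (\<lambda>c. fun_const (to_ac c)) P fx 1 / mm ^ d" if "homogeneous d P" for P d
  proof -
    have "evu (eval2 (\<lambda>c. [:to_ac c:]) P [:x0, \<beta>:] [:z0, - \<alpha>:]) =
        eval2 (\<lambda>c. fun_const (to_ac c)) P (1 / mm * fx) (1 / mm * 1)"
      using hom_eval2[OF C_to_ac rhom_evu, of P "[:x0, \<beta>:]" "[:z0, - \<alpha>:]"] by (simp add: evu_X evu_Z)
    also have "\<dots> = (1 / mm) ^ d * eval2 (\<lambda>c. fun_const (to_ac c)) P fx 1"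
      by (rule eval2_scale[OF C that])
    finally show ?thesis by (simp add: power_one_over)
  qed
  from this[OF hom1] this[OF hom0] show "evu A = gen_h1 / mm ^ (g + 1)" "evu B = gen_h0 / mm ^ (2 * g + 2)"
    by (simp_all add: A_def B_def gen_h1_def gen_h0_def)
qed

lemma v_equation: "v\<^sup>2 + evu A * v = evu B"
proof -
  have "(g + 1) * 2 = 2 * g + 2" by simp
  then have *: "(mm ^ (g + 1))\<^sup>2 = mm ^ (2 * g + 2)" by (metis power_mult)
  have "v\<^sup>2 + evu A * v = (fy\<^sup>2 + gen_h1 * fy) / (mm ^ (g + 1))\<^sup>2"
    unfolding v_def evu_A by (simp only: power_divide power2_eq_square times_divide_times_eq add_divide_distrib)
  also have "\<dots> = evu B" unfolding fun_y_equation evu_B * ..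
  finally show ?thesis .
qed

lemma A_0: "poly A 0 = h1 x0 z0" and B_0: "poly B 0 = h0 x0 z0"
  using hom_eval2[OF C_to_ac rhom_poly[of 0], of _ "[:x0, \<beta>:]" "[:z0, - \<alpha>:]"]
  by (simp_all add: A_def B_def h1_def h0_def)

lemma point_eq: "y0\<^sup>2 + poly A 0 * y0 = poly B 0"
  using point by (simp add: A_0 B_0 on_curve_def)

subsection \<open>The local ring in the chart\<close>

text \<open>The substituted polynomials represent \<open>X / M\<close>, \<open>Y / M^(g+1)\<close>
  and \<open>Z / M\<close>; a form of weight \<open>d\<close> becomes its quotient by
  \<open>M^d\<close>.\<close>

definition lift :: "'k alg_closure poly poly poly \<Rightarrow> 'k alg_closure poly poly" where
  "lift F = eval3 (\<lambda>c. [:[:c:]:]) F ([:[:x0, \<beta>:]:], [:0, 1:], [:[:z0, - \<alpha>:]:])"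

lemma rhom_CC: "rhom (\<lambda>c. [:[:c:]:])"
  by (rule rhom_comp[OF rhom_const rhom_const])

lemma generic_value_lift:
  assumes "weighted_form g d F"
  shows "generic_value H1 H0 F = mm ^ d * ev (lift F)"
proof -
  have "ev (lift F) = eval3 fun_const F (fx / mm, v, 1 / mm)"
    unfolding lift_def using hom_eval3[OF rhom_CC rhom_ev, of F]
    by (simp add: ev_pCons evu_X evu_Z del: eval3.simps)
  then have "mm ^ d * ev (lift F) = eval3 fun_const F (mm * (fx / mm), mm ^ (g + 1) * v, mm * (1 / mm))"
    by (simp only: eval3_scale[OF rhom_fun_const assms])
  also have "\<dots> = generic_value H1 H0 F"
    using mm_nz by (simp add: generic_value_def v_def del: eval3.simps)
  finally show ?thesis ..
qed

lemma eval_lift: "eval3 id F (x0, y0, z0) = val0 (lift F)"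
  unfolding lift_def using hom_eval3[OF rhom_CC rhom_val0, of F]
  by (simp add: val0_pCons id_def del: eval3.simps)

lemma form_value_eq:
  assumes "weighted_form g d F"
  shows "(\<forall>p\<in>wproj g (x0, y0, z0). eval3 id F p \<noteq> 0) \<longleftrightarrow> val0 (lift F) \<noteq> 0"
    and "(\<forall>p\<in>wproj g (x0, y0, z0). eval3 id F p = 0) \<longleftrightarrow> val0 (lift F) = 0"
proof -
  have *: "eval3 id F (c * x0, c ^ (g + 1) * y0, c * z0) = c ^ d * val0 (lift F)" for c
    using eval3_scale[OF rhom_id(2) assms] by (simp only: eval_lift)
  have 1: "eval3 id F p = 0 \<longleftrightarrow> val0 (lift F) = 0" if p: "p \<in> wproj g (x0, y0, z0)" for p
  proof -
    obtain c where "c \<noteq> 0" "p = (c * x0, c ^ (g + 1) * y0, c * z0)"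
      using p unfolding wproj.simps by blast
    then show ?thesis by (simp only: *) simp
  qed
  have "(x0, y0, z0) \<in> wproj g (x0, y0, z0)"
    unfolding wproj.simps by (simp, rule exI[of _ 1]) simp
  with 1 show "(\<forall>p\<in>wproj g (x0, y0, z0). eval3 id F p \<noteq> 0) \<longleftrightarrow> val0 (lift F) \<noteq> 0"
    "(\<forall>p\<in>wproj g (x0, y0, z0). eval3 id F p = 0) \<longleftrightarrow> val0 (lift F) = 0" by blast+
qed

definition mform :: "'k alg_closure poly poly poly" where "mform = [:[:[:0, \<alpha>:], [:\<beta>:]:]:]"
definition lform :: "'k alg_closure poly poly poly" where "lform = [:[:[:0, z0:], [:- x0:]:]:]"

text \<open>The converse of \<open>lift\<close>: a polynomial in \<open>u\<close> and
  \<open>v\<close> comes from a form divided by a power of \<open>M\<close>. All large weights are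
  demanded, not just one, because numerator and denominator of a function must have a common
  weight.\<close>

definition realized :: "'k alg_closure poly poly \<Rightarrow> bool" where
  "realized a \<longleftrightarrow> (\<exists>d0. \<forall>d\<ge>d0. \<exists>F. weighted_form g d F \<and> generic_value H1 H0 F = mm ^ d * ev a \<and>
     eval3 id F (x0, y0, z0) = val0 a)"

lemma rhom_generic_value: "rhom (generic_value H1 H0)"
  unfolding generic_value_def by (rule rhom_eval3[OF rhom_fun_const])

interpretation GV: rhom "generic_value H1 H0" by (rule rhom_generic_value)
interpretation E3: rhom "\<lambda>F. eval3 id F (x0, y0, z0)" by (rule rhom_eval3[OF rhom_id(2)])

lemma realized_add:
  assumes "realized a" "realized b" shows "realized (a + b)"
proof -
  obtain d1 d2 where d: "\<forall>d\<ge>d1. \<exists>F. weighted_form g d F \<and> generic_value H1 H0 F = mm ^ d * ev a \<and>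
     eval3 id F (x0, y0, z0) = val0 a" "\<forall>d\<ge>d2. \<exists>F. weighted_form g d F \<and> generic_value H1 H0 F = mm ^ d * ev b \<and>
     eval3 id F (x0, y0, z0) = val0 b" using assms unfolding realized_def by metis
  show ?thesis
    unfolding realized_def
  proof (intro exI[of _ "max d1 d2"] allI impI)
    fix d assume "max d1 d2 \<le> d"
    then obtain F G where "weighted_form g d F" "generic_value H1 H0 F = mm ^ d * ev a"
      "eval3 id F (x0, y0, z0) = val0 a" "weighted_form g d G" "generic_value H1 H0 G = mm ^ d * ev b"
      "eval3 id G (x0, y0, z0) = val0 b" using d by (meson max.boundedE)
    then show "\<exists>F. weighted_form g d F \<and> generic_value H1 H0 F = mm ^ d * ev (a + b) \<and>
     eval3 id F (x0, y0, z0) = val0 (a + b)"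
      by (intro exI[of _ "F + G"])
         (simp add: weighted_form_add GV.add E3.add EV.add AT.add algebra_simps del: eval3.simps)
  qed
qed

lemma realized_mult:
  assumes "realized a" "weighted_form g e F" "generic_value H1 H0 F = mm ^ e * ev b"
    "eval3 id F (x0, y0, z0) = val0 b"
  shows "realized (b * a)"
proof -
  obtain d0 where d: "\<forall>d\<ge>d0. \<exists>F. weighted_form g d F \<and> generic_value H1 H0 F = mm ^ d * ev a \<and>
     eval3 id F (x0, y0, z0) = val0 a" using assms(1) unfolding realized_def by metis
  show ?thesis
    unfolding realized_def
  proof (intro exI[of _ "e + d0"] allI impI)
    fix d assume "e + d0 \<le> d"
    then have "d - e \<ge> d0" and de: "d = e + (d - e)" by auto
    then obtain G where G: "weighted_form g (d - e) G" "generic_value H1 H0 G = mm ^ (d - e) * ev a"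
     "eval3 id G (x0, y0, z0) = val0 a" using d by blast
    have "mm ^ d = mm ^ e * mm ^ (d - e)" by (subst de) (simp add: power_add)
    then have "generic_value H1 H0 (F * G) = mm ^ d * ev (b * a)"
      using G assms by (simp add: GV.mult EV.mult mult_ac)
    moreover have "weighted_form g d (F * G)"
      using weighted_form_mult[OF assms(2) G(1)] de by simp
    moreover have "eval3 id (F * G) (x0, y0, z0) = val0 (b * a)"
      by (simp add: E3.mult AT.mult G assms del: eval3.simps)
    ultimately show "\<exists>F. weighted_form g d F \<and> generic_value H1 H0 F = mm ^ d * ev (b * a) \<and>
     eval3 id F (x0, y0, z0) = val0 (b * a)" by blast
  qed
qed

lemma mform: "weighted_form g 1 mform" "generic_value H1 H0 mform = mm" "eval3 id mform (x0, y0, z0) = 1"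
  and lform: "weighted_form g 1 lform" "generic_value H1 H0 lform = ll" "eval3 id lform (x0, y0, z0) = 0"
  using weighted_form_gens(2) transversal
  by (simp_all add: mform_def lform_def eval3_gens generic_value_def rhom_fun_const rhom_id mm_def
       ll_altdef del: eval3.simps One_nat_def)

lemma realized_const: "realized [:[:c:]:]"
  unfolding realized_def
proof (intro exI[of _ "0 :: nat"] allI impI)
  fix d
  let ?F = "[:[:[:c:]:]:] * mform ^ d"
  have "weighted_form g (0 + d * 1) ?F"
    by (intro weighted_form_mult weighted_form_power weighted_form_gens mform)
  moreover have "generic_value H1 H0 [:[:[:c:]:]:] = fun_const c" "eval3 id [:[:[:c:]:]:] (x0, y0, z0) = c"
    by (simp_all add: generic_value_def eval3_gens rhom_fun_const rhom_id del: eval3.simps)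
  then have "generic_value H1 H0 ?F = mm ^ d * ev [:[:c:]:]" "eval3 id ?F (x0, y0, z0) = val0 [:[:c:]:]"
    by (simp_all only: GV.mult GV.power E3.mult E3.power mform) simp_all
  ultimately show "\<exists>F. weighted_form g d F \<and> generic_value H1 H0 F = mm ^ d * ev [:[:c:]:] \<and>
     eval3 id F (x0, y0, z0) = val0 [:[:c:]:]" by auto
qed

lemma realized_inner: "realized [:p:]"
proof (induction p)
  case 0
  then show ?case using realized_const[of 0] by simp
next
  case (pCons c p)
  have "realized ([:[:0, 1:]:] * [:p:])"
    by (rule realized_mult[OF pCons(2) lform(1)])
       (use mm_nz in \<open>simp_all add: lform u_def del: eval3.simps\<close>)
  then have "realized ([:[:c:]:] + [:[:0, 1:]:] * [:p:])"
    by (rule realized_add[OF realized_const])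
  then show ?case by simp
qed

lemma realized: "realized a"
proof (induction a)
  case 0
  then show ?case using realized_inner[of 0] by simp
next
  case (pCons p a)
  have "realized ([:0, 1:] * a)"
    by (rule realized_mult[OF pCons(2) weighted_form_gens(3)])
       (use mm_nz in \<open>simp_all add: ev_pCons val0_pCons v_def generic_value_def eval3_gens rhom_fun_const rhom_id del: eval3.simps\<close>)
  then have "realized ([:p:] + [:0, 1:] * a)"
    by (rule realized_add[OF realized_inner])
  then show ?case by simp
qed

lemma realize2:
  "\<exists>d F G. weighted_form g d F \<and> generic_value H1 H0 F = mm ^ d * ev a \<and> val0 (lift F) = val0 a \<and>
     weighted_form g d G \<and> generic_value H1 H0 G = mm ^ d * ev b \<and> val0 (lift G) = val0 b"
proof -
  obtain d1 d2 where d: "\<forall>d\<ge>d1. \<exists>F. weighted_form g d F \<and> generic_value H1 H0 F = mm ^ d * ev a \<and>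
     eval3 id F (x0, y0, z0) = val0 a" "\<forall>d\<ge>d2. \<exists>F. weighted_form g d F \<and> generic_value H1 H0 F = mm ^ d * ev b \<and>
     eval3 id F (x0, y0, z0) = val0 b" using realized unfolding realized_def by metis
  then show ?thesis unfolding eval_lift by (meson max.cobounded1 max.cobounded2)
qed

abbreviation "pt \<equiv> wproj g (x0, y0, z0)"

text \<open>In a quotient of forms of equal weight the powers of \<open>M\<close> cancel, so that
  only polynomials in \<open>u\<close> and \<open>v\<close> remain; \<open>realize2\<close> leads
  back to forms.\<close>

lemma local_ring_eq: "local_ring g H1 H0 pt = {ev a / ev b | a b. val0 b \<noteq> 0}"
proof (intro Set.set_eqI iffI)
  fix f assume "f \<in> local_ring g H1 H0 pt"
  then obtain F G d where FG: "f = generic_value H1 H0 F / generic_value H1 H0 G"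
    "weighted_form g d F" "weighted_form g d G" "\<forall>p\<in>pt. eval3 id G p \<noteq> 0"
    unfolding local_ring_def by blast
  then have "f = ev (lift F) / ev (lift G)" "val0 (lift G) \<noteq> 0"
    using mm_nz by (simp_all add: generic_value_lift form_value_eq del: eval3.simps wproj.simps)
  then show "f \<in> {ev a / ev b | a b. val0 b \<noteq> 0}" by blast
next
  fix f assume "f \<in> {ev a / ev b | a b. val0 b \<noteq> 0}"
  then obtain a b where ab: "f = ev a / ev b" "val0 b \<noteq> 0" by blast
  obtain d F G where FG: "weighted_form g d F" "generic_value H1 H0 F = mm ^ d * ev a" "val0 (lift F) = val0 a"
     "weighted_form g d G" "generic_value H1 H0 G = mm ^ d * ev b" "val0 (lift G) = val0 b"
    using realize2[of a b] by blast
  then have "f = generic_value H1 H0 F / generic_value H1 H0 G" "\<forall>p\<in>pt. eval3 id G p \<noteq> 0"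
    using mm_nz ab by (simp_all add: form_value_eq[OF FG(4)] del: eval3.simps wproj.simps)
  then show "f \<in> local_ring g H1 H0 pt" unfolding local_ring_def using FG by blast
qed

lemma max_ideal_eq: "max_ideal g H1 H0 pt = {ev a / ev b | a b. val0 b \<noteq> 0 \<and> val0 a = 0}"
proof (intro Set.set_eqI iffI)
  fix f assume "f \<in> max_ideal g H1 H0 pt"
  then obtain F G d where FG: "f = generic_value H1 H0 F / generic_value H1 H0 G"
    "weighted_form g d F" "weighted_form g d G" "\<forall>p\<in>pt. eval3 id G p \<noteq> 0" "\<forall>p\<in>pt. eval3 id F p = 0"
    unfolding max_ideal_def by blast
  then have "f = ev (lift F) / ev (lift G)" "val0 (lift G) \<noteq> 0" "val0 (lift F) = 0"
    using mm_nz by (simp_all add: generic_value_lift form_value_eq del: eval3.simps wproj.simps)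
  then show "f \<in> {ev a / ev b | a b. val0 b \<noteq> 0 \<and> val0 a = 0}" by blast
next
  fix f assume "f \<in> {ev a / ev b | a b. val0 b \<noteq> 0 \<and> val0 a = 0}"
  then obtain a b where ab: "f = ev a / ev b" "val0 b \<noteq> 0" "val0 a = 0" by blast
  obtain d F G where FG: "weighted_form g d F" "generic_value H1 H0 F = mm ^ d * ev a" "val0 (lift F) = val0 a"
     "weighted_form g d G" "generic_value H1 H0 G = mm ^ d * ev b" "val0 (lift G) = val0 b"
    using realize2[of a b] by blast
  then have "f = generic_value H1 H0 F / generic_value H1 H0 G" "\<forall>p\<in>pt. eval3 id G p \<noteq> 0"
    "\<forall>p\<in>pt. eval3 id F p = 0"
    using mm_nz ab by (simp_all add: form_value_eq[OF FG(4)] form_value_eq[OF FG(1)] del: eval3.simps wproj.simps)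
  then show "f \<in> max_ideal g H1 H0 pt" unfolding max_ideal_def using FG by blast
qed

lemma function_field_eq: "function_field g H1 H0 = {ev a / ev b | a b. ev b \<noteq> 0}"
proof (intro Set.set_eqI iffI)
  fix f assume "f \<in> function_field g H1 H0"
  then obtain F G d where FG: "f = generic_value H1 H0 F / generic_value H1 H0 G"
    "weighted_form g d F" "weighted_form g d G" "generic_value H1 H0 G \<noteq> 0"
    unfolding function_field_def by blast
  then have "f = ev (lift F) / ev (lift G)" "ev (lift G) \<noteq> 0"
    using mm_nz by (simp_all add: generic_value_lift del: eval3.simps wproj.simps)
  then show "f \<in> {ev a / ev b | a b. ev b \<noteq> 0}" by blast
next
  fix f assume "f \<in> {ev a / ev b | a b. ev b \<noteq> 0}"
  then obtain a b where ab: "f = ev a / ev b" "ev b \<noteq> 0" by blast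
  obtain d F G where FG: "weighted_form g d F" "generic_value H1 H0 F = mm ^ d * ev a" "val0 (lift F) = val0 a"
     "weighted_form g d G" "generic_value H1 H0 G = mm ^ d * ev b" "val0 (lift G) = val0 b"
    using realize2[of a b] by blast
  then have "f = generic_value H1 H0 F / generic_value H1 H0 G" "generic_value H1 H0 G \<noteq> 0"
    using mm_nz ab by simp_all
  then show "f \<in> function_field g H1 H0" unfolding function_field_def using FG by blast
qed

text \<open>Division by the monic quadratic equation for \<open>v\<close>. The point satisfies the
  same equation, so its value is carried through the same reduction.\<close>

lemma reduce: "\<exists>p q. ev a = evu p + evu q * v \<and> val0 a = poly p 0 + poly q 0 * y0"
proof (induction a)
  case 0
  show ?case by (intro exI[of _ 0]) simp
next
  case (pCons c a)
  then obtain p q where pq: "ev a = evu p + evu q * v" "val0 a = poly p 0 + poly q 0 * y0" by blast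
  have v2: "v * v = evu B - evu A * v" using v_equation by (simp add: power2_eq_square algebra_simps)
  have y2: "y0 * y0 = poly B 0 - poly A 0 * y0" using point_eq by (simp add: power2_eq_square algebra_simps)
  have "ev (pCons c a) = evu c + evu p * v + evu q * (v * v)"
    unfolding ev_pCons pq by (simp add: algebra_simps)
  also have "\<dots> = evu (c + q * B) + evu (p - q * A) * v"
    unfolding v2 U.add U.mult U.diff by (simp add: algebra_simps)
  finally have "ev (pCons c a) = evu (c + q * B) + evu (p - q * A) * v" .
  moreover have "val0 (pCons c a) = poly c 0 + poly p 0 * y0 + poly q 0 * (y0 * y0)"
    unfolding val0_pCons pq by (simp add: algebra_simps)
  then have "val0 (pCons c a) = poly (c + q * B) 0 + poly (p - q * A) 0 * y0"
    unfolding y2 by (simp add: algebra_simps)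
  ultimately show ?case by blast
qed

text \<open>\<open>K(x) = K(u)\<close>, since
  \<open>x = (x0 + \<beta> u) / (z0 - \<alpha> u)\<close> is a Moebius function of
  \<open>u\<close>.\<close>

lemma rational_eq: "rational_functions = {evu p / evu q | p q. q \<noteq> 0}"
proof (intro equalityI subsetI)
  fix f :: "'k alg_closure fun_ext" assume "f \<in> {evu p / evu q | p q. q \<noteq> 0}"
  then show "f \<in> rational_functions" using range_to_ac_closed(4)[OF evu_rational evu_rational] by auto
next
  have const: "fun_const c \<in> {evu p / evu q | p q. q \<noteq> 0}" for c
  proof -
    have "fun_const c = evu [:c:] / evu 1" by simp
    then show ?thesis by fastforce
  qed
  have Z: "[:z0, - \<alpha>:] \<noteq> 0" using transversal point by (auto simp: on_curve_def)
  then have "evu [:x0, \<beta>:] / evu [:z0, - \<alpha>:] = fx" using mm_nz unfolding evu_X evu_Z by simp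
  then have x: "fx \<in> {evu p / evu q | p q. q \<noteq> 0}" using Z by (metis (mono_tags, lifting) mem_Collect_eq)
  have add: "a + b \<in> {evu p / evu q | p q. q \<noteq> 0}" and mult: "a * b \<in> {evu p / evu q | p q. q \<noteq> 0}"
    if ab: "a \<in> {evu p / evu q | p q. q \<noteq> 0}" "b \<in> {evu p / evu q | p q. q \<noteq> 0}" for a b
  proof -
    from ab(1) obtain p q where 1: "a = evu p / evu q" "q \<noteq> 0" by blast
    from ab(2) obtain r s where 2: "b = evu r / evu s" "s \<noteq> 0" by blast
    have nz: "q * s \<noteq> 0" "evu q \<noteq> 0" "evu s \<noteq> 0" using 1(2) 2(2) by simp_all
    have "a + b = evu (p * s + r * q) / evu (q * s)"
      unfolding 1(1) 2(1) U.add U.mult by (rule add_frac_eq[OF nz(2,3)])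
    with nz(1) show "a + b \<in> {evu p / evu q | p q. q \<noteq> 0}" by blast
    have "a * b = evu (p * r) / evu (q * s)"
      unfolding 1(1) 2(1) U.mult by (rule times_divide_times_eq)
    with nz(1) show "a * b \<in> {evu p / evu q | p q. q \<noteq> 0}" by blast
  qed
  have poly: "poly (map_poly fun_const r) fx \<in> {evu p / evu q | p q. q \<noteq> 0}" for r
  proof (induction r)
    case 0
    then show ?case using const[of 0] by simp
  next
    case (pCons c r)
    then show ?case using add[OF const mult[OF x pCons(2)]] by (simp add: map_poly_pCons)
  qed
  fix f :: "'k alg_closure fun_ext" assume "f \<in> rational_functions"
  then obtain w where "f = to_ac w" by blast
  then obtain r s where "s \<noteq> 0" "f = to_ac (to_fract r / to_fract s)"
    by (metis Fract_conv_to_fract Fract_cases)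
  then have f: "f = poly (map_poly fun_const r) fx / poly (map_poly fun_const s) fx"
    and nz: "poly (map_poly fun_const s) fx \<noteq> 0"
    by (simp_all add: to_ac_to_fract_eq[symmetric])
  obtain p q where "poly (map_poly fun_const s) fx = evu p / evu q" "q \<noteq> 0" using poly[of s] by blast
  moreover from this nz have "p \<noteq> 0" by auto
  ultimately have f': "f = poly (map_poly fun_const r) fx * (evu q / evu p)" unfolding f by simp
  have "evu q / evu p \<in> {evu p / evu q | p q. q \<noteq> 0}" using \<open>p \<noteq> 0\<close> by blast
  then show "f \<in> {evu p / evu q | p q. q \<noteq> 0}" unfolding f' by (rule mult[OF poly])
qed

end

section \<open>Dehomogenization of binary forms\<close>

lemma root_0_factor:
  fixes p :: "'a::comm_ring_1 poly"
  assumes "poly p 0 = 0"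
  obtains q where "p = [:0, 1:] * q"
  using assms unfolding poly_eq_0_iff_dvd minus_zero by (rule dvdE)

lemma eval2_monom:
  assumes "rhom \<phi>"
  shows "eval2 \<phi> (monom (monom c i) j) x z = \<phi> c * x ^ i * z ^ j"
  unfolding eval2_def using rhom.zero[OF assms] by (simp add: map_poly_monom poly_monom)

lemma homogeneous_expansion:
  fixes P :: "'a::comm_ring_1 poly poly"
  assumes "homogeneous d P"
  shows "P = (\<Sum>i\<le>d. monom (monom (coeff (coeff P (d - i)) i) i) (d - i))" (is "_ = ?S")
proof (rule poly_eqI, rule poly_eqI)
  fix j i
  have "coeff (coeff ?S j) i =
      (\<Sum>k\<le>d. if d - k = j \<and> k = i then coeff (coeff P (d - k)) k else 0)"
    by (simp add: coeff_sum if_distrib[of "\<lambda>p. coeff p i"] cong: if_cong) (rule sum.cong, auto)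
  also have "\<dots> = (\<Sum>k\<le>d. if k = i then (if d - i = j then coeff (coeff P j) i else 0) else 0)"
    by (intro sum.cong) auto
  also have "\<dots> = (if i \<le> d \<and> d - i = j then coeff (coeff P j) i else 0)"
    by (subst sum.delta) auto
  also have "\<dots> = coeff (coeff P j) i"
  proof -
    have "coeff (coeff P j) i = 0" if "\<not> (i \<le> d \<and> d - i = j)"
      by (rule ccontr) (use assms[unfolded homogeneous_def, rule_format, of j i] that in auto)
    then show ?thesis by auto
  qed
  finally show "coeff (coeff P j) i = coeff (coeff ?S j) i" ..
qed

lemma eval2_homogeneous:
  assumes "rhom \<phi>" "homogeneous d P"
  shows "eval2 \<phi> P x z = (\<Sum>i\<le>d. \<phi> (coeff (coeff P (d - i)) i) * x ^ i * z ^ (d - i))"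
proof -
  interpret rhom "\<lambda>P. eval2 \<phi> P x z" by (rule rhom_eval2[OF assms(1)])
  show ?thesis
    by (subst homogeneous_expansion[OF assms(2)]) (simp only: sum eval2_monom[OF assms(1)])
qed

definition dehomogenize :: "'a::comm_ring_1 poly poly \<Rightarrow> 'a poly" where
  "dehomogenize P = eval2 (\<lambda>c. [:c:]) P [:0, 1:] 1"

lemma rhom_dehomogenize: "rhom dehomogenize"
  unfolding dehomogenize_def by (rule rhom_eval2[OF rhom_const])

lemma coeff_dehomogenize:
  assumes "homogeneous d P"
  shows "coeff (dehomogenize P) i = coeff (coeff P (d - i)) i"
proof -
  have "dehomogenize P = (\<Sum>k\<le>d. monom (coeff (coeff P (d - k)) k) k)"
    unfolding dehomogenize_def eval2_homogeneous[OF rhom_const assms] by (simp add: monom_altdef)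
  then have "coeff (dehomogenize P) i = (if i \<le> d then coeff (coeff P (d - i)) i else 0)"
    by (simp add: coeff_sum)
  also have "\<dots> = coeff (coeff P (d - i)) i"
  proof -
    have "coeff (coeff P (d - i)) i = 0" if "\<not> i \<le> d"
      by (rule ccontr) (use assms[unfolded homogeneous_def, rule_format, of "d - i" i] that in auto)
    then show ?thesis by auto
  qed
  finally show ?thesis .
qed

lemma degree_dehomogenize_le:
  assumes "homogeneous d P"
  shows "degree (dehomogenize P) \<le> d"
proof (rule degree_le, intro allI impI)
  fix i assume "d < i"
  then show "coeff (dehomogenize P) i = 0"
    unfolding coeff_dehomogenize[OF assms] using assms unfolding homogeneous_def
    by (metis diff_is_0_eq less_imp_le_nat add.right_neutral less_irrefl)
qed

lemma eval2_at_one: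
  assumes "rhom \<phi>"
  shows "eval2 \<phi> P a 1 = poly (map_poly \<phi> (dehomogenize P)) a"
proof -
  have "rhom (\<lambda>p. poly (map_poly \<phi> p) a)"
    by (rule rhom_comp[OF rhom.map_poly[OF assms] rhom_poly])
  from hom_eval2[OF rhom_const this, of P "[:0, 1:]" 1] show ?thesis
    by (simp add: dehomogenize_def map_poly_pCons rhom.zero[OF assms] rhom.one[OF assms])
qed

text \<open>A zero at the point \<open>(1 : 0)\<close> thus shows up as a drop of the degree after
  setting \<open>Z = 1\<close>.\<close>

lemma eval2_at_infinity:
  assumes "rhom \<phi>" "homogeneous d P"
  shows "eval2 \<phi> P 1 0 = \<phi> (coeff (dehomogenize P) d)"
proof -
  have "eval2 \<phi> P 1 0 = (\<Sum>i\<le>d. if i = d then \<phi> (coeff (coeff P (d - i)) i) else 0)"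
    unfolding eval2_homogeneous[OF assms] by (intro sum.cong) (auto simp: power_0_left)
  then show ?thesis by (simp add: coeff_dehomogenize[OF assms(2)])
qed

section \<open>Ramification, irrationality of \<open>y\<close>, and uniformizers\<close>

context chart begin

interpretation U: rhom evu by (rule rhom_evu)
interpretation EV: rhom ev by (rule rhom_ev)
interpretation AT: rhom val0 by (rule rhom_val0)
interpretation FC: rhom fun_const by (rule rhom_fun_const)

definition ramified :: bool where
  "ramified \<longleftrightarrow> 2 * y0 + poly A 0 = 0"

text \<open>The local equation at \<open>v = y0\<close> vanishes at \<open>u = 0\<close>; its
  quotient \<open>s\<close> by \<open>u\<close> has as constant term the derivative of the equation
  in the direction of \<open>u\<close>. At a ramified point smoothness makes this term
  nonzero.\<close>

lemma tangent:
  "\<exists>s. B - [:y0\<^sup>2:] - A * [:y0:] = [:0, 1:] * s \<and> poly s 0 = poly (pderiv B) 0 - poly (pderiv A) 0 * y0"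
proof -
  have "poly (B - [:y0\<^sup>2:] - A * [:y0:]) 0 = 0" using point_eq by (simp add: algebra_simps)
  then obtain s where s: "B - [:y0\<^sup>2:] - A * [:y0:] = [:0, 1:] * s" by (rule root_0_factor)
  have "poly (pderiv (B - [:y0\<^sup>2:] - A * [:y0:])) 0 = poly (pderiv B) 0 - poly (pderiv A) 0 * y0"
    by (simp add: pderiv_diff pderiv_mult pderiv_pCons del: mult_pCons_right)
  moreover have "poly (pderiv ([:0, 1:] * s)) 0 = poly s 0"
    by (simp add: pderiv_mult pderiv_pCons del: mult_pCons_left)
  ultimately show ?thesis using s by metis
qed

lemma tangent_nz:
  assumes ramified
  shows "poly (pderiv B) 0 - poly (pderiv A) 0 * y0 \<noteq> 0"
  using smooth_direction[OF point transversal A_def B_def] assms by (simp add: ramified_def)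

lemma tangent_eq:
  assumes "B - [:y0\<^sup>2:] - A * [:y0:] = [:0, 1:] * s"
  shows "(v - fun_const y0) * (v + fun_const y0 + evu A) = u * evu s"
proof -
  have "u * evu s = evu (B - [:y0\<^sup>2:] - A * [:y0:])"
    unfolding assms U.mult by simp
  also have "\<dots> = evu B - (fun_const y0)\<^sup>2 - evu A * fun_const y0"
    by (simp only: U.diff U.mult evu_const FC.power)
  also have "\<dots> = (v - fun_const y0) * (v + fun_const y0 + evu A)"
    unfolding v_equation[symmetric] by (simp add: power2_eq_square algebra_simps)
  finally show ?thesis ..
qed

text \<open>Eisenstein's argument at \<open>u\<close>. The function \<open>w = v - y0\<close>
  satisfies \<open>w^2 + u a1(u) w = u s(u)\<close> with \<open>s(0)\<close> nonzero. If
  \<open>w = p / q\<close> in lowest terms at 0, then \<open>u\<close> divides \<open>p\<close>, and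
  after cancelling one factor \<open>u\<close> it also divides \<open>q\<close>.\<close>

lemma ramified_imp_irrational:
  assumes ramified
  shows "v \<notin> rational_functions"
proof
  assume "v \<in> rational_functions"
  obtain s where s: "B - [:y0\<^sup>2:] - A * [:y0:] = [:0, 1:] * s" "poly s 0 \<noteq> 0"
    using tangent tangent_nz[OF assms] by metis
  have "poly ([:2 * y0:] + A) 0 = 0" using assms by (simp add: ramified_def)
  then obtain a1 where a1: "[:2 * y0:] + A = [:0, 1:] * a1" by (rule root_0_factor)
  define w where "w = v - fun_const y0"
  have "w \<in> rational_functions"
    unfolding w_def by (intro range_to_ac_closed fun_const_rational \<open>v \<in> _\<close>)
  then obtain p0 q0 where w0: "w = evu p0 / evu q0" "q0 \<noteq> 0" unfolding rational_eq by blast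
  obtain k p q where pq: "p0 = [:0, 1:] ^ k * p" "q0 = [:0, 1:] ^ k * q"
    "poly p 0 \<noteq> 0 \<or> poly q 0 \<noteq> 0" using remove_common_zero[of p0 q0] w0(2) by blast
  have "q \<noteq> 0" using w0 pq by auto
  have w: "w = evu p / evu q" using u_nz unfolding w0 pq U.mult U.power by simp
  have "v + fun_const y0 + evu A = w + evu ([:2 * y0:] + A)"
    unfolding U.add w_def by (simp add: FC.mult FC.add[of 1 1, simplified])
  also have "\<dots> = w + u * evu a1" unfolding a1 U.mult by simp
  finally have "w * (w + u * evu a1) = u * evu s" using tangent_eq[OF s(1)] unfolding w_def[symmetric] by simp
  then have "evu p * evu p + u * (evu p * evu q * evu a1) = u * (evu s * evu q * evu q)"
    unfolding w using \<open>q \<noteq> 0\<close> by (simp add: field_simps)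
  then have "evu (p * p + [:0, 1:] * (p * q * a1)) = evu ([:0, 1:] * (s * q * q))"
    by (simp only: U.add U.mult evu_T)
  then have eq: "p * p + [:0, 1:] * (p * q * a1) = [:0, 1:] * (s * q * q)" by (simp only: evu_eq_iff)
  from arg_cong[OF this, of "\<lambda>f. poly f 0"] have p0: "poly p 0 = 0" by simp
  then obtain p1 where p1: "p = [:0, 1:] * p1" by (rule root_0_factor)
  have "[:0, 1:] * ([:0, 1:] * (p1 * p1 + p1 * q * a1)) = [:0, 1:] * (s * q * q)"
    using eq unfolding p1 by (simp only: algebra_simps)
  then have "[:0, 1:] * (p1 * p1 + p1 * q * a1) = s * q * q"
    by (subst (asm) mult_cancel_left) auto
  from arg_cong[OF this, of "\<lambda>f. poly f 0"] have "poly q 0 = 0" using s(2) by simp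
  with p0 pq(3) show False by blast
qed

lemma v_rational_iff: "v \<in> rational_functions \<longleftrightarrow> fy \<in> rational_functions"
proof
  assume "v \<in> rational_functions"
  then have "v * mm ^ (g + 1) \<in> rational_functions" by (intro range_to_ac_closed mm_rational)
  then show "fy \<in> rational_functions" using mm_nz by (simp add: v_def)
next
  assume "fy \<in> rational_functions"
  then show "v \<in> rational_functions" unfolding v_def by (intro range_to_ac_closed mm_rational)
qed

end

context curve begin

lemma chart_exists:
  assumes "on_curve (x0, y0, z0)"
  shows "\<exists>\<alpha> \<beta>. chart g H1 H0 x0 y0 z0 \<alpha> \<beta>"
proof -
  have "x0 \<noteq> 0 \<or> z0 \<noteq> 0" using assms by (auto simp: on_curve_def)
  then have "\<exists>\<alpha> \<beta>. \<alpha> * x0 + \<beta> * z0 = 1"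
    by (metis add_0 add.right_neutral left_inverse mult_zero_left)
  then show ?thesis
    using assms by (auto simp: chart_def chart_axioms_def intro: curve_axioms)
qed

lemma sqrt_exists: "\<exists>y. y\<^sup>2 = (c :: 'k alg_closure)"
proof -
  have "degree [:- c, 0, 1:] > 0" by simp
  then obtain y where "poly [:- c, 0, 1:] y = 0" using alg_closed_imp_poly_has_root by blast
  then show ?thesis by (intro exI[of _ y]) (simp add: power2_eq_square eq_neg_iff_add_eq_0)
qed

lemma point_exists: "\<exists>y. y\<^sup>2 + h1 x z * y = h0 x z"
proof -
  have "degree [:- h0 x z, h1 x z, 1:] > 0" by simp
  then obtain y where "poly [:- h0 x z, h1 x z, 1:] y = 0" using alg_closed_imp_poly_has_root by blast
  then show ?thesis by (intro exI[of _ y]) (simp add: power2_eq_square algebra_simps add_eq_0_iff2)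
qed

text \<open>If \<open>H1\<close> is constant on \<open>Z = 1\<close>, its coefficient at
  \<open>X^(g+1)\<close> is zero and the point \<open>(1 : 0)\<close> is a zero; otherwise there is
  an affine one.\<close>

lemma h1_has_zero: "\<exists>x z. (x, z) \<noteq> (0, 0) \<and> h1 x z = 0"
proof (cases "degree (dehomogenize H1) = 0")
  case True
  then have "coeff (dehomogenize H1) (g + 1) = 0" by (intro coeff_eq_0) simp
  then have "h1 1 0 = 0" by (simp add: h1_def eval2_at_infinity[OF rhom_to_ac hom1])
  then show ?thesis by (intro exI[of _ 1] exI[of _ 0]) simp
next
  case False
  then have "degree (map_poly to_ac (dehomogenize H1)) > 0" by (subst degree_map_poly) auto
  then obtain a where "poly (map_poly to_ac (dehomogenize H1)) a = 0"
    using alg_closed_imp_poly_has_root by blast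
  then have "h1 a 1 = 0" by (simp add: h1_def eval2_at_one[OF rhom_to_ac])
  then show ?thesis by (intro exI[of _ a] exI[of _ 1]) simp
qed

text \<open>Geometric irreducibility of the curve: it follows from smoothness at a single point over
  a zero of \<open>H1\<close>.\<close>

lemma fun_y_irrational: "fy \<notin> rational_functions"
proof -
  obtain x z where xz: "(x, z) \<noteq> (0, 0)" "h1 x z = 0" using h1_has_zero by blast
  obtain y where "y\<^sup>2 + h1 x z * y = h0 x z" using point_exists by blast
  then have "on_curve (x, y, z)" using xz by (simp add: on_curve_def)
  then obtain \<alpha> \<beta> where "chart g H1 H0 x y z \<alpha> \<beta>" using chart_exists by blast
  then interpret chart g H1 H0 x y z \<alpha> \<beta> .
  have ramified using xz by (simp add: ramified_def A_0 two_eq_0)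
  then show ?thesis using ramified_imp_irrational v_rational_iff by blast
qed

end

context chart begin

interpretation U: rhom evu by (rule rhom_evu)
interpretation EV: rhom ev by (rule rhom_ev)
interpretation AT: rhom val0 by (rule rhom_val0)
interpretation FC: rhom fun_const by (rule rhom_fun_const)

lemma v_irrational: "v \<notin> rational_functions"
  using fun_y_irrational v_rational_iff by blast

lemma reduced_eq_0:
  assumes "evu p + evu q * v = 0"
  shows "p = 0 \<and> q = 0"
proof (cases "q = 0")
  case True
  then show ?thesis using assms by simp
next
  case False
  then have "v = - evu p / evu q" using assms by (simp add: field_simps add_eq_0_iff)
  then have "v \<in> rational_functions" using range_to_ac_closed evu_rational by metis
  then show ?thesis using v_irrational by blast
qed

text \<open>As \<open>1\<close> and \<open>v\<close> are independent over \<open>K(u)\<close>, a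
  polynomial vanishing on the curve reduces to zero, and its value is that of its reduction. So
  functions have well-defined values at the point.\<close>

lemma ev_eq_0:
  assumes "ev a = 0"
  shows "val0 a = 0"
proof -
  obtain p q where pq: "ev a = evu p + evu q * v" "val0 a = poly p 0 + poly q 0 * y0"
    using reduce by blast
  then show ?thesis using reduced_eq_0[of p q] assms by simp
qed

lemma ev_eq:
  assumes "ev a = ev b"
  shows "val0 a = val0 b"
  using ev_eq_0[of "a - b"] assms by (simp add: EV.diff AT.diff)

definition local_unit :: "'k alg_closure fun_ext \<Rightarrow> bool" where
  "local_unit f \<longleftrightarrow> (\<exists>a b. val0 a \<noteq> 0 \<and> val0 b \<noteq> 0 \<and> f = ev a / ev b)"

lemma local_unit_ev: "val0 a \<noteq> 0 \<Longrightarrow> local_unit (ev a)"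
  unfolding local_unit_def by (intro exI[of _ a] exI[of _ 1]) simp

lemma local_unit_mult: "local_unit f \<Longrightarrow> local_unit h \<Longrightarrow> local_unit (f * h)"
  unfolding local_unit_def
  by (elim exE conjE, rule_tac x = "a * aa" in exI, rule_tac x = "b * ba" in exI)
     (simp add: AT.mult EV.mult)

lemma local_unit_inverse: "local_unit f \<Longrightarrow> local_unit (inverse f)"
  unfolding local_unit_def by (metis inverse_divide)

lemma local_unit_divide: "local_unit f \<Longrightarrow> local_unit h \<Longrightarrow> local_unit (f / h)"
  by (simp add: divide_inverse local_unit_mult local_unit_inverse)

lemma local_unit_nz: "local_unit f \<Longrightarrow> f \<noteq> 0"
  unfolding local_unit_def using ev_eq_0 by force

lemma local_unit_power: "local_unit f \<Longrightarrow> local_unit (f ^ n)"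
  by (induction n) (use local_unit_ev[of 1] local_unit_mult in auto)

lemma local_unit_in_ring: "local_unit f \<Longrightarrow> f \<in> local_ring g H1 H0 pt"
  unfolding local_unit_def local_ring_eq by blast

definition uniformizes :: "'k alg_closure fun_ext \<Rightarrow> bool" where
  "uniformizes t \<longleftrightarrow> t \<noteq> 0 \<and> (\<exists>a. val0 a = 0 \<and> t = ev a) \<and>
     (\<forall>a. ev a \<noteq> 0 \<longrightarrow> (\<exists>n w. local_unit w \<and> ev a = t ^ n * w))"

lemma ev_linear: "ev [:p, q:] = evu p + evu q * v" and val0_linear: "val0 [:p, q:] = poly p 0 + poly q 0 * y0"
  by (simp_all add: ev_pCons val0_pCons mult.commute)

lemma reduce_primitive:
  assumes "ev a \<noteq> 0"
  shows "\<exists>k p q. ev a = u ^ k * ev [:p, q:] \<and> (poly p 0 \<noteq> 0 \<or> poly q 0 \<noteq> 0)"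
proof -
  obtain p0 q0 where a: "ev a = evu p0 + evu q0 * v" using reduce by blast
  then have "p0 \<noteq> 0 \<or> q0 \<noteq> 0" using assms by auto
  then obtain k p q where pq: "p0 = [:0, 1:] ^ k * p" "q0 = [:0, 1:] ^ k * q"
    "poly p 0 \<noteq> 0 \<or> poly q 0 \<noteq> 0" using remove_common_zero by metis
  have "ev a = u ^ k * ev [:p, q:]"
    unfolding a pq U.mult U.power evu_T ev_linear by (simp add: algebra_simps)
  with pq(3) show ?thesis by blast
qed

text \<open>If \<open>p\<close>, \<open>q\<close> do not both vanish at \<open>0\<close>, then at an unramified point \<open>p + q v\<close> or its
  conjugate is a unit; in the second case divide the norm by the conjugate.\<close>

lemma uniformizes_unramified:
  assumes "\<not> ramified"
  shows "uniformizes u"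
  unfolding uniformizes_def
proof (intro conjI allI impI)
  show "u \<noteq> 0" by (rule u_nz)
  show "\<exists>a. val0 a = 0 \<and> u = ev a" by (rule exI[of _ "[:[:0, 1:]:]"]) simp
  fix a assume "ev a \<noteq> 0"
  then obtain k p q where a: "ev a = u ^ k * ev [:p, q:]" and pq: "poly p 0 \<noteq> 0 \<or> poly q 0 \<noteq> 0"
    using reduce_primitive by blast
  show "\<exists>n w. local_unit w \<and> ev a = u ^ n * w"
  proof (cases "val0 [:p, q:] = 0")
    case False
    then show ?thesis using a local_unit_ev by blast
  next
    case True
    define c where "c = [:p - q * A, - q:]"
    define N where "N = p * p - p * q * A - q * q * B"
    \<comment> \<open>At the point \<open>p = - q y0\<close>, so the conjugate takes the value
      \<open>- q(0)\<close> times the derivative of the equation in \<open>v\<close>. Here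
      \<open>q(0)\<close> is nonzero, for otherwise \<open>p(0)\<close> would vanish as
      well.\<close>
    have "val0 c = - poly q 0 * (2 * y0 + poly A 0)"
      using True unfolding c_def val0_linear by (simp add: algebra_simps eq_neg_iff_add_eq_0)
    moreover have "poly q 0 \<noteq> 0" using True pq by (auto simp: val0_linear)
    ultimately have c: "val0 c \<noteq> 0" using assms by (simp add: ramified_def)
    have v2: "v * v = evu B - evu A * v" using v_equation by (simp add: power2_eq_square algebra_simps)
    have "ev [:p, q:] * ev c = evu p * (evu p - evu q * evu A) - evu q * evu q * evu A * v - evu q * evu q * (v * v)"
      unfolding c_def ev_linear by (simp add: U.minus U.diff U.mult algebra_simps)
    also have "\<dots> = evu N"
      unfolding v2 N_def by (simp only: U.diff U.add U.mult algebra_simps)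
    finally have N: "ev [:p, q:] * ev c = evu N" .
    have "ev c \<noteq> 0" using c ev_eq_0 by blast
    moreover have "ev [:p, q:] \<noteq> 0" using \<open>ev a \<noteq> 0\<close> a by auto
    ultimately have "N \<noteq> 0" using N by (metis U.zero mult_eq_0_iff)
    then obtain j r where r: "N = [:0, 1:] ^ j * r" "poly r 0 \<noteq> 0" using remove_zero by blast
    have "ev [:p, q:] = u ^ j * (ev [:r:] / ev c)"
      using N \<open>ev c \<noteq> 0\<close> unfolding r(1) U.mult U.power by (simp add: field_simps)
    then have "ev a = u ^ (k + j) * (ev [:r:] / ev c)" unfolding a by (simp add: power_add)
    moreover have "local_unit (ev [:r:] / ev c)"
      by (intro local_unit_divide local_unit_ev) (use r c in simp_all)
    ultimately show ?thesis by blast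
  qed
qed

text \<open>For \<open>t = v - y0\<close> the local equation reads
  \<open>t^2 = u (s - t a1)\<close>, and the bracket is a unit because \<open>s(0)\<close> is
  nonzero. So \<open>u\<close> is \<open>t^2\<close> up to a unit, and a primitive
  \<open>p + q v\<close> that vanishes at the point is \<open>t\<close> times a unit.\<close>

lemma uniformizes_ramified:
  assumes ramified
  shows "uniformizes (v - fun_const y0)"
    and "\<exists>w. local_unit w \<and> u = (v - fun_const y0) ^ 2 * w"
proof -
  define t where "t = v - fun_const y0"
  define \<tau> where "\<tau> = [:[:- y0:], 1:]"
  have \<tau>: "ev \<tau> = t" "val0 \<tau> = 0"
    by (simp_all add: \<tau>_def t_def ev_linear val0_linear FC.minus)
  obtain s where s: "B - [:y0\<^sup>2:] - A * [:y0:] = [:0, 1:] * s" "poly s 0 \<noteq> 0"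
    using tangent tangent_nz[OF assms] by metis
  have "poly ([:2 * y0:] + A) 0 = 0" using assms by (simp add: ramified_def)
  then obtain a1 where a1: "[:2 * y0:] + A = [:0, 1:] * a1" by (rule root_0_factor)
  have "v + fun_const y0 + evu A = t + evu ([:2 * y0:] + A)"
    unfolding U.add t_def by (simp add: FC.mult FC.add[of 1 1, simplified])
  also have "\<dots> = t + u * evu a1" unfolding a1 U.mult by simp
  finally have "t * (t + u * evu a1) = u * evu s" using tangent_eq[OF s(1)] unfolding t_def[symmetric] by simp
  then have t2: "t ^ 2 = u * (evu s - t * evu a1)" by (simp add: power2_eq_square algebra_simps)
  define d where "d = [:s:] - \<tau> * [:a1:]"
  have d: "ev d = evu s - t * evu a1" "val0 d \<noteq> 0"
    using s(2) unfolding d_def by (simp_all only: EV.diff EV.mult AT.diff AT.mult \<tau>) simp_all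
  define w where "w = inverse (ev d)"
  have w: "local_unit w" unfolding w_def by (intro local_unit_inverse local_unit_ev d)
  have dnz: "ev d \<noteq> 0" using d(2) ev_eq_0 by blast
  have u: "u = t ^ 2 * w" using t2 dnz by (simp add: w_def d(1) field_simps)
  then show "\<exists>w. local_unit w \<and> u = (v - fun_const y0) ^ 2 * w" using w t_def by blast
  have "uniformizes t"
    unfolding uniformizes_def
  proof (intro conjI allI impI)
    show "t \<noteq> 0" using u u_nz by auto
    show "\<exists>a. val0 a = 0 \<and> t = ev a" using \<tau> by metis
    fix a assume "ev a \<noteq> 0"
    then obtain k p q where a: "ev a = u ^ k * ev [:p, q:]" and pq: "poly p 0 \<noteq> 0 \<or> poly q 0 \<noteq> 0"
      using reduce_primitive by blast
    have uk: "u ^ k = t ^ (2 * k) * w ^ k" by (simp add: u power_mult_distrib power_mult)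
    show "\<exists>n w. local_unit w \<and> ev a = t ^ n * w"
    proof (cases "val0 [:p, q:] = 0")
      case False
      have "ev a = t ^ (2 * k) * (w ^ k * ev [:p, q:])" unfolding a uk by (simp add: mult.assoc)
      moreover have "local_unit (w ^ k * ev [:p, q:])"
        by (intro local_unit_mult local_unit_power w local_unit_ev False)
      ultimately show ?thesis by blast
    next
      case True
      then have q: "poly q 0 \<noteq> 0" using pq by (auto simp: val0_linear)
      have "poly (p + q * [:y0:]) 0 = 0" using True by (simp add: val0_linear mult.commute)
      then obtain r where r: "p + q * [:y0:] = [:0, 1:] * r" by (rule root_0_factor)
      \<comment> \<open>If \<open>p + q v\<close> vanishes at the point, it equals
        \<open>u r + q t = t w (t r + q d)\<close>, because \<open>u = t^2 w\<close> and
        \<open>d w = 1\<close>. The bracket \<open>e\<close> has the value \<open>q(0) d(0)\<close>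
        at the point, which is nonzero.\<close>
      define e where "e = \<tau> * [:r:] + [:q:] * d"
      have e: "ev e = t * evu r + evu q * ev d" "val0 e \<noteq> 0"
        using q d(2) unfolding e_def by (simp_all only: EV.add EV.mult AT.add AT.mult \<tau>) simp_all
      have "ev [:p, q:] = evu (p + q * [:y0:]) + evu q * t"
        unfolding U.add U.mult ev_linear t_def by (simp add: algebra_simps)
      also have "\<dots> = u * evu r + evu q * t" unfolding r U.mult by simp
      also have "\<dots> = t * (ev e * w)"
      proof -
        have "ev d * w = 1" using dnz by (simp add: w_def)
        moreover have "t * (ev e * w) = t * (t * evu r * w + evu q * (ev d * w))"
          by (simp only: e(1) distrib_right mult.assoc)
        moreover have "u * evu r = t * (t * evu r * w)"
          unfolding u power2_eq_square by (simp only: ac_simps)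
        ultimately show ?thesis by (simp add: distrib_left mult.commute)
      qed
      finally have "ev a = t ^ (2 * k + 1) * (w ^ k * (ev e * w))" unfolding a uk by (simp add: mult_ac)
      moreover have "local_unit (w ^ k * (ev e * w))"
        by (intro local_unit_mult local_unit_power w local_unit_ev e)
      ultimately show ?thesis by blast
    qed
  qed
  then show "uniformizes (v - fun_const y0)" unfolding t_def .
qed

lemma uniformizer_dvr:
  assumes "uniformizes t"
  shows "dvr_set (local_ring g H1 H0 pt) (max_ideal g H1 H0 pt) t"
proof -
  obtain \<tau> where \<tau>: "t \<noteq> 0" "val0 \<tau> = 0" "t = ev \<tau>"
    and fact: "\<And>a. ev a \<noteq> 0 \<Longrightarrow> \<exists>n w. local_unit w \<and> ev a = t ^ n * w"
    using assms unfolding uniformizes_def by blast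
  have nz: "ev b \<noteq> 0" if "val0 b \<noteq> 0" for b using that ev_eq_0 by blast
  let ?R = "local_ring g H1 H0 pt"
  have ev_in: "ev a \<in> ?R" for a
    unfolding local_ring_eq by (intro CollectI exI[of _ a] exI[of _ 1]) simp
  have add: "a + b \<in> ?R" and mult: "a * b \<in> ?R" if a: "a \<in> ?R" and b: "b \<in> ?R" for a b
  proof -
    from a obtain p q where 1: "a = ev p / ev q" "val0 q \<noteq> 0" unfolding local_ring_eq by blast
    from b obtain r s where 2: "b = ev r / ev s" "val0 s \<noteq> 0" unfolding local_ring_eq by blast
    have qs: "val0 (q * s) \<noteq> 0" using 1 2 by (simp add: AT.mult)
    have "a + b = ev (p * s + r * q) / ev (q * s)"
      unfolding 1(1) 2(1) EV.add EV.mult by (rule add_frac_eq[OF nz[OF 1(2)] nz[OF 2(2)]])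
    with qs show "a + b \<in> ?R" unfolding local_ring_eq by blast
    have "a * b = ev (p * r) / ev (q * s)"
      unfolding 1(1) 2(1) EV.mult by (rule times_divide_times_eq)
    with qs show "a * b \<in> ?R" unfolding local_ring_eq by blast
  qed
  show ?thesis
  proof
    show "0 \<in> ?R" "1 \<in> ?R" "t \<in> ?R" using ev_in[of 0] ev_in[of 1] ev_in[of \<tau>] \<tau> by simp_all
    show "t \<noteq> 0" by fact
    show "1 \<notin> max_ideal g H1 H0 pt"
    proof
      assume "1 \<in> max_ideal g H1 H0 pt"
      then obtain a b where "1 = ev a / ev b" "val0 b \<noteq> 0" "val0 a = 0" unfolding max_ideal_eq by blast
      moreover from this nz have "ev a = ev b" by (simp add: field_simps)
      ultimately show False using ev_eq[of a b] by simp
    qed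
    show "\<exists>n w. w \<noteq> 0 \<and> w \<in> ?R \<and> inverse w \<in> ?R \<and> f = t ^ n * w" if f: "f \<in> ?R" "f \<noteq> 0" for f
    proof -
      from f(1) obtain a b where ab: "f = ev a / ev b" "val0 b \<noteq> 0" unfolding local_ring_eq by blast
      then have "ev a \<noteq> 0" using f(2) by auto
      then obtain n w where w: "local_unit w" "ev a = t ^ n * w" using fact by blast
      then have "local_unit (w / ev b)" by (intro local_unit_divide local_unit_ev ab)
      moreover have "f = t ^ n * (w / ev b)" using ab w by simp
      ultimately show ?thesis
        using local_unit_nz local_unit_in_ring local_unit_inverse by metis
    qed
    show "max_ideal g H1 H0 pt = {t * r | r. r \<in> ?R}"
    proof (intro equalityI subsetI)
      fix f assume "f \<in> max_ideal g H1 H0 pt"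
      then obtain a b where ab: "f = ev a / ev b" "val0 b \<noteq> 0" "val0 a = 0" unfolding max_ideal_eq by blast
      show "f \<in> {t * r | r. r \<in> ?R}"
      proof (cases "ev a = 0")
        case True
        then have "f = t * ev 0" using ab by simp
        then show ?thesis using ev_in by blast
      next
        case False
        then obtain n w where w: "local_unit w" "ev a = t ^ n * w" using fact by blast
        obtain c d where cd: "val0 c \<noteq> 0" "val0 d \<noteq> 0" "w = ev c / ev d" using w(1) unfolding local_unit_def by blast
        show ?thesis
        proof (cases n)
          case 0
          \<comment> \<open>With exponent 0 the function would be a unit, against the vanishing of
            \<open>a\<close> at the point.\<close>
          then have "ev (a * d) = ev c" using w cd nz by (simp add: EV.mult)
          then have "val0 (a * d) = val0 c" by (rule ev_eq)
          then show ?thesis using ab cd by (simp add: AT.mult)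
        next
          case (Suc m)
          have "t ^ m * w * inverse (ev b) \<in> ?R"
          proof -
            have "t ^ m \<in> ?R" using ev_in[of "\<tau> ^ m"] by (simp add: EV.power \<tau>)
            then show ?thesis
              by (intro mult local_unit_in_ring[OF w(1)] local_unit_in_ring[OF local_unit_inverse[OF local_unit_ev[OF ab(2)]]])
          qed
          moreover have "f = t * (t ^ m * w * inverse (ev b))"
            unfolding ab w Suc by (simp add: divide_inverse mult.assoc)
          ultimately show ?thesis by blast
        qed
      qed
    next
      fix f assume "f \<in> {t * r | r. r \<in> ?R}"
      then obtain a b where ab: "f = t * (ev a / ev b)" "val0 b \<noteq> 0" unfolding local_ring_eq by blast
      then have "f = ev (\<tau> * a) / ev b" "val0 (\<tau> * a) = 0" by (simp_all add: EV.mult AT.mult \<tau>)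
      then show "f \<in> max_ideal g H1 H0 pt" unfolding max_ideal_eq using ab(2) by blast
    qed
  qed (use add mult in blast)+
qed

text \<open>All that is used of a chart later on: the valuation ring, an order for each nonzero
  function, and the order of \<open>u\<close>, which is the ramification index of the projection to
  the line.\<close>

lemma chart_dvr:
  "\<exists>t. dvr_set (local_ring g H1 H0 pt) (max_ideal g H1 H0 pt) t \<and>
     (\<forall>f\<in>function_field g H1 H0 - {0}. \<exists>n. dvr_set.has_ord (local_ring g H1 H0 pt) t f n) \<and>
     dvr_set.has_ord (local_ring g H1 H0 pt) t u (if h1 x0 z0 = 0 then 2 else 1)"
proof -
  have ram: "ramified \<longleftrightarrow> h1 x0 z0 = 0" by (simp add: ramified_def A_0 two_eq_0)
  have "\<exists>t. uniformizes t \<and> (\<exists>w. local_unit w \<and> u = t ^ (if h1 x0 z0 = 0 then 2 else 1) * w)"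
  proof (cases ramified)
    case True
    then show ?thesis using uniformizes_ramified ram by auto
  next
    case False
    then show ?thesis using uniformizes_unramified ram local_unit_ev[of 1]
      by (intro exI[of _ u] conjI exI[of _ 1]) auto
  qed
  then obtain t w where t: "uniformizes t" and w: "local_unit w"
      "u = t ^ (if h1 x0 z0 = 0 then 2 else 1) * w" by blast
  interpret D: dvr_set "local_ring g H1 H0 pt" "max_ideal g H1 H0 pt" t
    by (rule uniformizer_dvr[OF t])
  have unit: "D.ring_unit f" if "local_unit f" for f
    using that local_unit_nz local_unit_in_ring local_unit_inverse unfolding D.ring_unit_def by blast
  have "D.has_ord u (if h1 x0 z0 = 0 then 2 else 1)"
    using D.has_ord_power[OF unit[OF w(1)], of "if h1 x0 z0 = 0 then 2 else 1"] w(2) by (auto split: if_splits)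
  moreover have "\<exists>n. D.has_ord f n" if f: "f \<in> function_field g H1 H0 - {0}" for f
  proof -
    obtain a b where ab: "f = ev a / ev b" "ev b \<noteq> 0" "ev a \<noteq> 0"
      using f unfolding function_field_eq by auto
    have "\<exists>n. D.has_ord (ev a) (int n)" if "ev a \<noteq> 0" for a
      using t that D.has_ord_power[OF unit] unfolding uniformizes_def by metis
    then obtain n m where "D.has_ord (ev a) (int n)" "D.has_ord (ev b) (int m)" using ab by metis
    then show ?thesis
      using D.has_ord_mult[OF _ D.has_ord_inverse] unfolding ab(1) divide_inverse by blast
  qed
  ultimately show ?thesis using D.dvr_set_axioms by blast
qed

end

context curve begin

abbreviation "CP \<equiv> curve_points g H1 H0"
abbreviation "FF \<equiv> function_field g H1 H0"
abbreviation "LR \<equiv> local_ring g H1 H0"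
abbreviation "ord \<equiv> ord_at g H1 H0"

lemma point_chart:
  assumes "P \<in> CP"
  obtains x y z \<alpha> \<beta> where "chart g H1 H0 x y z \<alpha> \<beta>" "P = wproj g (x, y, z)"
  using assms chart_exists unfolding curve_points_eq by fast

subsection \<open>The function field\<close>

lemma fun_y_square: "fy * fy = gen_h0 - gen_h1 * fy"
  using fun_y_equation by (simp add: power2_eq_square algebra_simps)

lemma gen_h_rational: "gen_h1 \<in> rational_functions" "gen_h0 \<in> rational_functions"
proof -
  have *: "rhom (\<lambda>c. to_fract [:to_ac c:])"
    by (rule rhom_comp[OF rhom_comp[OF rhom_to_ac rhom_const] rhom_to_fract])
  have "eval2 (\<lambda>c. fun_const (to_ac c)) H fx 1 = to_ac (eval2 (\<lambda>c. to_fract [:to_ac c:]) H (to_fract [:0, 1:]) 1)"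
    for H :: "'k poly poly"
    using hom_eval2[OF * rhom_to_ac, of H "to_fract [:0, 1:]" 1] by (simp add: fun_const_def fun_x_def)
  then show "gen_h1 \<in> rational_functions" "gen_h0 \<in> rational_functions"
    unfolding gen_h1_def gen_h0_def by blast+
qed

definition qext :: "'k alg_closure fun_ext set" where
  "qext = {a + b * fy | a b. a \<in> rational_functions \<and> b \<in> rational_functions}"

lemma qext_unique:
  assumes "a + b * fy = c + d * fy" "a \<in> rational_functions" "b \<in> rational_functions"
    "c \<in> rational_functions" "d \<in> rational_functions"
  shows "a = c \<and> b = d"
proof (cases "b = d")
  case False
  then have "fy = (c - a) / (b - d)" using assms(1) by (simp add: field_simps)
  then have "fy \<in> rational_functions" using assms by (metis range_to_ac_closed(2,4))
  then show ?thesis using fun_y_irrational by blast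
qed (use assms in simp)

lemma rational_in_qext: "a \<in> rational_functions \<Longrightarrow> a \<in> qext"
  unfolding qext_def using range_to_ac_closed(8) by force

lemma qextI: "a \<in> rational_functions \<Longrightarrow> b \<in> rational_functions \<Longrightarrow> a + b * fy \<in> qext"
  unfolding qext_def by blast

lemma qext_add: "f \<in> qext \<Longrightarrow> h \<in> qext \<Longrightarrow> f + h \<in> qext"
proof -
  assume "f \<in> qext" "h \<in> qext"
  then obtain a b c d where *: "f = a + b * fy" "h = c + d * fy" "a \<in> rational_functions"
    "b \<in> rational_functions" "c \<in> rational_functions" "d \<in> rational_functions" unfolding qext_def by blast
  have "f + h = (a + c) + (b + d) * fy" by (simp add: * algebra_simps)
  then show ?thesis using * by (simp only:) (intro qextI range_to_ac_closed)
qed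

lemma qext_mult: "f \<in> qext \<Longrightarrow> h \<in> qext \<Longrightarrow> f * h \<in> qext"
proof -
  assume "f \<in> qext" "h \<in> qext"
  then obtain a b c d where *: "f = a + b * fy" "h = c + d * fy" "a \<in> rational_functions"
    "b \<in> rational_functions" "c \<in> rational_functions" "d \<in> rational_functions" unfolding qext_def by blast
  have "f * h = a * c + (a * d + b * c) * fy + b * d * (fy * fy)" by (simp add: * algebra_simps)
  also have "\<dots> = (a * c + b * d * gen_h0) + (a * d + b * c - b * d * gen_h1) * fy"
    unfolding fun_y_square by (simp add: algebra_simps)
  finally show ?thesis using * gen_h_rational by (simp only:) (intro qextI range_to_ac_closed)
qed

lemma qext_inverse:
  assumes "f \<in> qext"
  shows "inverse f \<in> qext"
proof (cases "f = 0")
  case True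
  then show ?thesis using rational_in_qext range_to_ac_closed(8) by simp
next
  case False
  obtain a b where *: "f = a + b * fy" "a \<in> rational_functions" "b \<in> rational_functions"
    using assms unfolding qext_def by blast
  define c where "c = (a - b * gen_h1) + (- b) * fy"
  define n where "n = a * a - a * b * gen_h1 - b * b * gen_h0"
  have n: "n \<in> rational_functions" unfolding n_def by (intro range_to_ac_closed * gen_h_rational)
  have c: "c \<in> qext" unfolding c_def by (intro qextI range_to_ac_closed * gen_h_rational)
  have "f * c = a * (a - b * gen_h1) - b * b * gen_h1 * fy - b * b * (fy * fy)"
    unfolding c_def * by (simp add: algebra_simps)
  also have "\<dots> = n" unfolding fun_y_square n_def by (simp add: algebra_simps)
  finally have fc: "f * c = n" .
  have "c \<noteq> 0"
  proof
    assume "c = 0"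
    then have "(a - b * gen_h1) + (- b) * fy = 0 + 0 * fy" by (simp add: c_def)
    from qext_unique[OF this] have "a - b * gen_h1 = 0" "- b = 0"
      using * gen_h_rational by (auto intro!: range_to_ac_closed)
    then show False using * False by simp
  qed
  then have "inverse f = c * inverse n" using fc False by (auto simp: field_simps)
  then show ?thesis using qext_mult[OF c rational_in_qext] n range_to_ac_closed(6) by metis
qed

text \<open>One chart suffices, since the function field does not refer to a point. The resulting
  description by \<open>K(x)\<close> and \<open>y\<close> is the one on which the involution is
  easily computed.\<close>

lemma FF_eq: "FF = qext"
proof -
  obtain x z where xz: "(x, z) \<noteq> (0, 0)" "h1 x z = 0" using h1_has_zero by blast
  obtain y where "y\<^sup>2 + h1 x z * y = h0 x z" using point_exists by blast
  then have "on_curve (x, y, z)" using xz by (simp add: on_curve_def)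
  then obtain \<alpha> \<beta> where "chart g H1 H0 x y z \<alpha> \<beta>" using chart_exists by blast
  then interpret C: chart g H1 H0 x y z \<alpha> \<beta> .
  interpret U: rhom C.evu by (rule C.rhom_evu)
  have ev: "C.ev a \<in> qext" for a
  proof -
    obtain p q where "C.ev a = C.evu p + C.evu q * C.v" using C.reduce by blast
    also have "\<dots> = C.evu p + (C.evu q / C.mm ^ (g + 1)) * fy" by (simp add: C.v_def)
    finally show ?thesis
      by (simp only:) (intro qextI range_to_ac_closed C.evu_rational C.mm_rational)
  qed
  show ?thesis
  proof (intro equalityI subsetI)
    fix f assume "f \<in> FF"
    then obtain a b where "f = C.ev a / C.ev b" unfolding C.function_field_eq by blast
    then show "f \<in> qext" unfolding divide_inverse using ev qext_mult qext_inverse by metis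
  next
    fix f assume "f \<in> qext"
    then obtain a b where *: "f = a + b * fy" "a \<in> rational_functions" "b \<in> rational_functions"
      unfolding qext_def by blast
    have "b * C.mm ^ (g + 1) \<in> rational_functions" by (intro range_to_ac_closed * C.mm_rational)
    then obtain r s where rs: "b * C.mm ^ (g + 1) = C.evu r / C.evu s" "s \<noteq> 0" unfolding C.rational_eq by blast
    obtain p q where pq: "a = C.evu p / C.evu q" "q \<noteq> 0" using *(2) unfolding C.rational_eq by blast
    have "f = a + (b * C.mm ^ (g + 1)) * C.v" using C.mm_nz by (simp add: * C.v_def)
    also have "\<dots> = C.evu p / C.evu q + C.evu r * C.v / C.evu s"
      by (simp only: rs(1) pq(1) times_divide_eq_left)
    also have "\<dots> = (C.evu p * C.evu s + C.evu r * C.v * C.evu q) / (C.evu q * C.evu s)"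
      using pq(2) rs(2) by (intro add_frac_eq) simp_all
    also have "\<dots> = C.ev [:p * s, r * q:] / C.ev [:q * s:]"
      by (simp only: C.ev_linear C.ev_const U.mult ac_simps)
    finally have "f = C.ev [:p * s, r * q:] / C.ev [:q * s:]" .
    moreover have "C.ev [:q * s:] \<noteq> 0" using pq(2) rs(2) by simp
    ultimately show "f \<in> FF" unfolding C.function_field_eq by blast
  qed
qed

lemma FF_rational: "a \<in> rational_functions \<Longrightarrow> a \<in> FF"
  and FF_add: "f \<in> FF \<Longrightarrow> h \<in> FF \<Longrightarrow> f + h \<in> FF"
  and FF_mult: "f \<in> FF \<Longrightarrow> h \<in> FF \<Longrightarrow> f * h \<in> FF"
  and FF_inverse: "f \<in> FF \<Longrightarrow> inverse f \<in> FF"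
  unfolding FF_eq by (fact rational_in_qext qext_add qext_mult qext_inverse)+

lemma FF_divide: "f \<in> FF \<Longrightarrow> h \<in> FF \<Longrightarrow> f / h \<in> FF"
  by (simp add: divide_inverse FF_mult FF_inverse)

lemma FF_const: "fun_const c \<in> FF"
  by (rule FF_rational[OF fun_const_rational])

lemma FF_1: "1 \<in> FF"
  by (rule FF_rational[OF range_to_ac_closed(9)])

lemma FF_power: "f \<in> FF \<Longrightarrow> f ^ n \<in> FF"
  by (induction n) (auto intro: FF_1 FF_mult)

lemma FF_powi: "f \<in> FF \<Longrightarrow> f powi n \<in> FF"
  by (auto simp: power_int_def intro: FF_power FF_inverse)

subsection \<open>Orders of vanishing\<close>

lemma dvr_at:
  assumes "P \<in> CP"
  obtains t where "dvr_set (LR P) (max_ideal g H1 H0 P) t"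
    "\<And>f. f \<in> FF \<Longrightarrow> f \<noteq> 0 \<Longrightarrow> dvr_set.has_ord (LR P) t f (ord P f)"
proof -
  obtain x y z \<alpha> \<beta> where "chart g H1 H0 x y z \<alpha> \<beta>" "P = wproj g (x, y, z)"
    using point_chart[OF assms] .
  then obtain t where t: "dvr_set (LR P) (max_ideal g H1 H0 P) t"
     "\<And>f. f \<in> FF - {0} \<Longrightarrow> \<exists>n. dvr_set.has_ord (LR P) t f n"
    using chart.chart_dvr by metis
  interpret D: dvr_set "LR P" "max_ideal g H1 H0 P" t by (rule t(1))
  have "ord P f = n" if "D.has_ord f n" for f n
    unfolding ord_at_def local_order_def by (rule D.the_ord[OF that])
  then show ?thesis using that t by blast
qed

lemma ord_eqI:
  assumes "P \<in> CP" "dvr_set (LR P) (max_ideal g H1 H0 P) t" "dvr_set.has_ord (LR P) t f n"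
  shows "ord P f = n"
  unfolding ord_at_def local_order_def by (rule dvr_set.the_ord[OF assms(2,3)])

lemma LR_subset_FF: "P \<in> CP \<Longrightarrow> f \<in> LR P \<Longrightarrow> f \<in> FF"
proof -
  assume P: "P \<in> CP" and f: "f \<in> LR P"
  obtain x y z \<alpha> \<beta> where C: "chart g H1 H0 x y z \<alpha> \<beta>" "P = wproj g (x, y, z)"
    using point_chart[OF P] .
  interpret C: chart g H1 H0 x y z \<alpha> \<beta> by (rule C)
  show "f \<in> FF"
    using f C.ev_eq_0 unfolding C(2) C.local_ring_eq C.function_field_eq by blast
qed

context
  fixes P assumes P: "P \<in> CP"
begin

lemma LR_add: "f \<in> LR P \<Longrightarrow> h \<in> LR P \<Longrightarrow> f + h \<in> LR P"
  using dvr_at[OF P] dvr_set.R_add by metis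

lemma ord_mult:
  assumes "f \<in> FF" "f \<noteq> 0" "h \<in> FF" "h \<noteq> 0"
  shows "ord P (f * h) = ord P f + ord P h"
proof -
  obtain t where t: "dvr_set (LR P) (max_ideal g H1 H0 P) t"
    "\<And>f. f \<in> FF \<Longrightarrow> f \<noteq> 0 \<Longrightarrow> dvr_set.has_ord (LR P) t f (ord P f)" using dvr_at[OF P] by blast
  show ?thesis
    using ord_eqI[OF P t(1) dvr_set.has_ord_mult[OF t(1) t(2) t(2)]] assms by blast
qed

lemma ord_inverse:
  assumes "f \<in> FF" "f \<noteq> 0"
  shows "ord P (inverse f) = - ord P f"
proof -
  obtain t where t: "dvr_set (LR P) (max_ideal g H1 H0 P) t"
    "\<And>f. f \<in> FF \<Longrightarrow> f \<noteq> 0 \<Longrightarrow> dvr_set.has_ord (LR P) t f (ord P f)" using dvr_at[OF P] by blast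
  show ?thesis
    using ord_eqI[OF P t(1) dvr_set.has_ord_inverse[OF t(1) t(2)]] assms by blast
qed

lemma ord_divide:
  assumes "f \<in> FF" "f \<noteq> 0" "h \<in> FF" "h \<noteq> 0"
  shows "ord P (f / h) = ord P f - ord P h"
  unfolding divide_inverse using assms ord_mult[of f "inverse h"] ord_inverse[of h] FF_inverse by simp

lemma ord_nonneg_iff:
  assumes "f \<in> FF" "f \<noteq> 0"
  shows "ord P f \<ge> 0 \<longleftrightarrow> f \<in> LR P"
proof -
  obtain t where t: "dvr_set (LR P) (max_ideal g H1 H0 P) t"
    "\<And>f. f \<in> FF \<Longrightarrow> f \<noteq> 0 \<Longrightarrow> dvr_set.has_ord (LR P) t f (ord P f)" using dvr_at[OF P] by blast
  show ?thesis
    using dvr_set.has_ord_nonneg[OF t(1) t(2)] assms by blast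
qed

lemma ord_unit: "f \<in> LR P \<Longrightarrow> inverse f \<in> LR P \<Longrightarrow> f \<noteq> 0 \<Longrightarrow> ord P f = 0"
  using ord_nonneg_iff[of f] ord_nonneg_iff[of "inverse f"] ord_inverse[of f] LR_subset_FF[OF P]
  by (metis FF_inverse inverse_nonzero_iff_nonzero neg_0_le_iff_le order_antisym)

lemma ord_1: "ord P 1 = 0"
  using ord_mult[of 1 1] FF_1 by simp

lemma ord_power:
  assumes "f \<in> FF" "f \<noteq> 0" shows "ord P (f ^ n) = int n * ord P f"
  using assms by (induction n) (simp_all add: ord_1 ord_mult FF_power algebra_simps)

lemma ord_powi:
  assumes "f \<in> FF" "f \<noteq> 0" shows "ord P (f powi n) = n * ord P f"
proof (cases "n \<ge> 0")
  case True
  then show ?thesis using ord_power[OF assms, of "nat n"] by (simp add: power_int_def)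
next
  case False
  then show ?thesis using ord_power[of "inverse f" "nat (- n)"] ord_inverse[OF assms] assms
    by (simp add: power_int_def FF_inverse)
qed

lemma uniformizer_exists:
  "\<exists>t\<in>FF. t \<noteq> 0 \<and> ord P t = 1 \<and> (\<forall>f\<in>FF. f \<noteq> 0 \<longrightarrow> (\<exists>w. w \<noteq> 0 \<and> w \<in> LR P \<and> inverse w \<in> LR P \<and> f = t powi (ord P f) * w))"
proof -
  obtain t where t: "dvr_set (LR P) (max_ideal g H1 H0 P) t"
    "\<And>f. f \<in> FF \<Longrightarrow> f \<noteq> 0 \<Longrightarrow> dvr_set.has_ord (LR P) t f (ord P f)" using dvr_at[OF P] by blast
  interpret D: dvr_set "LR P" "max_ideal g H1 H0 P" t by (rule t(1))
  have "D.has_ord t 1" using D.has_ord_power[OF D.unit_1, of 1] by simp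
  then have "ord P t = 1" by (rule ord_eqI[OF P t(1)])
  moreover have "t \<in> FF" using LR_subset_FF[OF P D.t(1)] .
  moreover have "\<exists>w. w \<noteq> 0 \<and> w \<in> LR P \<and> inverse w \<in> LR P \<and> f = t powi (ord P f) * w"
    if "f \<in> FF" "f \<noteq> 0" for f
    using t(2)[OF that] unfolding D.has_ord_def D.ring_unit_def by blast
  ultimately show ?thesis using D.t by blast
qed

end

text \<open>Since units go to units, \<open>\<tau>\<close> multiplies all orders by the order of the
  image of a uniformizer. This factor is nonnegative, as the image is regular, and it divides 1, as
  a uniformizer at \<open>Q\<close> is itself an image. The lemma serves both the involution and the
  Galois action.\<close>

lemma ord_transport:
  assumes \<tau>: "rhom \<tau>" and PQ: "P \<in> CP" "Q \<in> CP" and LR: "\<tau> ` LR P = LR Q" and FF: "\<tau> ` FF = FF"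
    and f: "f \<in> FF" "f \<noteq> 0"
  shows "ord Q (\<tau> f) = ord P f"
proof -
  have nz: "\<tau> h \<noteq> 0" if "h \<noteq> 0" for h using that rhom_eq_0_iff[OF \<tau>] by blast
  obtain t where t: "t \<in> FF" "t \<noteq> 0" "ord P t = 1"
    and fact: "\<And>f. f \<in> FF \<Longrightarrow> f \<noteq> 0 \<Longrightarrow> \<exists>w. w \<noteq> 0 \<and> w \<in> LR P \<and> inverse w \<in> LR P \<and> f = t powi (ord P f) * w"
    using uniformizer_exists[OF PQ(1)] by blast
  obtain t' where t': "t' \<in> FF" "t' \<noteq> 0" "ord Q t' = 1"
    using uniformizer_exists[OF PQ(2)] by blast
  have powi: "\<tau> (h powi n) = \<tau> h powi n" for h n
    by (cases "n \<ge> 0") (simp_all add: power_int_def rhom.power[OF \<tau>] rhom_inverse[OF \<tau>])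
  have ord: "ord Q (\<tau> h) = ord P h * ord Q (\<tau> t)" if h: "h \<in> FF" "h \<noteq> 0" for h
  proof -
    obtain w where w: "w \<noteq> 0" "w \<in> LR P" "inverse w \<in> LR P" "h = t powi (ord P h) * w"
      using fact[OF h] by blast
    have \<tau>w: "\<tau> w \<in> LR Q" "inverse (\<tau> w) \<in> LR Q"
      using w LR by (auto simp flip: rhom_inverse[OF \<tau>])
    have t_FF: "\<tau> t \<in> FF" using t FF by blast
    have "\<tau> h = \<tau> t powi (ord P h) * \<tau> w" by (subst w(4)) (simp add: rhom.mult[OF \<tau>] powi)
    then have "ord Q (\<tau> h) = ord Q (\<tau> t powi (ord P h)) + ord Q (\<tau> w)"
      using ord_mult[OF PQ(2), of "\<tau> t powi (ord P h)" "\<tau> w"] FF_powi[OF t_FF] LR_subset_FF[OF PQ(2)]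
        \<tau>w w(1) nz t(2) by simp
    then show ?thesis
      using ord_powi[OF PQ(2) t_FF] nz t ord_unit[OF PQ(2) \<tau>w] w(1) by simp
  qed
  have "t \<in> LR P" using ord_nonneg_iff[OF PQ(1) t(1,2)] t(3) by simp
  then have "\<tau> t \<in> LR Q" using LR by blast
  then have "ord Q (\<tau> t) \<ge> 0" using ord_nonneg_iff[OF PQ(2)] LR_subset_FF[OF PQ(2)] nz[OF t(2)] by blast
  obtain h where h: "h \<in> FF" "t' = \<tau> h" using t'(1) FF by blast
  then have "h \<noteq> 0" using t' rhom.zero[OF \<tau>] by auto
  then have "ord P h * ord Q (\<tau> t) = 1" using ord[OF h(1)] t'(3) h(2) by simp
  with \<open>ord Q (\<tau> t) \<ge> 0\<close>   have "ord Q (\<tau> t) = 1" by (simp add: zmult_eq_1_iff)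
  then show ?thesis using ord[OF f] by simp
qed

text \<open>The linear form \<open>c X - a Z\<close>, which vanishes at \<open>(a : c)\<close>.\<close>

definition linf :: "'k alg_closure \<Rightarrow> 'k alg_closure \<Rightarrow> 'k alg_closure fun_ext" where
  "linf a c = fun_const c * fx - fun_const a"

lemma linf_altdef: "linf a c = fun_const c * fx + fun_const (- a)"
  by (simp add: linf_def rhom.minus[OF rhom_fun_const])

lemma linf_nz: "(a, c) \<noteq> (0, 0) \<Longrightarrow> linf a c \<noteq> 0"
  unfolding linf_altdef linear_in_fun_x_eq_0_iff by auto

lemma linf_rational: "linf a c \<in> rational_functions"
  unfolding linf_altdef linear_in_fun_x by blast

lemma linf_FF: "linf a c \<in> FF"
  by (rule FF_rational[OF linf_rational])

text \<open>Depends only on the zero set of \<open>H1\<close>, hence not on the representative of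
  \<open>(x : z)\<close>.\<close>

definition ram_index :: "'k alg_closure \<Rightarrow> 'k alg_closure \<Rightarrow> int" where
  "ram_index x z = (if h1 x z = 0 then 2 else 1)"

text \<open>Stated for quotients because a single linear form has an order only after division by
  another form of degree 1. The local reference form is \<open>M\<close>, which does not vanish at
  the point; no separate treatment of infinity arises.\<close>

lemma ord_linf:
  assumes pt: "on_curve (x, y, z)" and ac: "(a, c) \<noteq> (0, 0)" and ac': "(a', c') \<noteq> (0, 0)"
  shows "ord (wproj g (x, y, z)) (linf a c / linf a' c') =
     (if c * x = a * z then ram_index x z else 0) - (if c' * x = a' * z then ram_index x z else 0)"
proof -
  obtain \<alpha> \<beta> where C: "chart g H1 H0 x y z \<alpha> \<beta>" using chart_exists[OF pt] by blast
  interpret C: chart g H1 H0 x y z \<alpha> \<beta> by (rule C)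
  interpret U: rhom C.evu by (rule C.rhom_evu)
  interpret FC: rhom fun_const by (rule rhom_fun_const)
  let ?P = "wproj g (x, y, z)"
  have P: "?P \<in> CP" using pt unfolding curve_points_eq by blast
  have mm: "C.mm \<in> FF" "C.mm \<noteq> 0" using FF_rational[OF C.mm_rational] C.mm_nz by auto
  have ord: "ord ?P (linf a c / C.mm) = (if c * x = a * z then ram_index x z else 0)"
    if ac: "(a, c) \<noteq> (0, 0)" for a c
  proof (cases "c * x = a * z")
    case False
    define p where "p = [:c:] * [:x, \<beta>:] - [:a:] * [:z, - \<alpha>:]"
    have p0: "C.val0 [:p:] \<noteq> 0" using False by (simp add: p_def mult.commute)
    have "C.evu p = fun_const c * (fx / C.mm) - fun_const a * (1 / C.mm)"
      unfolding p_def U.diff U.mult C.evu_X C.evu_Z C.evu_const ..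
    also have "\<dots> = linf a c / C.mm" by (simp add: linf_def diff_divide_distrib)
    finally have "C.local_unit (linf a c / C.mm)" using C.local_unit_ev[OF p0] by simp
    then have "linf a c / C.mm \<in> LR ?P" "inverse (linf a c / C.mm) \<in> LR ?P" "linf a c / C.mm \<noteq> 0"
      using C.local_unit_in_ring C.local_unit_inverse C.local_unit_nz by blast+
    then show ?thesis using ord_unit[OF P] False by simp
  next
    case True
    \<comment> \<open>A linear form vanishing at \<open>(x : z)\<close> is a multiple of
      \<open>L\<close>; pairing \<open>(a, c) = k (x, z)\<close> with the transversal vector
      recovers the factor \<open>k\<close>.\<close>
    define k where "k = \<alpha> * a + \<beta> * c"
    have k: "a = k * x" "c = k * z"
    proof -
      have "a = a * (\<alpha> * x + \<beta> * z)" using C.transversal by simp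
      also have "\<dots> = a * \<alpha> * x + \<beta> * (a * z)" by (simp add: algebra_simps)
      also have "\<dots> = k * x" unfolding True[symmetric] k_def by (simp add: algebra_simps)
      finally show "a = k * x" .
      have "c = c * (\<alpha> * x + \<beta> * z)" using C.transversal by simp
      also have "\<dots> = \<alpha> * (c * x) + \<beta> * z * c" by (simp add: algebra_simps)
      also have "\<dots> = k * z" unfolding True k_def by (simp add: algebra_simps)
      finally show "c = k * z" .
    qed
    have "k \<noteq> 0" using ac k by auto
    have "linf a c = fun_const k * C.ll"
      by (simp add: linf_def C.ll_def k FC.mult algebra_simps)
    then have eq: "linf a c / C.mm = fun_const k * C.u" by (simp add: C.u_def)
    have "C.local_unit (C.ev [:[:k:]:])" using \<open>k \<noteq> 0\<close> by (intro C.local_unit_ev) simp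
    then have "C.local_unit (fun_const k)" by simp
    then have "ord ?P (fun_const k) = 0"
      using ord_unit[OF P] C.local_unit_in_ring C.local_unit_inverse C.local_unit_nz by blast
    moreover have "C.u \<in> FF" by (rule FF_rational[OF C.u_rational])
    ultimately have "ord ?P (fun_const k * C.u) = ord ?P C.u"
      using ord_mult[OF P, of "fun_const k" C.u] \<open>k \<noteq> 0\<close> C.u_nz FF_const by simp
    moreover have "ord ?P C.u = ram_index x z"
    proof -
      obtain t where t: "dvr_set (LR ?P) (max_ideal g H1 H0 ?P) t"
        "dvr_set.has_ord (LR ?P) t C.u (if h1 x z = 0 then 2 else 1)"
        using C.chart_dvr by blast
      show ?thesis unfolding ram_index_def by (rule ord_eqI[OF P t])
    qed
    ultimately show ?thesis using True by (simp add: eq)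
  qed
  have "linf a c / linf a' c' = (linf a c / C.mm) / (linf a' c' / C.mm)" using mm by simp
  also have "ord ?P \<dots> = ord ?P (linf a c / C.mm) - ord ?P (linf a' c' / C.mm)"
    using mm linf_nz[OF ac] linf_nz[OF ac'] by (intro ord_divide[OF P] FF_divide linf_FF) simp_all
  finally show ?thesis unfolding ord[OF ac] ord[OF ac'] .
qed

lemma ord_const:
  assumes "P \<in> CP" "c \<noteq> 0"
  shows "ord P (fun_const c) = 0"
proof -
  obtain x y z \<alpha> \<beta> where C: "chart g H1 H0 x y z \<alpha> \<beta>" "P = wproj g (x, y, z)"
    using point_chart[OF assms(1)] .
  interpret C: chart g H1 H0 x y z \<alpha> \<beta> by (rule C)
  have "C.local_unit (C.ev [:[:c:]:])" using assms(2) by (intro C.local_unit_ev) simp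
  then have "C.local_unit (fun_const c)" by simp
  then show ?thesis
    using ord_unit[OF assms(1)] C.local_unit_in_ring C.local_unit_inverse C.local_unit_nz C(2) by blast
qed

lemma const_in_LR: "P \<in> CP \<Longrightarrow> fun_const c \<in> LR P"
proof -
  assume "P \<in> CP"
  then obtain x y z \<alpha> \<beta> where C: "chart g H1 H0 x y z \<alpha> \<beta>" "P = wproj g (x, y, z)"
    using point_chart by blast
  interpret C: chart g H1 H0 x y z \<alpha> \<beta> by (rule C)
  have "fun_const c = C.ev [:[:c:]:] / C.ev 1" "C.val0 1 \<noteq> 0"
    by (simp_all add: rhom.one[OF C.rhom_ev] rhom.one[OF C.rhom_val0])
  then show ?thesis unfolding C(2) C.local_ring_eq by blast
qed

text \<open>A function of \<open>x\<close> is a fraction in \<open>u\<close>, and \<open>u\<close>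
  has order 2 here. Each polynomial in \<open>u\<close> is a power of \<open>u\<close> times a
  unit.\<close>

lemma even_ord_at_ramified:
  assumes pt: "on_curve (x, y, z)" and ram: "h1 x z = 0" and f: "f \<in> rational_functions" "f \<noteq> 0"
  shows "even (ord (wproj g (x, y, z)) f)"
proof -
  obtain \<alpha> \<beta> where C: "chart g H1 H0 x y z \<alpha> \<beta>" using chart_exists[OF pt] by blast
  interpret C: chart g H1 H0 x y z \<alpha> \<beta> by (rule C)
  interpret U: rhom C.evu by (rule C.rhom_evu)
  let ?P = "wproj g (x, y, z)"
  have P: "?P \<in> CP" using pt unfolding curve_points_eq by blast
  have u: "ord ?P C.u = 2"
  proof -
    obtain t where t: "dvr_set (LR ?P) (max_ideal g H1 H0 ?P) t"
      "dvr_set.has_ord (LR ?P) t C.u (if h1 x z = 0 then 2 else 1)"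
      using C.chart_dvr by blast
    show ?thesis using ord_eqI[OF P t] ram by simp
  qed
  have uF: "C.u \<in> FF" "C.u \<noteq> 0" using FF_rational[OF C.u_rational] C.u_nz by auto
  have evuF: "C.evu p \<in> FF" for p by (rule FF_rational[OF C.evu_rational])
  have ord: "even (ord ?P (C.evu p))" if p: "p \<noteq> 0" for p
  proof -
    obtain k r where r: "p = [:0, 1:] ^ k * r" "poly r 0 \<noteq> 0" using remove_zero[OF p] by blast
    have "C.local_unit (C.ev [:r:])" using r(2) by (intro C.local_unit_ev) simp
    then have unit: "ord ?P (C.evu r) = 0"
      using ord_unit[OF P] C.local_unit_in_ring C.local_unit_inverse C.local_unit_nz by (metis C.ev_const)
    have "r \<noteq> 0" using r(2) by auto
    have "C.evu p = C.u ^ k * C.evu r" by (simp only: r(1) U.mult U.power C.evu_T)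
    then have "ord ?P (C.evu p) = int k * 2"
      using ord_mult[OF P FF_power[OF uF(1), of k] _ evuF, of r] \<open>r \<noteq> 0\<close> uF ord_power[OF P uF] u unit by auto
    then show ?thesis by simp
  qed
  obtain p q where pq: "f = C.evu p / C.evu q" "q \<noteq> 0" using f(1) unfolding C.rational_eq by blast
  then have "p \<noteq> 0" using f(2) by auto
  then show ?thesis
    using ord_divide[OF P evuF _ evuF, of p q] pq ord by simp
qed

end

declare wproj.simps [simp del]

section \<open>Automorphisms of the rational function field\<close>

lemma irreducible_quadratic:
  fixes a b :: "'a::field"
  assumes "\<And>r. poly [:b, a, 1:] r \<noteq> 0"
  shows "irreducible [:b, a, 1:]"
proof (rule irreducibleI)
  show "[:b, a, 1:] \<noteq> 0" by simp
  show "\<not> is_unit [:b, a, 1:]" by (simp add: is_unit_iff_degree)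
  fix p q assume pq: "[:b, a, 1:] = p * q"
  show "is_unit p \<or> is_unit q"
  proof (rule ccontr)
    assume "\<not> (is_unit p \<or> is_unit q)"
    moreover have nz: "p \<noteq> 0" "q \<noteq> 0" using pq by auto
    ultimately have "degree p \<noteq> 0" "degree q \<noteq> 0" by (auto simp: is_unit_iff_degree)
    moreover have "degree p + degree q = 2"
      using degree_mult_eq[OF nz] unfolding pq[symmetric] by simp
    ultimately have "degree p = 1" by simp
    then obtain c d where p: "p = [:c, d:]" "d \<noteq> 0"
      by (metis degree1_coeffs)
    then have "poly p (- c / d) = 0" by simp
    then show False using assms[of "- c / d"] unfolding pq by simp
  qed
qed

lemma fract_hom_extension:
  fixes \<chi> :: "'a::idom \<Rightarrow> 'b::field"
  assumes "rhom \<chi>" "\<And>a. \<chi> a = 0 \<Longrightarrow> a = 0"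
  shows "\<exists>\<psi>. rhom \<psi> \<and> (\<forall>a. \<psi> (to_fract a) = \<chi> a)"
proof -
  interpret rhom \<chi> by fact
  have rep: "\<exists>a b. b \<noteq> 0 \<and> w = to_fract a / to_fract b" for w :: "'a fract"
    by (metis Fract_conv_to_fract Fract_cases)
  define \<psi> where "\<psi> w = (SOME v. \<exists>a b. b \<noteq> 0 \<and> w = to_fract a / to_fract b \<and> v = \<chi> a / \<chi> b)" for w
  have \<psi>: "\<psi> (to_fract a / to_fract b) = \<chi> a / \<chi> b" if "b \<noteq> 0" for a b
    unfolding \<psi>_def
  proof (rule some_equality)
    show "\<exists>c d. d \<noteq> 0 \<and> to_fract a / to_fract b = to_fract c / to_fract d \<and> \<chi> a / \<chi> b = \<chi> c / \<chi> d"
      using that by blast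
  next
    fix v assume "\<exists>c d. d \<noteq> 0 \<and> to_fract a / to_fract b = to_fract c / to_fract d \<and> v = \<chi> c / \<chi> d"
    then obtain c d where cd: "d \<noteq> 0" "to_fract a / to_fract b = to_fract c / to_fract d" "v = \<chi> c / \<chi> d"
      by blast
    then have "to_fract (a * d) = to_fract (c * b)"
      using that by (simp add: frac_eq_eq)
    then have "\<chi> (a * d) = \<chi> (c * b)" by (simp only: to_fract_eq_iff)
    then have "\<chi> a * \<chi> d = \<chi> c * \<chi> b" by (simp only: mult)
    then show "v = \<chi> a / \<chi> b" unfolding cd(3) using that cd(1) assms(2) by (metis frac_eq_eq)
  qed
  have \<psi>1: "\<psi> (to_fract a) = \<chi> a" for a using \<psi>[of 1 a] by simp
  have "rhom \<psi>"
  proof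
    show "\<psi> 1 = 1" using \<psi>1[of 1] by simp
    fix v w :: "'a fract"
    obtain a b c d where *: "b \<noteq> 0" "v = to_fract a / to_fract b" "d \<noteq> 0" "w = to_fract c / to_fract d"
      using rep[of v] rep[of w] by blast
    have nz: "\<chi> b \<noteq> 0" "\<chi> d \<noteq> 0" using * assms(2) by blast+
    have "v + w = to_fract (a * d + c * b) / to_fract (b * d)"
      using * by (simp add: add_frac_eq)
    moreover have "\<psi> (to_fract (a * d + c * b) / to_fract (b * d)) = \<chi> (a * d + c * b) / \<chi> (b * d)"
      using * by (intro \<psi>) simp
    ultimately show "\<psi> (v + w) = \<psi> v + \<psi> w"
      using * nz by (simp add: \<psi> add mult add_frac_eq)
    have "v * w = to_fract (a * c) / to_fract (b * d)" using * by simp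
    moreover have "\<psi> (to_fract (a * c) / to_fract (b * d)) = \<chi> (a * c) / \<chi> (b * d)"
      using * by (intro \<psi>) simp
    ultimately show "\<psi> (v * w) = \<psi> v * \<psi> w"
      using * by (simp add: \<psi> mult)
  qed
  with \<psi>1 show ?thesis by blast
qed

lemma fract_automorphism:
  fixes \<sigma> :: "'a::field \<Rightarrow> 'a"
  assumes "rhom \<sigma>" "bij \<sigma>"
  shows "\<exists>\<psi>. rhom \<psi> \<and> bij \<psi> \<and> (\<forall>p. \<psi> (to_fract p) = to_fract (map_poly \<sigma> p))"
proof -
  have inj: "map_poly \<sigma> p = 0 \<Longrightarrow> p = 0" for p
    using rhom_eq_0_iff[OF assms(1)] by (simp add: poly_eq_iff coeff_map_poly rhom.zero[OF assms(1)])
  have "rhom (\<lambda>p. to_fract (map_poly \<sigma> p))"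
    by (rule rhom_comp[OF rhom.map_poly[OF assms(1)] rhom_to_fract])
  then obtain \<psi> where \<psi>: "rhom \<psi>" "\<And>p. \<psi> (to_fract p) = to_fract (map_poly \<sigma> p)"
    using fract_hom_extension[of "\<lambda>p. to_fract (map_poly \<sigma> p)"] inj by auto
  have surj: "\<exists>q. map_poly \<sigma> q = p" for p
  proof
    show "map_poly \<sigma> (map_poly (inv_into UNIV \<sigma>) p) = p"
      using assms by (intro poly_eqI)
        (simp add: coeff_map_poly rhom.zero[OF rhom_inv] rhom.zero bij_is_surj surj_f_inv_f)
  qed
  have "\<exists>v. \<psi> v = w" for w
  proof -
    obtain a b where w: "w = to_fract a / to_fract b" by (metis Fract_conv_to_fract Fract_cases)
    obtain a' b' where "map_poly \<sigma> a' = a" "map_poly \<sigma> b' = b" using surj by metis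
    then have "\<psi> (to_fract a' / to_fract b') = w" by (simp add: rhom_divide[OF \<psi>(1)] \<psi>(2) w)
    then show ?thesis by blast
  qed
  then have "bij \<psi>" using rhom_inj[OF \<psi>(1)] unfolding bij_def surj_def by metis
  then show ?thesis using \<psi> by blast
qed

context curve begin

definition e1 :: "'k alg_closure poly fract" where
  "e1 = eval2 (\<lambda>c. to_fract [:to_ac c:]) H1 (to_fract [:0, 1:]) 1"
definition e0 :: "'k alg_closure poly fract" where
  "e0 = eval2 (\<lambda>c. to_fract [:to_ac c:]) H0 (to_fract [:0, 1:]) 1"

lemma rhom_e: "rhom (\<lambda>c. to_fract [:to_ac c:])"
  by (rule rhom_comp[OF rhom_comp[OF rhom_to_ac rhom_const] rhom_to_fract])

lemma gen_h_eq: "gen_h1 = to_ac e1" "gen_h0 = to_ac e0"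
  unfolding e1_def e0_def gen_h1_def gen_h0_def fun_const_def fun_x_def
  by (simp_all add: hom_eval2[OF rhom_e rhom_to_ac])

text \<open>The minimal polynomial of \<open>y\<close>, with coefficients in \<open>K(x)\<close>
  itself and not in its closure, as the extension theorem demands; \<open>e1\<close> and
  \<open>e0\<close> are \<open>gen_h1\<close> and \<open>gen_h0\<close> before the
  embedding.\<close>

definition qpoly :: "'k alg_closure poly fract poly" where
  "qpoly = [:- e0, e1, 1:]"

lemma qpoly_eval: "poly (map_poly to_ac qpoly) r = r * r + gen_h1 * r - gen_h0"
  by (simp add: qpoly_def map_poly_pCons gen_h_eq one_pCons algebra_simps)

lemma qpoly_roots: "poly (map_poly to_ac qpoly) r = 0 \<longleftrightarrow> r = fy \<or> r = - fy - gen_h1"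
proof -
  have "poly (map_poly to_ac qpoly) r = (r - fy) * (r - (- fy - gen_h1)) + (fy * fy + gen_h1 * fy - gen_h0)"
    unfolding qpoly_eval by (simp add: algebra_simps)
  also have "\<dots> = (r - fy) * (r - (- fy - gen_h1))" unfolding fun_y_square by simp
  finally show ?thesis by auto
qed

lemma irreducible_qpoly: "irreducible qpoly"
  unfolding qpoly_def
proof (rule irreducible_quadratic)
  fix r
  have "poly (map_poly to_ac qpoly) (to_ac r) \<noteq> 0"
  proof
    assume "poly (map_poly to_ac qpoly) (to_ac r) = 0"
    then have "to_ac r = fy \<or> to_ac r = - fy - gen_h1" by (simp add: qpoly_roots)
    moreover have "fy = - gen_h1 - to_ac r" if "to_ac r = - fy - gen_h1" using that by simp
    ultimately have "fy \<in> rational_functions"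
      using gen_h_rational range_to_ac_closed(2,5) by (metis rangeI)
    then show False using fun_y_irrational by blast
  qed
  then show "poly [:- e0, e1, 1:] r \<noteq> 0"
    unfolding qpoly_def[symmetric] rhom.poly[OF rhom_to_ac, symmetric] by simp
qed

subsection \<open>The hyperelliptic involution\<close>

lemma iota_exists:
  "\<exists>\<tau>. rhom \<tau> \<and> bij \<tau> \<and> (\<forall>c. \<tau> (to_ac c) = to_ac c) \<and> \<tau> fy = - fy - gen_h1"
  using alg_closure_automorphism_extension[OF rhom_id(1) bij_id[unfolded id_def] irreducible_qpoly, of fy "- fy - gen_h1"]
  by (simp add: qpoly_roots)

text \<open>An automorphism of the whole algebraic closure, chosen arbitrarily above the function
  field. Only its restriction to \<open>FF\<close> is canonical and an involution.\<close>

definition iota :: "'k alg_closure fun_ext \<Rightarrow> 'k alg_closure fun_ext" where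
  "iota = (SOME \<tau>. rhom \<tau> \<and> bij \<tau> \<and> (\<forall>c. \<tau> (to_ac c) = to_ac c) \<and> \<tau> fy = - fy - gen_h1)"

lemma rhom_iota: "rhom iota" and bij_iota: "bij iota"
  and iota_to_ac: "iota (to_ac c) = to_ac c" and iota_fun_y: "iota fy = - fy - gen_h1"
  using someI_ex[OF iota_exists] unfolding iota_def[symmetric] by blast+

interpretation I: rhom iota by (rule rhom_iota)

lemma iota_rational: "a \<in> rational_functions \<Longrightarrow> iota a = a"
  using iota_to_ac by auto

lemma iota_qext:
  assumes "a \<in> rational_functions" "b \<in> rational_functions"
  shows "iota (a + b * fy) = (a - b * gen_h1) + (- b) * fy"
  by (simp add: I.add I.mult iota_rational assms iota_fun_y algebra_simps)

lemma iota_FF: "f \<in> FF \<Longrightarrow> iota f \<in> FF"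
  unfolding FF_eq
proof -
  assume "f \<in> qext"
  then obtain a b where *: "f = a + b * fy" "a \<in> rational_functions" "b \<in> rational_functions"
    unfolding qext_def by blast
  show "iota f \<in> qext"
    unfolding *(1) iota_qext[OF *(2,3)] by (intro qextI range_to_ac_closed * gen_h_rational)
qed

lemma iota_iota:
  assumes "f \<in> FF"
  shows "iota (iota f) = f"
proof -
  obtain a b where *: "f = a + b * fy" "a \<in> rational_functions" "b \<in> rational_functions"
    using assms unfolding FF_eq qext_def by blast
  show ?thesis
    by (simp add: * I.add I.mult I.diff I.minus iota_rational gen_h_rational iota_fun_y algebra_simps)
qed

lemma iota_image_FF: "iota ` FF = FF"
  using iota_FF iota_iota by force

text \<open>If \<open>H1 = 0\<close>, the derivative in \<open>Y\<close> vanishes identically in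
  characteristic 2, so smoothness says that the gradient of \<open>H0\<close> has no zero. Then the
  derivative in \<open>X\<close> has no zero on \<open>Z = 1\<close> and is constant there. This
  kills the coefficient of \<open>X^(2g+1) Z\<close> in \<open>H0\<close>, which is the value of the
  derivative in \<open>Z\<close> at \<open>(1 : 0)\<close>, and the curve is singular there.\<close>

lemma H1_nz: "H1 \<noteq> 0"
proof
  assume H1: "H1 = 0"
  have sing: "eval2 to_ac (map_poly pderiv H0) x0 z0 * \<beta> - eval2 to_ac (pderiv H0) x0 z0 * \<alpha> \<noteq> 0"
    if "(x0, z0) \<noteq> (0, 0)" "\<alpha> * x0 + \<beta> * z0 = 1" for x0 z0 \<alpha> \<beta>
  proof -
    obtain y0 where "y0\<^sup>2 + h1 x0 z0 * y0 = h0 x0 z0" using point_exists by blast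
    then have pt: "on_curve (x0, y0, z0)" using that by (simp add: on_curve_def)
    have C: "rhom (\<lambda>c. [:to_ac c:])" by (rule rhom_comp[OF rhom_to_ac rhom_const])
    have at0: "poly (eval2 (\<lambda>c. [:to_ac c:]) Q [:x0, \<beta>:] [:z0, - \<alpha>:]) 0 = eval2 to_ac Q x0 z0" for Q
      using hom_eval2[OF C rhom_poly[of 0], of Q "[:x0, \<beta>:]" "[:z0, - \<alpha>:]"] by simp
    have "poly (pderiv (eval2 (\<lambda>c. [:to_ac c:]) H0 [:x0, \<beta>:] [:z0, - \<alpha>:])) 0 \<noteq> 0"
      using smooth_direction[OF pt that(2) refl refl] by (simp add: H1 two_eq_0)
    then show ?thesis unfolding pderiv_eval2[OF rhom_to_ac] by (simp add: at0 pderiv_pCons mult.commute)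
  qed
  define D where "D = map_poly to_ac (dehomogenize (map_poly pderiv H0))"
  have "poly D a \<noteq> 0" for a
    using sing[of a 1 0 1] by (simp add: D_def eval2_at_one[OF rhom_to_ac])
  then have "degree D = 0" using alg_closed_imp_poly_has_root[of D] by auto
  then have "coeff D (2 * g) = 0" using g by (intro coeff_eq_0) simp
  moreover have hX: "homogeneous (2 * g + 1) (map_poly pderiv H0)"
    unfolding homogeneous_def
  proof (intro allI impI)
    fix i j assume "coeff (coeff (map_poly pderiv H0) j) i \<noteq> 0"
    then have "coeff (coeff H0 j) (Suc i) \<noteq> 0" by (auto simp: coeff_map_poly coeff_pderiv)
    then show "i + j = 2 * g + 1"
      using hom0[unfolded homogeneous_def, rule_format, of j "Suc i"] by simp
  qed
  moreover from this have "coeff D (2 * g) = to_ac (coeff (coeff (map_poly pderiv H0) 1) (2 * g))"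
    by (simp add: D_def coeff_map_poly coeff_dehomogenize)
  ultimately have "coeff (coeff (map_poly pderiv H0) 1) (2 * g) = 0" by simp
  then have "of_nat (Suc (2 * g)) * coeff (coeff H0 1) (Suc (2 * g)) = (0 :: 'k)"
    by (simp only: coeff_map_poly[where f = pderiv, OF pderiv_0] coeff_pderiv)
  moreover have "(of_nat (Suc (2 * g)) :: 'k) = 1"
    using of_nat_CHAR[where 'a = 'k] char2 by simp
  ultimately have 0: "coeff (coeff H0 1) (Suc (2 * g)) = 0" by (metis mult_1)
  have coeff_Z: "coeff (coeff (pderiv H0) j) i = of_nat (Suc j) * coeff (coeff H0 (Suc j)) i" for i j
    by (simp only: coeff_pderiv of_nat_poly) simp
  have hZ: "homogeneous (2 * g + 1) (pderiv H0)"
    unfolding homogeneous_def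
  proof (intro allI impI)
    fix i j assume "coeff (coeff (pderiv H0) j) i \<noteq> 0"
    then have "coeff (coeff H0 (Suc j)) i \<noteq> 0"
      unfolding coeff_Z by (metis mult_zero_right)
    then show "i + j = 2 * g + 1"
      using hom0[unfolded homogeneous_def, rule_format, of "Suc j" i] by simp
  qed
  have "eval2 to_ac (pderiv H0) 1 0 = 0"
    using 0 by (simp add: eval2_at_infinity[OF rhom_to_ac hZ] coeff_dehomogenize[OF hZ] coeff_Z)
  then show False using sing[of 1 0 1 0] by simp
qed

lemma gen_h1_eq: "gen_h1 = to_ac (to_fract (map_poly to_ac (dehomogenize H1)))"
  unfolding gen_h1_def to_ac_to_fract_eq
  by (simp add: eval2_at_one[OF rhom_comp[OF rhom_to_ac rhom_fun_const]] map_poly_map_poly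
      rhom.zero[OF rhom_fun_const] o_def)

lemma dehomogenize_H1_nz: "dehomogenize H1 \<noteq> 0"
proof
  assume "dehomogenize H1 = 0"
  then have "coeff (coeff H1 (g + 1 - i)) i = 0" for i
    using coeff_dehomogenize[OF hom1, of i] by simp
  then show False using homogeneous_expansion[OF hom1] H1_nz by simp
qed

lemma gen_h1_nz: "gen_h1 \<noteq> 0"
  using dehomogenize_H1_nz unfolding gen_h1_eq
  by (simp add: poly_eq_iff coeff_map_poly)

text \<open>In characteristic 2 the involution sends \<open>y\<close> to \<open>y + h1\<close>, so
  it changes \<open>a + b y\<close> by \<open>b h1\<close>. The fixed field is \<open>K(x)\<close>
  exactly because \<open>H1\<close> is nonzero.\<close>

lemma iota_fixed:
  assumes "f \<in> FF" "iota f = f"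
  shows "f \<in> rational_functions"
proof -
  obtain a b where *: "f = a + b * fy" "a \<in> rational_functions" "b \<in> rational_functions"
    using assms unfolding FF_eq qext_def by blast
  have "a - b * gen_h1 = a"
    using qext_unique[of "a - b * gen_h1" "- b" a b] assms(2) * iota_qext[OF *(2,3)] gen_h_rational
      range_to_ac_closed(2,3,5) by metis
  then have "b = 0" using gen_h1_nz by simp
  then show ?thesis using * by simp
qed

definition hyp :: "'k alg_closure \<times> 'k alg_closure \<times> 'k alg_closure \<Rightarrow> 'k alg_closure \<times> 'k alg_closure \<times> 'k alg_closure" where
  "hyp = (\<lambda>(x, y, z). (x, - y - h1 x z, z))"

definition hyp_pt :: "'k alg_closure wpoint \<Rightarrow> 'k alg_closure wpoint" where
  "hyp_pt P = hyp ` P"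

lemma hyp_wproj: "hyp_pt (wproj g (x, y, z)) = wproj g (x, - y - h1 x z, z)"
proof -
  have "hyp (c * x, c ^ (g + 1) * y, c * z) = (c * x, c ^ (g + 1) * (- y - h1 x z), c * z)" for c
    unfolding hyp_def prod.case h_scale by (simp only: right_diff_distrib mult_minus_right)
  then show ?thesis
    unfolding hyp_pt_def wproj.simps image_Collect by (simp only: setcompr_eq_image image_image)
qed

lemma hyp_on_curve: "on_curve (x, y, z) \<Longrightarrow> on_curve (x, - y - h1 x z, z)"
  by (simp add: on_curve_def power2_eq_square algebra_simps)

lemma hyp_CP: "P \<in> CP \<Longrightarrow> hyp_pt P \<in> CP"
  unfolding curve_points_eq using hyp_on_curve hyp_wproj by fastforce

lemma hyp_hyp: "hyp_pt (hyp_pt P) = P"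
proof -
  have "hyp (hyp p) = p" for p by (cases p) (simp add: hyp_def)
  then show ?thesis by (simp add: hyp_pt_def image_image)
qed

text \<open>The conjugate point lies over the same point of the line, so the same
  \<open>\<alpha>\<close> and \<open>\<beta>\<close> give its chart. The involution becomes the
  substitution \<open>v \<mapsto> - v - A\<close>, which exchanges evaluation at \<open>y\<close>
  and at \<open>y'\<close>.\<close>

lemma LR_iota_subset:
  assumes P: "P \<in> CP"
  shows "iota ` LR P \<subseteq> LR (hyp_pt P)"
proof -
  obtain x y z \<alpha> \<beta> where C: "chart g H1 H0 x y z \<alpha> \<beta>" "P = wproj g (x, y, z)"
    using point_chart[OF P] .
  interpret C: chart g H1 H0 x y z \<alpha> \<beta> by (rule C)
  define y' where "y' = - y - h1 x z"
  interpret C': chart g H1 H0 x y' z \<alpha> \<beta>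
    using hyp_on_curve[OF C.point] C.transversal
    by unfold_locales (simp_all add: y'_def)
  have P': "hyp_pt P = wproj g (x, y', z)" by (simp only: C(2) hyp_wproj y'_def)
  define r where "r a = pcompose a [:- C.A, - 1:]" for a
  have evu: "iota (C.evu p) = C.evu p" for p by (rule iota_rational[OF C.evu_rational])
  have "iota C.v = - C.v - C.evu C.A"
    unfolding C.v_def divide_inverse C.evu_A
    by (simp add: I.mult I.power rhom_inverse[OF rhom_iota] iota_fun_y iota_rational[OF C.mm_rational] algebra_simps)
  then have iota_v: "iota C.v = C.ev [:- C.A, - 1:]"
    by (simp add: C.ev_pCons rhom.minus[OF C.rhom_evu] rhom.one[OF C.rhom_evu] rhom.zero[OF C.rhom_ev])
  have ev: "iota (C.ev a) = C.ev (r a)" for a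
  proof (induction a)
    case (pCons p a)
    have "C.ev (r (pCons p a)) = C.evu p + C.ev [:- C.A, - 1:] * C.ev (r a)"
      unfolding r_def pcompose_pCons rhom.add[OF C.rhom_ev] rhom.mult[OF C.rhom_ev] C.ev_const ..
    then show ?case using pCons(2) by (simp only: C.ev_pCons[of p a] I.add I.mult evu iota_v)
  qed (simp add: r_def rhom.zero[OF C.rhom_ev])
  have val: "C'.val0 (r a) = C.val0 a" for a
  proof (induction a)
    case (pCons p a)
    have "C'.val0 [:- C.A, - 1:] = y"
      unfolding C'.val0_pCons rhom.zero[OF C'.rhom_val0] by (simp add: C.A_0) (simp add: y'_def)
    moreover have "C'.val0 (r (pCons p a)) = poly p 0 + C'.val0 [:- C.A, - 1:] * C'.val0 (r a)"
      unfolding r_def pcompose_pCons rhom.add[OF C'.rhom_val0] rhom.mult[OF C'.rhom_val0] C'.val0_const ..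
    ultimately show ?case using pCons(2) by (simp only: C.val0_pCons[of p a])
  qed (simp add: r_def rhom.zero[OF C.rhom_val0] rhom.zero[OF C'.rhom_val0])
  show ?thesis
  proof
    fix f assume "f \<in> iota ` LR P"
    then obtain a b where ab: "f = iota (C.ev a / C.ev b)" "C.val0 b \<noteq> 0"
      unfolding C(2) C.local_ring_eq by blast
    \<comment> \<open>\<open>C'.ev\<close> is the same function as \<open>C.ev\<close>, because
      neither \<open>u\<close> nor \<open>v\<close> involves the \<open>y\<close>-coordinate of the
      point.\<close>
    have "f = C'.ev (r a) / C'.ev (r b)"
      by (simp only: ab(1) rhom_divide[OF rhom_iota] ev)
    moreover have "C'.val0 (r b) \<noteq> 0" using ab(2) by (simp add: val)
    ultimately show "f \<in> LR (hyp_pt P)" unfolding P' C'.local_ring_eq by blast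
  qed
qed

lemma LR_iota:
  assumes P: "P \<in> CP"
  shows "iota ` LR P = LR (hyp_pt P)"
proof
  show "iota ` LR P \<subseteq> LR (hyp_pt P)" by (rule LR_iota_subset[OF P])
  show "LR (hyp_pt P) \<subseteq> iota ` LR P"
  proof
    fix f assume f: "f \<in> LR (hyp_pt P)"
    then have "iota f \<in> LR P" using LR_iota_subset[OF hyp_CP[OF P]] unfolding hyp_hyp by blast
    moreover have "f = iota (iota f)" using iota_iota LR_subset_FF[OF hyp_CP[OF P] f] by simp
    ultimately show "f \<in> iota ` LR P" by blast
  qed
qed

lemma ord_iota:
  assumes "P \<in> CP" "f \<in> FF" "f \<noteq> 0"
  shows "ord (hyp_pt P) (iota f) = ord P f"
  by (rule ord_transport[OF rhom_iota assms(1) hyp_CP[OF assms(1)] LR_iota[OF assms(1)] iota_image_FF assms(2,3)])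

subsection \<open>The Galois action\<close>

lemma galois_group_iff:
  "\<sigma> \<in> galois_group \<longleftrightarrow> rhom \<sigma> \<and> bij \<sigma> \<and> (\<forall>a. \<sigma> (to_ac a) = to_ac a)"
proof
  assume "\<sigma> \<in> galois_group"
  then have *: "bij \<sigma>" "\<forall>a b. \<sigma> (a + b) = \<sigma> a + \<sigma> b" "\<forall>a b. \<sigma> (a * b) = \<sigma> a * \<sigma> b" "\<forall>a. \<sigma> (to_ac a) = to_ac a"
    unfolding galois_group_def by blast+
  moreover have "\<sigma> 1 = 1" using *(4)[rule_format, of 1] by simp
  ultimately show "rhom \<sigma> \<and> bij \<sigma> \<and> (\<forall>a. \<sigma> (to_ac a) = to_ac a)"
    unfolding rhom_def by blast
qed (auto simp: galois_group_def rhom_def)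

lemma galois_inv: "\<sigma> \<in> galois_group \<Longrightarrow> inv_into UNIV \<sigma> \<in> galois_group"
  unfolding galois_group_iff by (metis bij_imp_bij_inv bij_inv_eq_iff rhom_inv)

text \<open>First act on the coefficients of \<open>K(x)\<close>, then extend to the closure. Since
  \<open>H1\<close> and \<open>H0\<close> have coefficients in \<open>k\<close>, the minimal
  polynomial of \<open>y\<close> is unchanged, so \<open>y\<close> may be kept fixed.\<close>

lemma galois_lift:
  assumes "\<sigma> \<in> galois_group"
  shows "\<exists>\<tau>. rhom \<tau> \<and> bij \<tau> \<and> (\<forall>c. \<tau> (fun_const c) = fun_const (\<sigma> c)) \<and> \<tau> fx = fx \<and> \<tau> fy = fy"
proof -
  have \<sigma>: "rhom \<sigma>" "bij \<sigma>" "\<And>a. \<sigma> (to_ac a) = to_ac a" using assms by (auto simp: galois_group_iff)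
  interpret \<sigma>: rhom \<sigma> by fact
  obtain \<psi> where \<psi>: "rhom \<psi>" "bij \<psi>" "\<And>p. \<psi> (to_fract p) = to_fract (map_poly \<sigma> p)"
    using fract_automorphism[OF \<sigma>(1,2)] by blast
  have c: "\<psi> (to_fract [:c:]) = to_fract [:\<sigma> c:]" for c by (simp add: \<psi>(3) map_poly_pCons)
  have x: "\<psi> (to_fract [:0, 1:]) = to_fract [:0, 1:]" by (simp add: \<psi>(3) map_poly_pCons)
  have "\<psi> e1 = e1" "\<psi> e0 = e0"
    unfolding e1_def e0_def hom_eval2[OF rhom_e \<psi>(1)] by (simp_all only: c x \<sigma>(3) rhom.one[OF \<psi>(1)])
  then have q: "map_poly \<psi> qpoly = qpoly"
    by (simp add: qpoly_def map_poly_pCons rhom.minus[OF \<psi>(1)] rhom.zero[OF \<psi>(1)] rhom.one[OF \<psi>(1)])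
  have "poly (map_poly to_ac qpoly) fy = 0" by (simp add: qpoly_roots)
  then obtain \<tau> where "rhom \<tau>" "bij \<tau>" "\<And>c. \<tau> (to_ac c) = to_ac (\<psi> c)" "\<tau> fy = fy"
    using alg_closure_automorphism_extension[OF \<psi>(1,2) irreducible_qpoly, of fy fy] unfolding q by blast
  then show ?thesis by (intro exI[of _ \<tau>]) (simp add: fun_const_def fun_x_def c x)
qed

lemma galois_wproj:
  assumes "rhom \<sigma>" "bij \<sigma>"
  shows "galois_point \<sigma> (wproj g (x, y, z)) = wproj g (\<sigma> x, \<sigma> y, \<sigma> z)"
proof -
  interpret rhom \<sigma> by fact
  have nz: "\<sigma> c = 0 \<longleftrightarrow> c = 0" for c by (rule rhom_eq_0_iff[OF assms(1)])
  show ?thesis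
  proof (intro equalityI subsetI)
    fix p assume "p \<in> galois_point \<sigma> (wproj g (x, y, z))"
    then obtain c where "c \<noteq> 0" "p = (\<sigma> (c * x), \<sigma> (c ^ (g + 1) * y), \<sigma> (c * z))"
      unfolding galois_point_def wproj.simps by auto
    then have "\<sigma> c \<noteq> 0" "p = (\<sigma> c * \<sigma> x, \<sigma> c ^ (g + 1) * \<sigma> y, \<sigma> c * \<sigma> z)"
      by (simp_all only: nz mult power simp_thms)
    then show "p \<in> wproj g (\<sigma> x, \<sigma> y, \<sigma> z)" unfolding wproj.simps by blast
  next
    fix p assume "p \<in> wproj g (\<sigma> x, \<sigma> y, \<sigma> z)"
    then obtain d where d: "d \<noteq> 0" "p = (d * \<sigma> x, d ^ (g + 1) * \<sigma> y, d * \<sigma> z)"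
      unfolding wproj.simps by blast
    obtain c where "d = \<sigma> c" using assms(2) by (metis bij_pointE)
    then have "c \<noteq> 0" "p = map_prod \<sigma> (map_prod \<sigma> \<sigma>) (c * x, c ^ (g + 1) * y, c * z)"
      using d by (auto simp add: mult power)
    then show "p \<in> galois_point \<sigma> (wproj g (x, y, z))"
      unfolding galois_point_def wproj.simps by blast
  qed
qed

lemma galois_h:
  assumes "\<sigma> \<in> galois_group"
  shows "h1 (\<sigma> x) (\<sigma> z) = \<sigma> (h1 x z)" "h0 (\<sigma> x) (\<sigma> z) = \<sigma> (h0 x z)"
proof -
  have \<sigma>: "rhom \<sigma>" "\<And>a. \<sigma> (to_ac a) = to_ac a" using assms by (auto simp: galois_group_iff)
  show "h1 (\<sigma> x) (\<sigma> z) = \<sigma> (h1 x z)" "h0 (\<sigma> x) (\<sigma> z) = \<sigma> (h0 x z)"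
    unfolding h1_def h0_def hom_eval2[OF rhom_to_ac \<sigma>(1)] \<sigma>(2) by simp_all
qed

lemma galois_on_curve:
  assumes "\<sigma> \<in> galois_group" "on_curve (x, y, z)"
  shows "on_curve (\<sigma> x, \<sigma> y, \<sigma> z)"
proof -
  have \<sigma>: "rhom \<sigma>" using assms by (auto simp: galois_group_iff)
  have "\<sigma> (y\<^sup>2 + h1 x z * y) = \<sigma> (h0 x z)" using assms(2) by (simp add: on_curve_def)
  then show ?thesis
    using assms(2) rhom_eq_0_iff[OF \<sigma>]
    by (simp add: on_curve_def galois_h[OF assms(1)] rhom.add[OF \<sigma>] rhom.mult[OF \<sigma>] rhom.power[OF \<sigma>])
qed

lemma galois_CP:
  assumes "\<sigma> \<in> galois_group" "P \<in> CP"
  shows "galois_point \<sigma> P \<in> CP"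
proof -
  obtain x y z where P: "P = wproj g (x, y, z)" "on_curve (x, y, z)"
    using assms(2) unfolding curve_points_eq by auto
  have "galois_point \<sigma> P = wproj g (\<sigma> x, \<sigma> y, \<sigma> z)"
    unfolding P using assms(1) by (intro galois_wproj) (auto simp: galois_group_iff)
  then show ?thesis unfolding curve_points_eq using galois_on_curve[OF assms(1) P(2)] by blast
qed

lemma galois_point_inv:
  assumes "\<sigma> \<in> galois_group"
  shows "galois_point (inv_into UNIV \<sigma>) (galois_point \<sigma> P) = P"
    "galois_point \<sigma> (galois_point (inv_into UNIV \<sigma>) P) = P"
proof -
  have b: "bij \<sigma>" using assms by (auto simp: galois_group_iff)
  have 1: "inv_into UNIV \<sigma> (\<sigma> a) = a" "\<sigma> (inv_into UNIV \<sigma> a) = a" for a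
    using b by (simp_all add: bij_is_inj bij_is_surj surj_f_inv_f)
  show "galois_point (inv_into UNIV \<sigma>) (galois_point \<sigma> P) = P"
    "galois_point \<sigma> (galois_point (inv_into UNIV \<sigma>) P) = P"
    by (simp_all add: galois_point_def image_image map_prod_def 1 case_prod_beta)
qed

text \<open>Apply \<open>\<sigma>\<close> to the coefficients of the forms. This is done with the
  definition by forms rather than in charts, since here the coordinates of the point move. The
  inverse automorphism gives the opposite inclusions in \<open>galois_ord\<close>.\<close>

lemma LR_galois_subset:
  assumes \<sigma>: "\<sigma> \<in> galois_group" and \<tau>: "rhom \<tau>" "\<And>c. \<tau> (fun_const c) = fun_const (\<sigma> c)" "\<tau> fx = fx" "\<tau> fy = fy"
  shows "\<tau> ` LR P \<subseteq> LR (galois_point \<sigma> P)" and "\<tau> ` FF \<subseteq> FF"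
proof -
  have s: "rhom \<sigma>" using \<sigma> by (auto simp: galois_group_iff)
  have s0: "\<sigma> c = 0 \<longleftrightarrow> c = 0" for c by (rule rhom_eq_0_iff[OF s])
  define r where "r F = map_poly (map_poly (map_poly \<sigma>)) F" for F
  have wf: "weighted_form g d (r F)" if "weighted_form g d F" for d F
    using that s0 by (simp add: weighted_form_def r_def coeff_map_poly)
  have gv: "generic_value H1 H0 (r F) = \<tau> (generic_value H1 H0 F)" for F
    unfolding generic_value_def r_def eval3_map[OF rhom_fun_const s] hom_eval3[OF rhom_fun_const \<tau>(1)] \<tau>
      rhom.one[OF \<tau>(1)] ..
  have "eval3 id (r F) (\<sigma> x, \<sigma> y, \<sigma> z) = \<sigma> (eval3 id F (x, y, z))" for F x y z
    unfolding r_def eval3_map[OF rhom_id(2) s] hom_eval3[OF rhom_id(2) s] by simp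
  then have ev: "eval3 id (r F) (map_prod \<sigma> (map_prod \<sigma> \<sigma>) p) = \<sigma> (eval3 id F p)" for F p
    by (cases p) (simp del: eval3.simps)
  show "\<tau> ` LR P \<subseteq> LR (galois_point \<sigma> P)"
  proof
    fix f assume "f \<in> \<tau> ` LR P"
    then obtain F G d where FG: "f = \<tau> (generic_value H1 H0 F / generic_value H1 H0 G)"
      "weighted_form g d F" "weighted_form g d G" "\<forall>p\<in>P. eval3 id G p \<noteq> 0"
      unfolding local_ring_def by blast
    have "f = generic_value H1 H0 (r F) / generic_value H1 H0 (r G)"
      by (simp add: FG(1) gv rhom_divide[OF \<tau>(1)])
    moreover have "\<forall>p\<in>galois_point \<sigma> P. eval3 id (r G) p \<noteq> 0"
      using FG(4) by (auto simp: galois_point_def ev s0 simp del: eval3.simps map_prod_def map_prod_simp)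
    ultimately show "f \<in> LR (galois_point \<sigma> P)"
      unfolding local_ring_def using wf FG(2,3) by blast
  qed
  show "\<tau> ` FF \<subseteq> FF"
  proof
    fix f assume "f \<in> \<tau> ` FF"
    then obtain F G d where FG: "f = \<tau> (generic_value H1 H0 F / generic_value H1 H0 G)"
      "weighted_form g d F" "weighted_form g d G" "generic_value H1 H0 G \<noteq> 0"
      unfolding function_field_def by blast
    have "f = generic_value H1 H0 (r F) / generic_value H1 H0 (r G)"
      by (simp add: FG(1) gv rhom_divide[OF \<tau>(1)])
    moreover have "generic_value H1 H0 (r G) \<noteq> 0" using FG(4) by (simp add: gv rhom_eq_0_iff[OF \<tau>(1)])
    ultimately show "f \<in> FF"
      unfolding function_field_def using wf FG(2,3) by blast
  qed
qed

lemma galois_ord: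
  assumes \<sigma>: "\<sigma> \<in> galois_group"
  shows "\<exists>\<tau>. rhom \<tau> \<and> \<tau> ` FF = FF \<and> (\<forall>P\<in>CP. \<forall>f\<in>FF. f \<noteq> 0 \<longrightarrow> ord (galois_point \<sigma> P) (\<tau> f) = ord P f)"
proof -
  obtain \<tau> where \<tau>: "rhom \<tau>" "bij \<tau>" "\<And>c. \<tau> (fun_const c) = fun_const (\<sigma> c)" "\<tau> fx = fx" "\<tau> fy = fy"
    using galois_lift[OF \<sigma>] by blast
  define \<sigma>' where "\<sigma>' = inv_into UNIV \<sigma>"
  define \<tau>' where "\<tau>' = inv_into UNIV \<tau>"
  have \<sigma>': "\<sigma>' \<in> galois_group" unfolding \<sigma>'_def by (rule galois_inv[OF \<sigma>])
  have inv: "\<tau>' (\<tau> f) = f" "\<tau> (\<tau>' f) = f" for f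
    using \<tau>(2) by (simp_all add: \<tau>'_def bij_is_inj bij_is_surj surj_f_inv_f)
  have inv\<sigma>: "\<sigma> (\<sigma>' c) = c" for c
    using \<sigma> by (auto simp: \<sigma>'_def galois_group_iff bij_is_surj surj_f_inv_f)
  have \<tau>': "rhom \<tau>'" "\<And>c. \<tau>' (fun_const c) = fun_const (\<sigma>' c)" "\<tau>' fx = fx" "\<tau>' fy = fy"
  proof -
    show "rhom \<tau>'" unfolding \<tau>'_def by (rule rhom_inv[OF \<tau>(1,2)])
    show "\<tau>' (fun_const c) = fun_const (\<sigma>' c)" for c
      using inv(1)[of "fun_const (\<sigma>' c)"] unfolding \<tau>(3) inv\<sigma> .
    show "\<tau>' fx = fx" "\<tau>' fy = fy" using inv(1)[of fx] inv(1)[of fy] \<tau> by simp_all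
  qed
  note sub = LR_galois_subset[OF \<sigma> \<tau>(1,3,4,5)] and sub' = LR_galois_subset[OF \<sigma>' \<tau>']
  have LR: "\<tau> ` LR P = LR (galois_point \<sigma> P)" for P
  proof
    show "LR (galois_point \<sigma> P) \<subseteq> \<tau> ` LR P"
    proof
      fix f assume "f \<in> LR (galois_point \<sigma> P)"
      then have "\<tau>' f \<in> LR P" using sub'(1)[of "galois_point \<sigma> P"] galois_point_inv(1)[OF \<sigma>] by (auto simp: \<sigma>'_def)
      then show "f \<in> \<tau> ` LR P" using inv(2)[of f] by (metis imageI)
    qed
  qed (rule sub)
  have FF: "\<tau> ` FF = FF"
  proof
    show "FF \<subseteq> \<tau> ` FF"
    proof
      fix f assume "f \<in> FF"
      then have "\<tau>' f \<in> FF" using sub'(2) by blast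
      then show "f \<in> \<tau> ` FF" using inv(2)[of f] by (metis imageI)
    qed
  qed (rule sub)
  show ?thesis
    using ord_transport[OF \<tau>(1) _ galois_CP[OF \<sigma>] LR FF] \<tau>(1) FF by blast
qed

end

section \<open>Divisors as finitely supported functions, and their degrees\<close>

abbreviation lk :: "('a \<Rightarrow>\<^sub>0 int) \<Rightarrow> 'a \<Rightarrow> int" where "lk \<equiv> Poly_Mapping.lookup"
abbreviation ks :: "('a \<Rightarrow>\<^sub>0 int) \<Rightarrow> 'a set" where "ks \<equiv> Poly_Mapping.keys"

lemma lookup_frag_extend:
  assumes "\<And>x. \<theta>' (\<theta> x) = x" "\<And>x. \<theta> (\<theta>' x) = x"
  shows "lk (frag_extend (frag_of \<circ> \<theta>) D) x = lk D (\<theta>' x)"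
  using subset_UNIV[of "ks D"]
proof (induction D rule: frag_induction)
  case (one y)
  have "x = \<theta> y \<longleftrightarrow> \<theta>' x = y" using assms by metis
  then show ?case by simp
qed (simp_all add: frag_extend_diff lookup_minus)

lemma div_degree_eq:
  assumes "finite A" "ks D \<subseteq> A"
  shows "div_degree D = (\<Sum>P\<in>A. lk D P)"
  unfolding div_degree_def
  by (rule sum.mono_neutral_left[OF assms]) (simp add: in_keys_iff)

lemma div_degree_0 [simp]: "div_degree 0 = 0"
  by (simp add: div_degree_def)

lemma div_degree_add: "div_degree (D + E) = div_degree D + div_degree E"
proof -
  have *: "finite (ks D \<union> ks E)" by simp
  show ?thesis
    using div_degree_eq[OF *, of D] div_degree_eq[OF *, of E] div_degree_eq[OF *, of "D + E"] keys_add[of D E]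
    by (simp add: lookup_add sum.distrib)
qed

lemma div_degree_minus: "div_degree (- D) = - div_degree D"
  using div_degree_add[of D "- D"] by simp

lemma div_degree_diff: "div_degree (D - E) = div_degree D - div_degree E"
  using div_degree_add[of D "- E"] div_degree_minus[of E] by simp

lemma div_degree_frag_of [simp]: "div_degree (frag_of P) = 1"
  by (simp add: div_degree_def)

lemma div_degree_sum: "div_degree (\<Sum>i\<in>A. f i) = (\<Sum>i\<in>A. div_degree (f i))"
  by (induction A rule: infinite_finite_induct) (simp_all add: div_degree_add)

lemma div_degree_frag_extend: "div_degree (frag_extend (frag_of \<circ> \<theta>) D) = div_degree D"
  using subset_UNIV[of "ks D"]
  by (induction D rule: frag_induction) (simp_all add: frag_extend_diff div_degree_diff)

lemma div_degree_cmul: "div_degree (frag_cmul k D) = k * div_degree D"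
  using div_degree_eq[of "ks D" "frag_cmul k D"] keys_cmul[of k D]
  by (simp add: div_degree_def sum_distrib_left)

lemma lookup_sum_frag: "lk (\<Sum>i\<in>A. f i) x = (\<Sum>i\<in>A. lk (f i) x)"
  by (induction A rule: infinite_finite_induct) (simp_all add: lookup_add)

context curve begin

abbreviation "Prin \<equiv> principal_divisors g H1 H0"

definition has_div :: "'k alg_closure fun_ext \<Rightarrow> ('k alg_closure wpoint \<Rightarrow>\<^sub>0 int) \<Rightarrow> bool" where
  "has_div f D \<longleftrightarrow> ks D \<subseteq> CP \<and> (\<forall>P\<in>CP. lk D P = ord P f)"

lemma Prin_iff: "D \<in> Prin \<longleftrightarrow> (\<exists>f\<in>FF. f \<noteq> 0 \<and> has_div f D)"
  unfolding principal_divisors_def has_div_def by auto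

lemma has_div_mult:
  assumes "has_div f D" "has_div h E" "f \<in> FF" "f \<noteq> 0" "h \<in> FF" "h \<noteq> 0"
  shows "has_div (f * h) (D + E)"
  unfolding has_div_def
  using assms keys_add[of D E] by (auto simp: has_div_def lookup_add ord_mult)

lemma has_div_inverse:
  assumes "has_div f D" "f \<in> FF" "f \<noteq> 0"
  shows "has_div (inverse f) (- D)"
  using assms by (auto simp: has_div_def ord_inverse)

lemma has_div_divide:
  assumes "has_div f D" "has_div h E" "f \<in> FF" "f \<noteq> 0" "h \<in> FF" "h \<noteq> 0"
  shows "has_div (f / h) (D - E)"
  using has_div_mult[OF assms(1) has_div_inverse[OF assms(2,5,6)] assms(3,4)] assms FF_inverse
  by (simp add: divide_inverse)

lemma has_div_const: "c \<noteq> 0 \<Longrightarrow> has_div (fun_const c) 0"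
  by (simp add: has_div_def ord_const)

lemma has_div_unique: "has_div f D \<Longrightarrow> has_div f E \<Longrightarrow> D = E"
  unfolding has_div_def by (rule poly_mapping_eqI) (metis in_keys_iff subsetD)

lemma Prin_0: "0 \<in> Prin"
  unfolding Prin_iff using has_div_const[of 1] FF_const[of 1] by (metis fun_const_eq_0_iff one_neq_zero)

lemma Prin_diff:
  assumes "D \<in> Prin" "E \<in> Prin"
  shows "D - E \<in> Prin"
proof -
  obtain f h where *: "f \<in> FF" "f \<noteq> 0" "has_div f D" "h \<in> FF" "h \<noteq> 0" "has_div h E"
    using assms unfolding Prin_iff by blast
  then have "has_div (f / h) (D - E)" "f / h \<in> FF" "f / h \<noteq> 0" by (auto intro: has_div_divide FF_divide)
  then show ?thesis unfolding Prin_iff by blast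
qed

lemma Prin_minus: "D \<in> Prin \<Longrightarrow> - D \<in> Prin"
  using Prin_diff[OF Prin_0] by simp

lemma Prin_add: "D \<in> Prin \<Longrightarrow> E \<in> Prin \<Longrightarrow> D + E \<in> Prin"
  using Prin_diff[of D "- E"] Prin_minus by simp

lemma Prin_sum: "(\<And>i. i \<in> A \<Longrightarrow> f i \<in> Prin) \<Longrightarrow> (\<Sum>i\<in>A. f i) \<in> Prin"
  by (induction A rule: infinite_finite_induct) (auto intro: Prin_0 Prin_add)

lemma Prin_cmul: "D \<in> Prin \<Longrightarrow> frag_cmul k D \<in> Prin"
  by (rule frag_closure_minus_cmul[of "\<lambda>D. D \<in> Prin"]) (auto intro: Prin_0 Prin_diff)

subsection \<open>Fibres of the projection to the line\<close>

lemma wproj_self: "p \<in> wproj g p"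
proof (cases p)
  case (fields x y z)
  show ?thesis unfolding fields wproj.simps by (rule CollectI, rule exI[of _ 1]) simp
qed

lemma wproj_eqI:
  assumes "c \<noteq> 0"
  shows "wproj g (c * x, c ^ (g + 1) * y, c * z) = wproj g (x, y, z)"
proof (intro equalityI subsetI)
  fix p assume "p \<in> wproj g (c * x, c ^ (g + 1) * y, c * z)"
  then obtain d where "d \<noteq> 0" "p = (d * (c * x), d ^ (g + 1) * (c ^ (g + 1) * y), d * (c * z))"
    unfolding wproj.simps by blast
  then have "d * c \<noteq> 0" "p = (d * c * x, (d * c) ^ (g + 1) * y, d * c * z)"
    using assms by (simp_all only: power_mult_distrib mult.assoc) simp_all
  then show "p \<in> wproj g (x, y, z)" unfolding wproj.simps by blast
next
  fix p assume "p \<in> wproj g (x, y, z)"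
  then obtain d where d: "d \<noteq> 0" "p = (d * x, d ^ (g + 1) * y, d * z)"
    unfolding wproj.simps by blast
  have "d / c \<noteq> 0" "p = ((d / c) * (c * x), (d / c) ^ (g + 1) * (c ^ (g + 1) * y), (d / c) * (c * z))"
    using assms d by (simp_all add: power_divide)
  then show "p \<in> wproj g (c * x, c ^ (g + 1) * y, c * z)" unfolding wproj.simps by blast
qed

lemma wproj_eq_iff:
  "wproj g (x, y, z) = wproj g (x', y', z') \<longleftrightarrow>
     (\<exists>c. c \<noteq> 0 \<and> x' = c * x \<and> y' = c ^ (g + 1) * y \<and> z' = c * z)"
proof
  assume "wproj g (x, y, z) = wproj g (x', y', z')"
  then have "(x', y', z') \<in> wproj g (x, y, z)" using wproj_self by blast
  then show "\<exists>c. c \<noteq> 0 \<and> x' = c * x \<and> y' = c ^ (g + 1) * y \<and> z' = c * z"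
    unfolding wproj.simps by blast
next
  assume "\<exists>c. c \<noteq> 0 \<and> x' = c * x \<and> y' = c ^ (g + 1) * y \<and> z' = c * z"
  then show "wproj g (x, y, z) = wproj g (x', y', z')" using wproj_eqI by metis
qed

lemma proportional:
  fixes x z x' z' :: "'b::field"
  assumes "(x, z) \<noteq> (0, 0)" "(x', z') \<noteq> (0, 0)" "z * x' = x * z'"
  obtains c where "c \<noteq> 0" "x' = c * x" "z' = c * z"
proof (cases "x = 0")
  case True
  then have "z \<noteq> 0" "x' = 0" using assms by auto
  then have "z' / z \<noteq> 0" "x' = z' / z * x" "z' = z' / z * z" using assms(2) True by auto
  then show ?thesis using that by blast
next
  case False
  have "x' \<noteq> 0"
  proof
    assume "x' = 0"
    then show False using assms False by simp
  qed
  then have "x' / x \<noteq> 0" "x' = x' / x * x" "z' = x' / x * z" using False assms(3) by (auto simp: field_simps)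
  then show ?thesis using that by blast
qed

text \<open>After rescaling to the same \<open>X\<close> and \<open>Z\<close>, both
  \<open>Y\<close>-coordinates are roots of one quadratic, whose roots are \<open>y\<close> and
  \<open>- y - h1 x z\<close>.\<close>

lemma same_fibre:
  assumes "on_curve (x, y, z)" "on_curve (x', y', z')" "z * x' = x * z'"
  shows "wproj g (x', y', z') = wproj g (x, y, z) \<or> wproj g (x', y', z') = wproj g (x, - y - h1 x z, z)"
proof -
  obtain c where c: "c \<noteq> 0" "x' = c * x" "z' = c * z"
    using proportional[of x z x' z'] assms by (auto simp: on_curve_def)
  define w where "w = y' / c ^ (g + 1)"
  have y': "y' = c ^ (g + 1) * w" using c by (simp add: w_def)
  have pow: "c ^ (2 * g + 2) = c ^ (g + 1) * c ^ (g + 1)"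
    by (simp add: power_add[symmetric] mult_2)
  have "c ^ (2 * g + 2) * (w\<^sup>2 + h1 x z * w) = y'\<^sup>2 + h1 x' z' * y'"
    unfolding y' c h_scale pow power2_eq_square by (simp only: algebra_simps)
  also have "\<dots> = c ^ (2 * g + 2) * h0 x z"
    using assms(2) unfolding on_curve_def prod.case c h_scale by blast
  finally have "w\<^sup>2 + h1 x z * w = y\<^sup>2 + h1 x z * y"
    using c assms(1) by (simp add: on_curve_def)
  then have "(w - y) * (w - (- y - h1 x z)) = 0"
    by (simp add: power2_eq_square algebra_simps)
  then have "w = y \<or> w = - y - h1 x z" by simp
  then show ?thesis
    unfolding y' c(2,3) wproj_eqI[OF c(1)] by blast
qed

text \<open>Equality of \<open>X\<close> and \<open>Z\<close> forces the scaling factor to be 1, and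
  then \<open>h1 x z = - 2 y = 0\<close>. Hence in characteristic 2 the ramification is read off
  from \<open>H1\<close> alone.\<close>

lemma hyp_fixed_iff:
  assumes "(x, z) \<noteq> (0, 0)"
  shows "hyp_pt (wproj g (x, y, z)) = wproj g (x, y, z) \<longleftrightarrow> h1 x z = 0"
proof
  assume "hyp_pt (wproj g (x, y, z)) = wproj g (x, y, z)"
  then obtain c where "x = c * x" "z = c * z" "- y - h1 x z = c ^ (g + 1) * y"
    unfolding hyp_wproj using wproj_eq_iff by metis
  then have "c = 1" using assms by auto
  then have eq: "- y - h1 x z = y" using \<open>- y - h1 x z = c ^ (g + 1) * y\<close> by simp
  have "- h1 x z = y + (- y - h1 x z)" by simp
  also have "\<dots> = 0" unfolding eq by (rule add_self)
  finally show "h1 x z = 0" by simp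
next
  assume "h1 x z = 0"
  then show "hyp_pt (wproj g (x, y, z)) = wproj g (x, y, z)" by (simp add: hyp_wproj uminus_eq)
qed

text \<open>The pullback of a point of the line. At a ramification point the two summands coincide,
  which gives the multiplicity 2.\<close>

definition fib :: "'k alg_closure wpoint \<Rightarrow> 'k alg_closure wpoint \<Rightarrow>\<^sub>0 int" where
  "fib P = frag_of P + frag_of (hyp_pt P)"

lemma div_degree_fib: "div_degree (fib P) = 2"
  by (simp add: fib_def div_degree_add)

lemma keys_fib: "P \<in> CP \<Longrightarrow> ks (fib P) \<subseteq> CP"
  using keys_add[of "frag_of P" "frag_of (hyp_pt P)"] hyp_CP[of P] by (auto simp: fib_def)

lemma lookup_fib:
  assumes "on_curve (x, y, z)" "on_curve (x', y', z')"
  shows "lk (fib (wproj g (x, y, z))) (wproj g (x', y', z')) = (if z * x' = x * z' then ram_index x' z' else 0)"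
proof (cases "z * x' = x * z'")
  case True
  obtain c where c: "c \<noteq> 0" "x' = c * x" "z' = c * z"
    using proportional[of x z x' z'] assms True by (auto simp: on_curve_def)
  have h: "h1 x' z' = 0 \<longleftrightarrow> h1 x z = 0" using c h_scale(1)[of c x z] by simp
  have xz: "(x, z) \<noteq> (0, 0)" using assms(1) by (simp add: on_curve_def)
  define P where "P = wproj g (x, y, z)"
  define Q where "Q = wproj g (x', y', z')"
  have PQ: "Q = P \<or> Q = hyp_pt P" using same_fibre[OF assms True] by (simp add: P_def Q_def hyp_wproj)
  have ram: "hyp_pt P = P \<longleftrightarrow> h1 x z = 0" unfolding P_def by (rule hyp_fixed_iff[OF xz])
  have "lk (fib P) Q = (if Q = P then 1 else 0) + (if Q = hyp_pt P then 1 else 0)"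
    by (simp add: fib_def lookup_add)
  also have "\<dots> = ram_index x' z'"
  proof (cases "h1 x z = 0")
    case True
    then show ?thesis using PQ ram h by (simp add: ram_index_def)
  next
    case False
    then show ?thesis using PQ ram h by (auto simp: ram_index_def)
  qed
  finally show ?thesis using True by (simp add: P_def Q_def)
next
  case False
  have "wproj g (x', y', z') \<noteq> wproj g (x, y, z)" "wproj g (x', y', z') \<noteq> wproj g (x, - y - h1 x z, z)"
    using False by (auto simp: wproj_eq_iff algebra_simps)
  then show ?thesis using False by (simp add: fib_def lookup_add hyp_wproj)
qed

lemma fib_diff_has_div:
  assumes "on_curve (x, y, z)" "on_curve (x', y', z')"
  shows "has_div (linf x z / linf x' z') (fib (wproj g (x, y, z)) - fib (wproj g (x', y', z')))"
  unfolding has_div_def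
proof (intro conjI ballI)
  have CP: "wproj g (x, y, z) \<in> CP" "wproj g (x', y', z') \<in> CP" using assms unfolding curve_points_eq by blast+
  show "ks (fib (wproj g (x, y, z)) - fib (wproj g (x', y', z'))) \<subseteq> CP"
    using keys_diff[of "fib (wproj g (x, y, z))"] keys_fib CP by blast
  fix Q assume "Q \<in> CP"
  then obtain a b c where Q: "Q = wproj g (a, b, c)" "on_curve (a, b, c)" unfolding curve_points_eq by auto
  have "(x, z) \<noteq> (0, 0)" "(x', z') \<noteq> (0, 0)" using assms by (auto simp: on_curve_def)
  then show "lk (fib (wproj g (x, y, z)) - fib (wproj g (x', y', z'))) Q = ord Q (linf x z / linf x' z')"
    using lookup_fib[OF assms(1) Q(2)] lookup_fib[OF assms(2) Q(2)] ord_linf[OF Q(2)]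
    by (simp add: lookup_minus Q(1))
qed

lemma fib_diff_Prin:
  assumes "P \<in> CP" "Q \<in> CP"
  shows "fib P - fib Q \<in> Prin"
proof -
  obtain x y z x' y' z' where *: "P = wproj g (x, y, z)" "on_curve (x, y, z)"
    "Q = wproj g (x', y', z')" "on_curve (x', y', z')"
    using assms unfolding curve_points_eq by auto
  have "linf x z \<noteq> 0" "linf x' z' \<noteq> 0" using * by (auto simp: on_curve_def intro!: linf_nz)
  then have "linf x z / linf x' z' \<noteq> 0" "linf x z / linf x' z' \<in> FF" by (auto intro: FF_divide linf_FF)
  then show ?thesis unfolding Prin_iff using fib_diff_has_div[OF *(2,4)] *(1,3) by blast
qed

subsection \<open>Divisors of functions\<close>

lemma rational_has_div:
  assumes "f \<in> rational_functions" "f \<noteq> 0"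
  shows "\<exists>D. has_div f D \<and> div_degree D = 0"
proof -
  have FF: "to_ac (to_fract p) \<in> FF" for p by (rule FF_rational) blast
  have poly: "\<exists>D. has_div (to_ac (to_fract p)) D \<and> div_degree D = 0" if "p \<noteq> 0" for p
    using that
  proof (induction "degree p" arbitrary: p rule: less_induct)
    case less
    show ?case
    proof (cases "degree p = 0")
      case True
      then obtain c where "p = [:c:]" by (rule degree_eq_zeroE)
      then show ?thesis using less.prems has_div_const[of c] by (intro exI[of _ 0]) (auto simp: fun_const_def)
    next
      case False
      then obtain a where "poly p a = 0" using alg_closed_imp_poly_has_root by blast
      then obtain q where q: "p = [:- a, 1:] * q" by (auto simp: poly_eq_0_iff_dvd dvd_def)
      have "q \<noteq> 0" using less.prems q by auto
      have "degree q < degree p" unfolding q by (subst degree_mult_eq) (use \<open>q \<noteq> 0\<close> in auto)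
      then obtain D where D: "has_div (to_ac (to_fract q)) D" "div_degree D = 0"
        using less.hyps \<open>q \<noteq> 0\<close> by blast
      obtain y y' where y: "y\<^sup>2 + h1 a 1 * y = h0 a 1" "y'\<^sup>2 + h1 1 0 * y' = h0 1 0" using point_exists by metis
      then have pts: "on_curve (a, y, 1)" "on_curve (1, y', 0)" by (auto simp: on_curve_def)
      \<comment> \<open>\<open>linf 1 0\<close> is the form \<open>- Z\<close> with
        \<open>Z = 1\<close>, that is, the constant \<open>- 1\<close>. Written as a denominator it
        accounts for the pole of \<open>x - a\<close> over infinity.\<close>
      have "linf a 1 / linf 1 0 = - (linf a 1)"
        by (simp add: linf_def rhom.one[OF rhom_fun_const] rhom.zero[OF rhom_fun_const])
      also have "\<dots> = linf a 1" by (rule uminus_eq_fun)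
      also have "\<dots> = to_ac (to_fract [:- a, 1:])" unfolding linf_altdef linear_in_fun_x ..
      finally have lin: "linf a 1 / linf 1 0 = to_ac (to_fract [:- a, 1:])" .
      have "has_div (to_ac (to_fract [:- a, 1:]) * to_ac (to_fract q))
          (fib (wproj g (a, y, 1)) - fib (wproj g (1, y', 0)) + D)"
        using fib_diff_has_div[OF pts] D(1) \<open>q \<noteq> 0\<close> unfolding lin by (intro has_div_mult FF) auto
      then have "has_div (to_ac (to_fract p)) (fib (wproj g (a, y, 1)) - fib (wproj g (1, y', 0)) + D)"
        unfolding q to_fract_mult to_ac_mult .
      moreover have "div_degree (fib (wproj g (a, y, 1)) - fib (wproj g (1, y', 0)) + D) = 0"
        by (simp add: div_degree_add div_degree_diff div_degree_fib D(2))
      ultimately show ?thesis by blast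
    qed
  qed
  obtain w where "f = to_ac w" using assms by blast
  then obtain p q where pq: "q \<noteq> 0" "f = to_ac (to_fract p) / to_ac (to_fract q)"
    by (metis Fract_conv_to_fract Fract_cases to_ac_divide)
  then have "p \<noteq> 0" using assms by auto
  then obtain D E where *: "has_div (to_ac (to_fract p)) D" "div_degree D = 0"
    "has_div (to_ac (to_fract q)) E" "div_degree E = 0" using poly pq(1) by meson
  have "has_div f (D - E)" unfolding pq(2) using * pq(1) \<open>p \<noteq> 0\<close> by (intro has_div_divide FF) auto
  then show ?thesis using * by (intro exI[of _ "D - E"]) (simp add: div_degree_diff)
qed

lemma finite_ord_rational:
  assumes "f \<in> rational_functions" "f \<noteq> 0"
  shows "finite {P \<in> CP. ord P f \<noteq> 0}"
proof -
  obtain D where D: "has_div f D" using rational_has_div[OF assms] by blast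
  have "{P \<in> CP. ord P f \<noteq> 0} \<subseteq> ks D" using D by (auto simp: has_div_def in_keys_iff)
  then show ?thesis by (rule finite_subset) simp
qed

lemma fun_y_in_LR:
  assumes "on_curve (x, y, z)" "z \<noteq> 0"
  shows "fy \<in> LR (wproj g (x, y, z))"
proof -
  \<comment> \<open>With \<open>\<alpha> = 0\<close> the form \<open>M\<close> is a multiple of
    \<open>Z\<close>, so \<open>v\<close> is a constant multiple of \<open>y\<close>.\<close>
  interpret C: chart g H1 H0 x y z 0 "1 / z"
    using assms by unfold_locales simp_all
  interpret EV: rhom C.ev by (rule C.rhom_ev)
  interpret V0: rhom C.val0 by (rule C.rhom_val0)
  have "fy = C.mm ^ (g + 1) * C.v" using C.mm_nz by (simp add: C.v_def)
  also have "C.mm = fun_const (1 / z)" by (simp add: C.mm_def rhom.zero[OF rhom_fun_const])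
  also have "fun_const (1 / z) ^ (g + 1) * C.v = C.ev [:0, [:(1 / z) ^ (g + 1):]:] / C.ev 1"
    by (simp only: C.ev_linear C.evu_const rhom.power[OF rhom_fun_const] rhom.zero[OF C.rhom_evu] EV.one) simp
  finally have "fy = C.ev [:0, [:(1 / z) ^ (g + 1):]:] / C.ev 1" .
  moreover have "C.val0 1 \<noteq> 0" by (simp add: V0.one)
  ultimately show ?thesis unfolding C.local_ring_eq by blast
qed

lemma finite_fibre: "finite {P \<in> CP. \<exists>x y. P = wproj g (x, y, 0)}"
proof -
  obtain y where "y\<^sup>2 + h1 1 0 * y = h0 1 0" using point_exists by metis
  then have pt: "on_curve (1, y, 0)" by (simp add: on_curve_def)
  have "{P \<in> CP. \<exists>x y. P = wproj g (x, y, 0)} \<subseteq> {wproj g (1, y, 0), wproj g (1, - y - h1 1 0, 0)}"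
  proof
    fix P assume "P \<in> {P \<in> CP. \<exists>x y. P = wproj g (x, y, 0)}"
    then obtain x w a b c where *: "P = wproj g (x, w, 0)" "P = wproj g (a, b, c)" "on_curve (a, b, c)"
      unfolding curve_points_eq by auto
    then have "c = 0" unfolding wproj_eq_iff by (metis mult_zero_right wproj_eq_iff)
    then show "P \<in> {wproj g (1, y, 0), wproj g (1, - y - h1 1 0, 0)}"
      using same_fibre[OF pt *(3)] *(2) by simp
  qed
  then show ?thesis by (rule finite_subset) simp
qed

lemma LR_mult: "P \<in> CP \<Longrightarrow> f \<in> LR P \<Longrightarrow> h \<in> LR P \<Longrightarrow> f * h \<in> LR P"
  using dvr_at dvr_set.R_mult by metis

lemma LR_minus: "P \<in> CP \<Longrightarrow> f \<in> LR P \<Longrightarrow> - f \<in> LR P"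
  by (simp add: uminus_eq_fun)

lemma norm_rational:
  assumes "f \<in> FF"
  shows "f * iota f \<in> rational_functions"
proof (rule iota_fixed)
  show "f * iota f \<in> FF" using assms by (intro FF_mult iota_FF)
  show "iota (f * iota f) = f * iota f"
    by (simp add: rhom.mult[OF rhom_iota] iota_iota[OF assms] mult.commute)
qed

lemma iota_nz: "f \<noteq> 0 \<Longrightarrow> iota f \<noteq> 0"
  using rhom_eq_0_iff[OF rhom_iota] by blast

text \<open>Away from the poles of the coefficients and of the norm, a function \<open>a + b y\<close> and its
  conjugate are both regular and have orders adding up to zero.\<close>

lemma finite_ord:
  assumes f: "f \<in> FF" "f \<noteq> 0"
  shows "finite {P \<in> CP. ord P f \<noteq> 0}"
proof -
  obtain a b where ab: "f = a + b * fy" "a \<in> rational_functions" "b \<in> rational_functions"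
    using f unfolding FF_eq qext_def by blast
  define bad where "bad h = (if h = 0 then {} else {P \<in> CP. ord P h \<noteq> 0})" for h
  define N where "N = f * iota f"
  have N: "N \<in> rational_functions" "N \<noteq> 0" using norm_rational[OF f(1)] f(2) iota_nz[OF f(2)] by (auto simp: N_def)
  define S where "S = bad a \<union> bad b \<union> bad gen_h1 \<union> bad N \<union> {P \<in> CP. \<exists>x y. P = wproj g (x, y, 0)}"
  have "finite (bad h)" if "h \<in> rational_functions" for h
    using finite_ord_rational[OF that] by (simp add: bad_def)
  then have "finite S" unfolding S_def using ab gen_h_rational N finite_fibre by simp
  moreover have "{P \<in> CP. ord P f \<noteq> 0} \<subseteq> S"
  proof (rule ccontr)
    assume "\<not> {P \<in> CP. ord P f \<noteq> 0} \<subseteq> S"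
    then obtain P where P: "P \<in> CP" "ord P f \<noteq> 0" "P \<notin> S" by blast
    obtain x y z where xyz: "P = wproj g (x, y, z)" "on_curve (x, y, z)"
      using P(1) unfolding curve_points_eq by auto
    have "z \<noteq> 0" using P xyz by (auto simp: S_def)
    then have y: "fy \<in> LR P" using fun_y_in_LR xyz by blast
    have reg: "h \<in> LR P" if h: "h \<in> rational_functions" "P \<notin> bad h" for h
    proof (cases "h = 0")
      case True
      then show ?thesis using const_in_LR[OF P(1), of 0] by (simp add: rhom.zero[OF rhom_fun_const])
    next
      case False
      then show ?thesis using h P(1) ord_nonneg_iff[OF P(1) FF_rational[OF h(1)]] by (auto simp: bad_def)
    qed
    have ab': "a \<in> LR P" "b \<in> LR P" "gen_h1 \<in> LR P" using P(3) ab gen_h_rational by (auto simp: S_def intro!: reg)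
    have "f \<in> LR P" unfolding ab by (intro LR_add[OF P(1)] LR_mult[OF P(1)] ab' y)
    then have 1: "ord P f \<ge> 0" using ord_nonneg_iff[OF P(1) f] by simp
    have "iota f = a + b * (- fy + - gen_h1)"
      by (simp add: ab rhom.add[OF rhom_iota] rhom.mult[OF rhom_iota] iota_rational iota_fun_y)
    then have "iota f \<in> LR P"
      by (simp only:) (intro LR_add[OF P(1)] LR_mult[OF P(1)] LR_minus[OF P(1)] ab' y)
    then have 2: "ord P (iota f) \<ge> 0" using ord_nonneg_iff[OF P(1) iota_FF[OF f(1)]] iota_nz[OF f(2)] by simp
    have "ord P N = ord P f + ord P (iota f)"
      unfolding N_def using f iota_FF iota_nz by (intro ord_mult[OF P(1)]) auto
    moreover have "ord P N = 0" using P N(2) by (auto simp: S_def bad_def)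
    ultimately show False using 1 2 P(2) by linarith
  qed
  ultimately show ?thesis by (rule finite_subset[rotated])
qed

definition dv :: "'k alg_closure fun_ext \<Rightarrow> 'k alg_closure wpoint \<Rightarrow>\<^sub>0 int" where
  "dv f = Abs_poly_mapping (\<lambda>P. if P \<in> CP then ord P f else 0)"

lemma has_div_dv:
  assumes "f \<in> FF" "f \<noteq> 0"
  shows "has_div f (dv f)"
proof -
  have "finite {P. (if P \<in> CP then ord P f else 0) \<noteq> 0}"
    using finite_ord[OF assms] by (rule rev_finite_subset) (auto split: if_splits)
  then have "lk (dv f) = (\<lambda>P. if P \<in> CP then ord P f else 0)"
    unfolding dv_def by (rule lookup_Abs_poly_mapping)
  then show ?thesis by (auto simp: has_div_def in_keys_iff split: if_splits)
qed

definition hD :: "('k alg_closure wpoint \<Rightarrow>\<^sub>0 int) \<Rightarrow> ('k alg_closure wpoint \<Rightarrow>\<^sub>0 int)" where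
  "hD = frag_extend (frag_of \<circ> hyp_pt)"

lemma lookup_hD: "lk (hD D) P = lk D (hyp_pt P)"
  unfolding hD_def by (rule lookup_frag_extend) (fact hyp_hyp)+

lemma keys_hD: "ks D \<subseteq> CP \<Longrightarrow> ks (hD D) \<subseteq> CP"
proof -
  assume D: "ks D \<subseteq> CP"
  show "ks (hD D) \<subseteq> CP"
  proof
    fix P assume "P \<in> ks (hD D)"
    then have "hyp_pt P \<in> ks D" by (simp add: in_keys_iff lookup_hD)
    then have "hyp_pt (hyp_pt P) \<in> CP" using D by (auto intro!: hyp_CP[of "hyp_pt P"])
    then show "P \<in> CP" by (simp add: hyp_hyp)
  qed
qed

lemma div_degree_hD: "div_degree (hD D) = div_degree D"
  unfolding hD_def by (rule div_degree_frag_extend)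

lemma has_div_iota:
  assumes "has_div f D" "f \<in> FF" "f \<noteq> 0"
  shows "has_div (iota f) (hD D)"
  unfolding has_div_def
proof (intro conjI ballI)
  show "ks (hD D) \<subseteq> CP" using assms keys_hD by (simp add: has_div_def)
  fix P assume P: "P \<in> CP"
  then have "ord (hyp_pt (hyp_pt P)) (iota f) = ord (hyp_pt P) f"
    using ord_iota[OF hyp_CP[OF P] assms(2,3)] by simp
  then show "lk (hD D) P = ord P (iota f)"
    using assms(1) hyp_CP[OF P] by (simp add: lookup_hD hyp_hyp has_div_def)
qed

text \<open>The norm of \<open>f\<close> is a function of \<open>x\<close>, whose divisor has degree
  0 by construction from fibres. It is the divisor of \<open>f\<close> plus its conjugate, so twice
  the degree is 0.\<close>

lemma degree_principal:
  assumes "D \<in> Prin"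
  shows "div_degree D = 0"
proof -
  obtain f where f: "f \<in> FF" "f \<noteq> 0" "has_div f D" using assms unfolding Prin_iff by blast
  have "has_div (f * iota f) (D + hD D)"
    using f iota_FF iota_nz by (intro has_div_mult has_div_iota) auto
  moreover obtain E where "has_div (f * iota f) E" "div_degree E = 0"
    using rational_has_div[OF norm_rational[OF f(1)]] f(2) iota_nz[OF f(2)] by auto
  ultimately have "div_degree (D + hD D) = 0" using has_div_unique by blast
  then show ?thesis by (simp add: div_degree_add div_degree_hD)
qed

text \<open>The constant is the value of \<open>f\<close> at \<open>P\<close>; subtracting it moves
  \<open>f\<close> into the maximal ideal, whose elements are multiples of a uniformizer.\<close>

lemma residue:
  assumes P: "P \<in> CP" and f: "f \<in> LR P"
  shows "\<exists>c. f - fun_const c = 0 \<or> ord P (f - fun_const c) > 0"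
proof -
  obtain x y z \<alpha> \<beta> where C: "chart g H1 H0 x y z \<alpha> \<beta>" "P = wproj g (x, y, z)"
    using point_chart[OF P] .
  interpret C: chart g H1 H0 x y z \<alpha> \<beta> by (rule C)
  interpret EV: rhom C.ev by (rule C.rhom_ev)
  interpret V0: rhom C.val0 by (rule C.rhom_val0)
  obtain a b where ab: "f = C.ev a / C.ev b" "C.val0 b \<noteq> 0" using f unfolding C(2) C.local_ring_eq by blast
  define c where "c = C.val0 a / C.val0 b"
  have nz: "C.ev b \<noteq> 0" using ab(2) C.ev_eq_0 by blast
  have "f - fun_const c = (C.ev a - fun_const c * C.ev b) / C.ev b"
    unfolding ab(1) using nz by (simp add: diff_divide_distrib)
  also have "\<dots> = C.ev (a - [:[:c:]:] * b) / C.ev b" unfolding EV.diff EV.mult by simp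
  finally have eq: "f - fun_const c = C.ev (a - [:[:c:]:] * b) / C.ev b" .
  have "C.val0 (a - [:[:c:]:] * b) = 0" unfolding V0.diff V0.mult using ab(2) by (simp add: c_def)
  then have M: "f - fun_const c \<in> max_ideal g H1 H0 P"
    unfolding C(2) C.max_ideal_eq eq using ab(2) by blast
  obtain t where t: "dvr_set (LR P) (max_ideal g H1 H0 P) t"
    "\<And>f. f \<in> FF \<Longrightarrow> f \<noteq> 0 \<Longrightarrow> dvr_set.has_ord (LR P) t f (ord P f)" using dvr_at[OF P] by blast
  interpret D: dvr_set "LR P" "max_ideal g H1 H0 P" t by (rule t(1))
  obtain r where r: "f - fun_const c = t * r" "r \<in> LR P" using M unfolding D.M by blast
  have tF: "t \<in> FF" "r \<in> FF" using LR_subset_FF[OF P] D.t r by auto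
  have "D.has_ord t 1" using D.has_ord_power[OF D.unit_1, of 1] by simp
  then have t1: "ord P t = 1" by (rule ord_eqI[OF P t(1)])
  show ?thesis
  proof (cases "r = 0")
    case True
    then show ?thesis using r by auto
  next
    case False
    then have "ord P (t * r) = 1 + ord P r" "ord P r \<ge> 0"
      using ord_mult[OF P tF(1) D.t(2) tF(2)] t1 ord_nonneg_iff[OF P tF(2)] r by auto
    then show ?thesis unfolding r(1)[symmetric] by (intro exI[of _ c] disjI2) linarith
  qed
qed

lemma CP_nonempty: "\<exists>P. P \<in> CP"
proof -
  obtain y where "y\<^sup>2 + h1 1 0 * y = h0 1 0" using point_exists by metis
  then have "on_curve (1, y, 0)" by (simp add: on_curve_def)
  then show ?thesis unfolding curve_points_eq by blast
qed

text \<open>Subtract the value at a point: the difference is still regular and has a zero, which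
  contradicts degree zero unless it vanishes.\<close>

lemma regular_imp_constant:
  assumes f: "f \<in> FF" "f \<noteq> 0" and reg: "\<And>P. P \<in> CP \<Longrightarrow> ord P f \<ge> 0"
  shows "\<exists>c. f = fun_const c"
proof -
  obtain P where P: "P \<in> CP" using CP_nonempty by blast
  have LR: "f \<in> LR Q" if "Q \<in> CP" for Q using ord_nonneg_iff[OF that f] reg[OF that] by simp
  obtain c where c: "f - fun_const c = 0 \<or> ord P (f - fun_const c) > 0" using residue[OF P LR[OF P]] by blast
  have "f - fun_const c = 0"
  proof (rule ccontr)
    assume nz: "f - fun_const c \<noteq> 0"
    let ?h = "f + fun_const (- c)"
    have eq: "f - fun_const c = ?h" by (simp add: rhom.minus[OF rhom_fun_const])
    have h: "?h \<in> FF" "?h \<noteq> 0" using f FF_add FF_const nz eq by metis+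
    have ord: "ord Q ?h \<ge> 0" if "Q \<in> CP" for Q
      using ord_nonneg_iff[OF that h] LR_add[OF that LR[OF that] const_in_LR[OF that]] by blast
    have nonneg: "lk (dv ?h) Q \<ge> 0" for Q
    proof (cases "Q \<in> CP")
      case True
      then show ?thesis using ord[OF True] has_div_dv[OF h] by (simp add: has_div_def)
    next
      case False
      then have "Q \<notin> ks (dv ?h)" using has_div_dv[OF h] unfolding has_div_def by blast
      then show ?thesis by (simp add: in_keys_iff)
    qed
    have "ord P ?h > 0" using c nz eq by simp
    then have pos: "lk (dv ?h) P > 0" using has_div_dv[OF h] P by (simp add: has_div_def)
    then have "P \<in> ks (dv ?h)" by (simp add: in_keys_iff)
    then have "div_degree (dv ?h) > 0"
      unfolding div_degree_def using nonneg pos by (intro sum_pos2[of _ P]) auto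
    moreover have "dv ?h \<in> Prin" unfolding Prin_iff using has_div_dv[OF h] h by blast
    ultimately show False using degree_principal by fastforce
  qed
  then show ?thesis by auto
qed

lemma divisor_zero_imp_constant:
  assumes "f \<in> FF" "f \<noteq> 0" "has_div f 0"
  shows "\<exists>c. c \<noteq> 0 \<and> f = fun_const c"
  using regular_imp_constant[OF assms(1,2)] assms by (auto simp: has_div_def)

end

section \<open>The Jacobian as a group of divisor classes\<close>

lemma (in group) ord_eq_2_iff:
  assumes "a \<in> carrier G"
  shows "ord a = 2 \<longleftrightarrow> a \<noteq> \<one> \<and> a \<otimes> a = \<one>"
proof -
  have sq: "a \<otimes> a = a [^] (2::nat)" using assms by (simp add: numeral_2_eq_2)
  have id: "a [^] (2::nat) = \<one> \<longleftrightarrow> ord a dvd 2" by (rule pow_eq_id[OF assms])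
  have one: "ord a = 1 \<longleftrightarrow> a = \<one>" using ord_eq_1[OF assms] by blast
  have "ord a dvd 2 \<longleftrightarrow> ord a = 1 \<or> ord a = 2"
    using prime_nat_iff[of 2] two_is_prime_nat by auto
  then show ?thesis using sq id one by auto
qed

context curve begin

abbreviation "GD \<equiv> degree_zero_divisors g H1 H0"

lemma carrier_GD: "carrier GD = {D. ks D \<subseteq> CP \<and> div_degree D = 0}"
  and mult_GD: "D \<otimes>\<^bsub>GD\<^esub> E = D + E"
  and one_GD: "\<one>\<^bsub>GD\<^esub> = 0"
  by (simp_all add: degree_zero_divisors_def Let_def free_Abelian_group_def)

lemma keys_add_CP: "ks D \<subseteq> CP \<Longrightarrow> ks E \<subseteq> CP \<Longrightarrow> ks (D + E) \<subseteq> CP"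
  using keys_add[of D E] by blast

lemma keys_diff_CP: "ks D \<subseteq> CP \<Longrightarrow> ks E \<subseteq> CP \<Longrightarrow> ks (D - E) \<subseteq> CP"
  using keys_diff[of D E] by blast

lemma keys_Prin: "D \<in> Prin \<Longrightarrow> ks D \<subseteq> CP"
  unfolding Prin_iff has_div_def by blast

lemma comm_group_GD: "comm_group GD"
proof (rule comm_groupI)
  fix D assume "D \<in> carrier GD"
  then show "\<exists>E\<in>carrier GD. E \<otimes>\<^bsub>GD\<^esub> D = \<one>\<^bsub>GD\<^esub>"
    by (intro bexI[of _ "- D"]) (auto simp: carrier_GD mult_GD one_GD div_degree_minus)
next
  fix D E assume "D \<in> carrier GD" "E \<in> carrier GD"
  then show "D \<otimes>\<^bsub>GD\<^esub> E \<in> carrier GD"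
    using keys_add_CP by (auto simp: carrier_GD mult_GD div_degree_add)
qed (simp_all add: carrier_GD mult_GD one_GD add.assoc add.commute)

interpretation GD: comm_group GD by (rule comm_group_GD)

lemma inv_GD: "D \<in> carrier GD \<Longrightarrow> inv\<^bsub>GD\<^esub> D = - D"
  by (rule GD.inv_equality) (auto simp: carrier_GD mult_GD one_GD div_degree_minus)

lemma subgroup_Prin: "subgroup Prin GD"
proof (rule GD.subgroupI)
  show "Prin \<subseteq> carrier GD" using keys_Prin degree_principal by (auto simp: carrier_GD)
  then show "inv\<^bsub>GD\<^esub> D \<in> Prin" if "D \<in> Prin" for D using that Prin_minus inv_GD by auto
  show "Prin \<noteq> {}" using Prin_0 by blast
  show "D \<otimes>\<^bsub>GD\<^esub> E \<in> Prin" if "D \<in> Prin" "E \<in> Prin" for D E using that by (simp add: mult_GD Prin_add)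
qed

lemma normal_Prin: "Prin \<lhd> GD"
  by (rule GD.subgroup_imp_normal[OF subgroup_Prin])

abbreviation "Jac \<equiv> jacobian g H1 H0"

lemma group_Jac: "group Jac"
  unfolding jacobian_def by (rule normal.factorgroup_is_group[OF normal_Prin])

interpretation Jac: group Jac by (rule group_Jac)

definition cl :: "('k alg_closure wpoint \<Rightarrow>\<^sub>0 int) \<Rightarrow> ('k alg_closure wpoint \<Rightarrow>\<^sub>0 int) set" where
  "cl D = (\<lambda>E. E + D) ` Prin"

lemma coset_eq_cl: "Prin #>\<^bsub>GD\<^esub> D = cl D"
  by (auto simp: r_coset_def cl_def mult_GD)

lemma carrier_Jac: "carrier Jac = cl ` carrier GD"
  by (auto simp: jacobian_def FactGroup_def RCOSETS_def coset_eq_cl)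

lemma one_Jac: "\<one>\<^bsub>Jac\<^esub> = cl 0"
  by (simp add: jacobian_def FactGroup_def cl_def)

lemma mult_Jac: "D \<in> carrier GD \<Longrightarrow> E \<in> carrier GD \<Longrightarrow> cl D \<otimes>\<^bsub>Jac\<^esub> cl E = cl (D + E)"
  using normal.rcos_sum[OF normal_Prin, of D E]
  by (simp add: jacobian_def FactGroup_def coset_eq_cl mult_GD)

lemma cl_eq_iff: "cl D = cl E \<longleftrightarrow> D - E \<in> Prin"
proof
  assume "cl D = cl E"
  moreover have "D \<in> cl D" unfolding cl_def by (rule image_eqI[OF _ Prin_0]) simp
  ultimately obtain F where "F \<in> Prin" "D = F + E" unfolding cl_def by auto
  then show "D - E \<in> Prin" by simp
next
  assume DE: "D - E \<in> Prin"
  show "cl D = cl E"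
  proof (intro equalityI subsetI)
    fix F assume "F \<in> cl D"
    then obtain H where "H \<in> Prin" "F = H + D" unfolding cl_def by auto
    then show "F \<in> cl E" unfolding cl_def
      by (intro image_eqI[of _ _ "H + (D - E)"] Prin_add DE) simp
  next
    fix F assume "F \<in> cl E"
    then obtain H where "H \<in> Prin" "F = H + E" unfolding cl_def by auto
    then show "F \<in> cl D" unfolding cl_def
      by (intro image_eqI[of _ _ "H - (D - E)"] Prin_diff DE) simp
  qed
qed

lemma galois_divisor_add: "galois_divisor \<sigma> (D + E) = galois_divisor \<sigma> D + galois_divisor \<sigma> E"
  and galois_divisor_diff: "galois_divisor \<sigma> (D - E) = galois_divisor \<sigma> D - galois_divisor \<sigma> E"
  and galois_divisor_cmul: "galois_divisor \<sigma> (frag_cmul k D) = frag_cmul k (galois_divisor \<sigma> D)"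
  and galois_divisor_frag_of: "galois_divisor \<sigma> (frag_of P) = frag_of (galois_point \<sigma> P)"
  by (simp_all add: galois_divisor_def frag_extend_add frag_extend_diff frag_extend_cmul)

lemma lookup_galois_divisor:
  assumes "\<sigma> \<in> galois_group"
  shows "lk (galois_divisor \<sigma> D) P = lk D (galois_point (inv_into UNIV \<sigma>) P)"
  unfolding galois_divisor_def by (rule lookup_frag_extend) (fact galois_point_inv[OF assms])+

lemma keys_galois_divisor:
  assumes \<sigma>: "\<sigma> \<in> galois_group" and D: "ks D \<subseteq> CP"
  shows "ks (galois_divisor \<sigma> D) \<subseteq> CP"
proof
  fix P assume "P \<in> ks (galois_divisor \<sigma> D)"
  then have "galois_point (inv_into UNIV \<sigma>) P \<in> CP"
    using D by (auto simp: in_keys_iff lookup_galois_divisor[OF \<sigma>])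
  from galois_CP[OF \<sigma> this] show "P \<in> CP" by (simp add: galois_point_inv[OF \<sigma>])
qed

lemma galois_Prin:
  assumes \<sigma>: "\<sigma> \<in> galois_group" and D: "D \<in> Prin"
  shows "galois_divisor \<sigma> D \<in> Prin"
proof -
  obtain f where f: "f \<in> FF" "f \<noteq> 0" "has_div f D" using D unfolding Prin_iff by blast
  obtain \<tau> where \<tau>: "rhom \<tau>" "\<tau> ` FF = FF" "\<And>P f. P \<in> CP \<Longrightarrow> f \<in> FF \<Longrightarrow> f \<noteq> 0 \<Longrightarrow> ord (galois_point \<sigma> P) (\<tau> f) = ord P f"
    using galois_ord[OF \<sigma>] by blast
  have "has_div (\<tau> f) (galois_divisor \<sigma> D)"
    unfolding has_div_def
  proof (intro conjI ballI)
    show "ks (galois_divisor \<sigma> D) \<subseteq> CP" by (rule keys_galois_divisor[OF \<sigma> keys_Prin[OF D]])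
    fix P assume P: "P \<in> CP"
    let ?P' = "galois_point (inv_into UNIV \<sigma>) P"
    have P': "?P' \<in> CP" by (rule galois_CP[OF galois_inv[OF \<sigma>] P])
    have "ord (galois_point \<sigma> ?P') (\<tau> f) = ord ?P' f" by (rule \<tau>(3)[OF P' f(1,2)])
    also have "\<dots> = lk D ?P'" using f(3) P' by (simp add: has_div_def)
    finally show "lk (galois_divisor \<sigma> D) P = ord P (\<tau> f)"
      by (simp add: lookup_galois_divisor[OF \<sigma>] galois_point_inv[OF \<sigma>])
  qed
  moreover have "\<tau> f \<in> FF" "\<tau> f \<noteq> 0" using \<tau> f rhom_eq_0_iff[OF \<tau>(1)] by auto
  ultimately show ?thesis unfolding Prin_iff by blast
qed

lemma galois_cl:
  assumes \<sigma>: "\<sigma> \<in> galois_group"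
  shows "galois_divisor \<sigma> ` cl D = cl (galois_divisor \<sigma> D)"
proof -
  have "galois_divisor \<sigma> ` Prin = Prin"
  proof (intro equalityI subsetI)
    fix E assume E: "E \<in> Prin"
    define E' where "E' = galois_divisor (inv_into UNIV \<sigma>) E"
    have "E' \<in> Prin" unfolding E'_def by (rule galois_Prin[OF galois_inv[OF \<sigma>] E])
    moreover have "galois_divisor \<sigma> E' = E"
    proof (rule poly_mapping_eqI)
      fix P
      have "inv_into UNIV (inv_into UNIV \<sigma>) = \<sigma>" using \<sigma> by (auto simp: galois_group_iff inv_inv_eq)
      then show "lk (galois_divisor \<sigma> E') P = lk E P"
        unfolding E'_def lookup_galois_divisor[OF \<sigma>] lookup_galois_divisor[OF galois_inv[OF \<sigma>]]
        by (simp add: galois_point_inv[OF \<sigma>])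
    qed
    ultimately show "E \<in> galois_divisor \<sigma> ` Prin" by blast
  qed (use galois_Prin[OF \<sigma>] in blast)
  then show ?thesis unfolding cl_def by (force simp: image_iff galois_divisor_add)
qed

lemma rational_order_2_iff:
  "(\<exists>c\<in>jacobian_rational_points g H1 H0. group.ord Jac c = 2) \<longleftrightarrow>
   (\<exists>D. ks D \<subseteq> CP \<and> div_degree D = 0 \<and> D \<notin> Prin \<and> D + D \<in> Prin \<and>
        (\<forall>\<sigma>\<in>galois_group. galois_divisor \<sigma> D - D \<in> Prin))" (is "?L \<longleftrightarrow> (\<exists>D. ?R D)")
proof -
  have "?L \<longleftrightarrow> (\<exists>D\<in>carrier GD. Jac.ord (cl D) = 2 \<and> (\<forall>\<sigma>\<in>galois_group. galois_divisor \<sigma> ` cl D = cl D))"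
    unfolding jacobian_rational_points_def carrier_Jac by blast
  also have "\<dots> \<longleftrightarrow> (\<exists>D\<in>carrier GD. ?R D)"
  proof (rule bex_cong[OF refl])
    fix D assume D: "D \<in> carrier GD"
    then have "cl D \<in> carrier Jac" by (simp add: carrier_Jac)
    then have "Jac.ord (cl D) = 2 \<longleftrightarrow> D \<notin> Prin \<and> D + D \<in> Prin"
      by (simp add: Jac.ord_eq_2_iff mult_Jac[OF D D] one_Jac cl_eq_iff)
    then show "(Jac.ord (cl D) = 2 \<and> (\<forall>\<sigma>\<in>galois_group. galois_divisor \<sigma> ` cl D = cl D)) \<longleftrightarrow> ?R D"
      using D by (auto simp: carrier_GD galois_cl cl_eq_iff)
  qed
  also have "\<dots> \<longleftrightarrow> (\<exists>D. ?R D)" by (auto simp: carrier_GD)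
  finally show ?thesis .
qed

subsection \<open>Two-torsion and ramification points\<close>

definition Ram :: "'k alg_closure wpoint set" where
  "Ram = {P \<in> CP. hyp_pt P = P}"

definition dsum :: "'k alg_closure wpoint set \<Rightarrow> 'k alg_closure wpoint \<Rightarrow>\<^sub>0 int" where
  "dsum S = (\<Sum>P\<in>S. frag_of P)"

lemma lookup_dsum: "finite S \<Longrightarrow> lk (dsum S) P = (if P \<in> S then 1 else 0)"
  by (simp add: dsum_def lookup_sum_frag)

lemma keys_dsum: "finite S \<Longrightarrow> ks (dsum S) = S"
  by (rule Set.set_eqI) (simp add: in_keys_iff lookup_dsum)

lemma div_degree_dsum: "div_degree (dsum S) = int (card S)"
  by (simp add: dsum_def div_degree_sum)

lemma lookup_fib': "lk (fib P) Q = (if Q = P then 1 else 0) + (if Q = hyp_pt P then 1 else 0)"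
  by (simp add: fib_def lookup_add)

lemma hyp_eq_iff: "hyp_pt P = Q \<longleftrightarrow> P = hyp_pt Q"
  using hyp_hyp by metis

lemma even_fib_Ram:
  assumes "Q \<in> Ram"
  shows "even (lk (fib P) Q)"
proof -
  have "hyp_pt Q = Q" using assms by (simp add: Ram_def)
  then have "Q = hyp_pt P \<longleftrightarrow> Q = P" using hyp_eq_iff[of P Q] by auto
  then show ?thesis by (simp add: lookup_fib')
qed

lemma hD_add: "hD (D + E) = hD D + hD E" and hD_diff: "hD (D - E) = hD D - hD E"
  and hD_cmul: "hD (frag_cmul k D) = frag_cmul k (hD D)" and hD_frag_of: "hD (frag_of P) = frag_of (hyp_pt P)"
  by (simp_all add: hD_def frag_extend_add frag_extend_diff frag_extend_cmul)

lemma hD_fib: "hD (fib P) = fib P"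
  by (simp add: fib_def hD_add hD_frag_of hyp_hyp add.commute)

lemma hD_dsum:
  assumes "finite S" "S \<subseteq> Ram"
  shows "hD (dsum S) = dsum S"
proof (rule poly_mapping_eqI)
  fix P
  have "hyp_pt P \<in> S \<longleftrightarrow> P \<in> S"
    using assms(2) hyp_hyp[of P] by (metis (mono_tags, lifting) Ram_def mem_Collect_eq subsetD)
  then show "lk (hD (dsum S)) P = lk (dsum S) P" by (simp add: lookup_hD lookup_dsum assms(1))
qed

lemma iota_const: "iota (fun_const c) = fun_const c"
  by (rule iota_rational[OF fun_const_rational])

text \<open>If \<open>div f\<close> is invariant under the involution then \<open>f / \<iota>(f)\<close> is a constant of norm one,
  hence one in characteristic two. So \<open>f\<close> is a function of \<open>x\<close> alone, and its order at each
  ramification point is even.\<close>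

lemma ramification_points_independent:
  assumes S: "finite S" "S \<subseteq> Ram" and P0: "P0 \<in> CP"
    and Prin: "dsum S + frag_cmul m (fib P0) \<in> Prin"
  shows "S = {}"
proof (rule ccontr)
  assume "S \<noteq> {}"
  then obtain Q where Q: "Q \<in> S" by blast
  define D where "D = dsum S + frag_cmul m (fib P0)"
  have hD: "hD D = D" by (simp add: D_def hD_add hD_cmul hD_dsum[OF S] hD_fib)
  obtain f where f: "f \<in> FF" "f \<noteq> 0" "has_div f D" using Prin unfolding D_def[symmetric] Prin_iff by blast
  have if': "iota f \<in> FF" "iota f \<noteq> 0" "has_div (iota f) D"
    using iota_FF[OF f(1)] iota_nz[OF f(2)] has_div_iota[OF f(3,1,2)] hD by simp_all
  have "has_div (f / iota f) 0" using has_div_divide[OF f(3) if'(3) f(1,2) if'(1,2)] by simp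
  then obtain c where c: "f / iota f = fun_const c"
    using divisor_zero_imp_constant[of "f / iota f"] f if' FF_divide by auto
  then have f_eq: "f = fun_const c * iota f" using if' by (simp add: field_simps)
  have "iota f = iota (fun_const c * iota f)" by (rule arg_cong[OF f_eq])
  also have "\<dots> = fun_const c * f" by (simp only: rhom.mult[OF rhom_iota] iota_const iota_iota[OF f(1)])
  finally have "f = (fun_const c * fun_const c) * f" using f_eq by (simp only: mult.assoc)
  then have "fun_const c * fun_const c = fun_const 1" using f(2) by (simp add: rhom.one[OF rhom_fun_const])
  then have "c * c = 1" by (simp flip: rhom.mult[OF rhom_fun_const])
  then have "(c + 1) * (c + 1) = 0" using add_self[of c] add_self[of 1] by (simp add: algebra_simps)
  then have "c + 1 = 0" by simp
  then have "c = 1" by (simp add: add_eq_0_iff2 uminus_eq)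
  then have "iota f = f" using f_eq by (simp add: rhom.one[OF rhom_fun_const])
  then have rat: "f \<in> rational_functions" by (rule iota_fixed[OF f(1)])
  have QR: "Q \<in> Ram" using Q S by blast
  then obtain x y z where xyz: "Q = wproj g (x, y, z)" "on_curve (x, y, z)"
    unfolding Ram_def curve_points_eq by auto
  then have "h1 x z = 0" using QR hyp_fixed_iff[of x z y] by (auto simp: Ram_def on_curve_def)
  then have "even (ord Q f)" using even_ord_at_ramified[OF xyz(2) _ rat f(2)] xyz(1) by simp
  \<comment> \<open>Against this parity, \<open>Q\<close> occurs once in \<open>dsum S\<close> and
    an even number of times in any fibre.\<close>
  moreover have "ord Q f = 1 + m * lk (fib P0) Q"
  proof -
    have "Q \<in> CP" using QR by (simp add: Ram_def)
    then have "ord Q f = lk D Q" using f(3) by (simp add: has_div_def)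
    also have "\<dots> = 1 + m * lk (fib P0) Q" using Q S(1) by (simp add: D_def lookup_add lookup_dsum)
    finally show ?thesis .
  qed
  ultimately show False using even_fib_Ram[OF QR, of P0] by simp
qed

text \<open>Remove points from the support by subtracting fibres. Invariance gives \<open>P\<close>
  and its conjugate the same coefficient \<open>n\<close>; subtract \<open>n\<close> fibres if they
  differ, and \<open>n / 2\<close> if \<open>P\<close> is ramified, where \<open>n\<close> is even.
  All fibres are equivalent.\<close>

lemma invariant_even_divisor:
  assumes "hD E = E" "ks E \<subseteq> CP" "\<And>P. P \<in> Ram \<Longrightarrow> even (lk E P)" "P0 \<in> CP"
  shows "\<exists>m. E - frag_cmul m (fib P0) \<in> Prin"
  using assms(1-3)
proof (induction "card (ks E)" arbitrary: E rule: less_induct)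
  case less
  show ?case
  proof (cases "E = 0")
    case True
    then show ?thesis using Prin_0 by (intro exI[of _ 0]) simp
  next
    case False
    then obtain P where P: "P \<in> ks E" by (metis keys_eq_empty ex_in_conv)
    then have PC: "P \<in> CP" using less.prems by blast
    define n where "n = lk E P"
    have n': "lk E (hyp_pt P) = n"
      using arg_cong[OF less.prems(1), of "\<lambda>D. lk D P"] by (simp add: lookup_hD n_def)
    define k where "k = (if hyp_pt P = P then n div 2 else n)"
    define E' where "E' = E - frag_cmul k (fib P)"
    have kP: "lk E' Q = lk E Q - k * lk (fib P) Q" for Q by (simp add: E'_def lookup_minus)
    have zero: "lk E' P = 0"
    proof (cases "hyp_pt P = P")
      case True
      then have "even n" using less.prems(3)[of P] PC by (simp add: Ram_def n_def)
      then show ?thesis using True by (simp add: kP lookup_fib' k_def n_def)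
    next
      case False
      then show ?thesis by (simp add: kP lookup_fib' k_def n_def)
    qed
    have other: "lk E' Q = lk E Q" if "Q \<noteq> P" "Q \<noteq> hyp_pt P" for Q
      using that by (simp add: kP lookup_fib')
    have "ks E' \<subseteq> ks E - {P}"
    proof
      fix Q assume Q: "Q \<in> ks E'"
      then have "Q \<noteq> P" using zero by (auto simp: in_keys_iff)
      moreover have "Q \<in> ks E"
      proof (cases "Q = hyp_pt P")
        case True
        then show ?thesis using n' P by (simp add: in_keys_iff n_def)
      next
        case False
        then show ?thesis using Q other[of Q] \<open>Q \<noteq> P\<close> by (simp add: in_keys_iff)
      qed
      ultimately show "Q \<in> ks E - {P}" by blast
    qed
    then have sub: "ks E' \<subset> ks E" using P by blast
    then have "card (ks E') < card (ks E)" by (intro psubset_card_mono) simp_all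
    moreover have "hD E' = E'" using less.prems(1) by (simp add: E'_def hD_diff hD_cmul hD_fib)
    moreover have "ks E' \<subseteq> CP" using sub less.prems(2) by blast
    moreover have "even (lk E' Q)" if "Q \<in> Ram" for Q
      using less.prems(3)[OF that] even_fib_Ram[OF that, of P] by (simp add: kP)
    ultimately obtain m where m: "E' - frag_cmul m (fib P0) \<in> Prin" using less.hyps by blast
    have "E' - frag_cmul m (fib P0) + frag_cmul k (fib P - fib P0) \<in> Prin"
      by (intro Prin_add m Prin_cmul fib_diff_Prin PC assms(4))
    also have "E' - frag_cmul m (fib P0) + frag_cmul k (fib P - fib P0) = E - frag_cmul (m + k) (fib P0)"
      by (rule poly_mapping_eqI) (simp add: E'_def lookup_minus lookup_add algebra_simps)
    finally show ?thesis by blast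
  qed
qed

text \<open>\<open>S\<close> collects the ramification points with odd coefficient; what remains is
  even at every ramification point.\<close>

lemma invariant_divisor:
  assumes D: "hD D = D" "ks D \<subseteq> CP" and P0: "P0 \<in> CP"
  shows "\<exists>S m. finite S \<and> S \<subseteq> Ram \<and> D - (dsum S + frag_cmul m (fib P0)) \<in> Prin"
proof -
  define S where "S = {P \<in> Ram. odd (lk D P)}"
  have "S \<subseteq> ks D" by (auto simp: S_def in_keys_iff)
  then have fin: "finite S" by (rule finite_subset) simp
  have S: "S \<subseteq> Ram" by (auto simp: S_def)
  have SC: "S \<subseteq> CP" using S by (auto simp: Ram_def)
  have "\<exists>m. (D - dsum S) - frag_cmul m (fib P0) \<in> Prin"
  proof (rule invariant_even_divisor[OF _ _ _ P0])
    show "hD (D - dsum S) = D - dsum S" by (simp add: hD_diff D(1) hD_dsum[OF fin S])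
    show "ks (D - dsum S) \<subseteq> CP" using SC by (intro keys_diff_CP D) (simp add: keys_dsum[OF fin])
    show "even (lk (D - dsum S) P)" if P: "P \<in> Ram" for P
    proof -
      have "P \<in> S \<longleftrightarrow> odd (lk D P)" using P by (simp add: S_def)
      then show ?thesis by (simp add: lookup_minus lookup_dsum[OF fin])
    qed
  qed
  then show ?thesis using fin S by (auto simp: diff_diff_eq)
qed

lemma add_hyp_Prin:
  assumes "ks D \<subseteq> CP" "P0 \<in> CP"
  shows "D + hD D - frag_cmul (div_degree D) (fib P0) \<in> Prin"
  using assms(1)
proof (induction D rule: frag_induction)
  case zero
  then show ?case using Prin_0 by (simp add: hD_def)
next
  case (one P)
  then show ?case using fib_diff_Prin[OF one assms(2)] by (simp add: hD_frag_of fib_def)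
next
  case (diff D E)
  have eq: "D - E + hD (D - E) - frag_cmul (div_degree (D - E)) (fib P0) =
      (D + hD D - frag_cmul (div_degree D) (fib P0)) - (E + hD E - frag_cmul (div_degree E) (fib P0))"
    by (rule poly_mapping_eqI) (simp add: lookup_minus lookup_add hD_diff div_degree_diff algebra_simps)
  show ?case unfolding eq by (rule Prin_diff[OF diff])
qed

text \<open>Hilbert 90 for the involution: a function \<open>f\<close> of norm one is \<open>h / \<iota>(h)\<close> with \<open>h = 1 + f\<close>.\<close>

lemma two_torsion_invariant:
  assumes D: "ks D \<subseteq> CP" "div_degree D = 0" "D + D \<in> Prin"
  shows "\<exists>D'. hD D' = D' \<and> ks D' \<subseteq> CP \<and> D - D' \<in> Prin"
proof -
  obtain P0 where P0: "P0 \<in> CP" using CP_nonempty by blast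
  have "D + hD D \<in> Prin" using add_hyp_Prin[OF D(1) P0] D(2) by simp
  then have "D - hD D \<in> Prin" using Prin_diff[OF D(3), of "D + hD D"] by simp
  then obtain f where f: "f \<in> FF" "f \<noteq> 0" "has_div f (D - hD D)" unfolding Prin_iff by blast
  have hh: "hD (hD D) = D" by (rule poly_mapping_eqI) (simp add: lookup_hD hyp_hyp)
  have "has_div (f * iota f) (D - hD D + hD (D - hD D))"
    using f iota_FF iota_nz by (intro has_div_mult has_div_iota) auto
  then have "has_div (f * iota f) 0" by (simp add: hD_diff hh)
  then obtain c where c: "c \<noteq> 0" "f * iota f = fun_const c"
    using divisor_zero_imp_constant[of "f * iota f"] f iota_nz iota_FF FF_mult by auto
  obtain s where s: "s\<^sup>2 = c" using sqrt_exists by blast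
  then have "s \<noteq> 0" using c by auto
  define f1 where "f1 = f / fun_const s"
  have f1: "f1 \<in> FF" "f1 \<noteq> 0" "has_div f1 (D - hD D)"
  proof -
    show "f1 \<in> FF" unfolding f1_def by (intro FF_divide FF_const f)
    show "f1 \<noteq> 0" using f \<open>s \<noteq> 0\<close> by (simp add: f1_def)
    show "has_div f1 (D - hD D)"
      using has_div_divide[OF f(3) has_div_const[OF \<open>s \<noteq> 0\<close>] f(1,2) FF_const] \<open>s \<noteq> 0\<close> by (simp add: f1_def)
  qed
  have "f1 * iota f1 = (f * iota f) / (fun_const s * fun_const s)"
    unfolding f1_def by (simp add: rhom_divide[OF rhom_iota] iota_const)
  also have "fun_const s * fun_const s = fun_const c"
    by (simp flip: rhom.mult[OF rhom_fun_const] add: s[symmetric] power2_eq_square)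
  finally have norm: "f1 * iota f1 = 1" using c by simp
  show ?thesis
  proof (cases "1 + f1 = 0")
    \<comment> \<open>Here \<open>h\<close> would vanish. But then \<open>f1 = - 1 = 1\<close> has
      divisor 0, and \<open>D\<close> is already invariant.\<close>
    case True
    then have "f1 = fun_const 1" by (simp add: add_eq_0_iff uminus_eq_fun rhom.one[OF rhom_fun_const])
    then have "D - hD D = 0" using has_div_unique[OF f1(3)] has_div_const[of 1] by simp
    then show ?thesis using D(1) Prin_0 by (intro exI[of _ D]) simp
  next
    case False
    define h where "h = 1 + f1"
    have h: "h \<in> FF" "h \<noteq> 0" using False f1 FF_add FF_1 by (auto simp: h_def)
    have "f1 * iota h = h" unfolding h_def
      by (simp add: rhom.add[OF rhom_iota] rhom.one[OF rhom_iota] distrib_left norm add.commute)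
    then have ih: "iota h = h / f1" using f1(2) by (simp add: field_simps)
    have "has_div (iota h) (dv h - (D - hD D))"
      unfolding ih using has_div_divide[OF has_div_dv[OF h] f1(3) h f1(1,2)] .
    then have hE: "hD (dv h) = dv h - (D - hD D)"
      using has_div_unique has_div_iota[OF has_div_dv[OF h] h] by blast
    have "dv h \<in> Prin" using has_div_dv[OF h] h unfolding Prin_iff by blast
    moreover have "hD (D - dv h) = D - dv h" by (simp add: hD_diff hE)
    moreover have "ks (D - dv h) \<subseteq> CP" by (rule keys_diff_CP[OF D(1) keys_Prin[OF \<open>dv h \<in> Prin\<close>]])
    ultimately show ?thesis by (intro exI[of _ "D - dv h"]) simp
  qed
qed

lemma galois_hyp:
  assumes "\<sigma> \<in> galois_group" "P \<in> CP"
  shows "galois_point \<sigma> (hyp_pt P) = hyp_pt (galois_point \<sigma> P)"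
proof -
  have \<sigma>: "rhom \<sigma>" "bij \<sigma>" using assms by (auto simp: galois_group_iff)
  obtain x y z where P: "P = wproj g (x, y, z)" using assms(2) unfolding curve_points_eq by auto
  show ?thesis
    unfolding P hyp_wproj galois_wproj[OF \<sigma>] galois_h[OF assms(1)]
    by (simp add: rhom.diff[OF \<sigma>(1)] rhom.minus[OF \<sigma>(1)])
qed

lemma galois_Ram: "\<sigma> \<in> galois_group \<Longrightarrow> P \<in> Ram \<Longrightarrow> galois_point \<sigma> P \<in> Ram"
  unfolding Ram_def using galois_CP galois_hyp by (metis (mono_tags, lifting) mem_Collect_eq)

lemma galois_fib: "\<sigma> \<in> galois_group \<Longrightarrow> P \<in> CP \<Longrightarrow> galois_divisor \<sigma> (fib P) = fib (galois_point \<sigma> P)"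
  by (simp add: fib_def galois_divisor_add galois_divisor_frag_of galois_hyp)

lemma galois_dsum:
  assumes \<sigma>: "\<sigma> \<in> galois_group" and S: "finite S"
  shows "galois_divisor \<sigma> (dsum S) = dsum (galois_point \<sigma> ` S)"
proof (rule poly_mapping_eqI)
  fix P
  have "galois_point (inv_into UNIV \<sigma>) P \<in> S \<longleftrightarrow> P \<in> galois_point \<sigma> ` S"
  proof
    assume "galois_point (inv_into UNIV \<sigma>) P \<in> S"
    then have "galois_point \<sigma> (galois_point (inv_into UNIV \<sigma>) P) \<in> galois_point \<sigma> ` S" by (rule imageI)
    then show "P \<in> galois_point \<sigma> ` S" by (simp only: galois_point_inv[OF \<sigma>])
  next
    assume "P \<in> galois_point \<sigma> ` S"
    then show "galois_point (inv_into UNIV \<sigma>) P \<in> S" by (auto simp: galois_point_inv[OF \<sigma>])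
  qed
  then show "lk (galois_divisor \<sigma> (dsum S)) P = lk (dsum (galois_point \<sigma> ` S)) P"
    using S by (simp add: lookup_galois_divisor[OF \<sigma>] lookup_dsum)
qed

text \<open>Makes the set of a class unique, so that a Galois-stable class yields a Galois-stable
  set. Twice a ramification point is a fibre, so modulo fibres the difference becomes the sum over
  the symmetric difference \<open>T\<close>, which must be empty by independence.\<close>

lemma dsum_diff_Prin:
  assumes A: "finite A" "A \<subseteq> Ram" and B: "finite B" "B \<subseteq> Ram" and AB: "dsum A - dsum B \<in> Prin"
  shows "A = B"
proof -
  obtain P0 where P0: "P0 \<in> CP" using CP_nonempty by blast
  define T where "T = (A - B) \<union> (B - A)"
  have T: "finite T" "T \<subseteq> Ram" using A B by (auto simp: T_def)
  have "(\<Sum>Q\<in>B - A. fib Q - fib P0) \<in> Prin"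
    using B by (intro Prin_sum fib_diff_Prin P0) (auto simp: Ram_def)
  then have "dsum A - dsum B + (\<Sum>Q\<in>B - A. fib Q - fib P0) \<in> Prin" using AB by (rule Prin_add[rotated])
  also have "dsum A - dsum B + (\<Sum>Q\<in>B - A. fib Q - fib P0) =
      dsum T + frag_cmul (- int (card (B - A))) (fib P0)"
  proof (rule poly_mapping_eqI)
    fix P
    have fib: "lk (fib Q) P = 2 * (if Q = P then 1 else 0)" if "Q \<in> B - A" for Q
    proof -
      have "hyp_pt Q = Q" using that B by (auto simp: Ram_def)
      then show ?thesis by (auto simp: lookup_fib')
    qed
    have "lk (\<Sum>Q\<in>B - A. fib Q - fib P0) P = (\<Sum>Q\<in>B - A. 2 * (if Q = P then 1 else 0) - lk (fib P0) P)"
      unfolding lookup_sum_frag by (intro sum.cong refl) (simp only: lookup_minus fib)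
    also have "\<dots> = 2 * (if P \<in> B - A then 1 else 0) - int (card (B - A)) * lk (fib P0) P"
      using B by (simp add: sum_subtractf sum_distrib_left[symmetric])
    finally show "lk (dsum A - dsum B + (\<Sum>Q\<in>B - A. fib Q - fib P0)) P =
        lk (dsum T + frag_cmul (- int (card (B - A))) (fib P0)) P"
      using A B T by (auto simp: lookup_add lookup_minus lookup_dsum T_def)
  qed
  finally have "T = {}" by (rule ramification_points_independent[OF T P0])
  then show ?thesis by (auto simp: T_def)
qed

theorem rational_order_2_iff_stable_set:
  "(\<exists>c\<in>jacobian_rational_points g H1 H0. group.ord Jac c = 2) \<longleftrightarrow>
   (\<exists>S. finite S \<and> S \<subseteq> Ram \<and> S \<noteq> {} \<and> even (card S) \<and> (\<forall>\<sigma>\<in>galois_group. galois_point \<sigma> ` S = S))"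
  unfolding rational_order_2_iff
proof
  assume "\<exists>D. ks D \<subseteq> CP \<and> div_degree D = 0 \<and> D \<notin> Prin \<and> D + D \<in> Prin \<and>
        (\<forall>\<sigma>\<in>galois_group. galois_divisor \<sigma> D - D \<in> Prin)"
  then obtain D where D: "ks D \<subseteq> CP" "div_degree D = 0" "D \<notin> Prin" "D + D \<in> Prin"
    and Dg: "\<And>\<sigma>. \<sigma> \<in> galois_group \<Longrightarrow> galois_divisor \<sigma> D - D \<in> Prin" by blast
  obtain P0 where P0: "P0 \<in> CP" using CP_nonempty by blast
  obtain D' where D': "hD D' = D'" "ks D' \<subseteq> CP" "D - D' \<in> Prin"
    using two_torsion_invariant[OF D(1,2,4)] by blast
  obtain S m where S: "finite S" "S \<subseteq> Ram" "D' - (dsum S + frag_cmul m (fib P0)) \<in> Prin"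
    using invariant_divisor[OF D'(1,2) P0] by blast
  define D1 where "D1 = dsum S + frag_cmul m (fib P0)"
  define p where "p = D - D1"
  have "D - D' + (D' - D1) = p" by (simp add: p_def)
  then have p: "p \<in> Prin" using Prin_add[OF D'(3) S(3)] unfolding D1_def by simp
  have "div_degree p = 0" by (rule degree_principal[OF p])
  \<comment> \<open>\<open>D\<close> has degree 0 and differs from
    \<open>dsum S + frag_cmul m (fib P0)\<close> by a principal divisor; comparing degrees shows
    that \<open>card S\<close> is even and determines \<open>m\<close>.\<close>
  then have deg: "int (card S) + 2 * m = 0"
    using D(2) by (simp add: p_def D1_def div_degree_diff div_degree_add div_degree_dsum div_degree_cmul div_degree_fib)
  then have "even (int (card S))" by presburger
  then have ev: "even (card S)" by simp
  have "S \<noteq> {}"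
  proof
    assume "S = {}"
    then have "D1 = 0" using deg by (simp add: D1_def dsum_def)
    then show False using p D(3) by (simp add: p_def)
  qed
  moreover have "galois_point \<sigma> ` S = S" if \<sigma>: "\<sigma> \<in> galois_group" for \<sigma>
  proof (rule dsum_diff_Prin)
    show "finite (galois_point \<sigma> ` S)" "galois_point \<sigma> ` S \<subseteq> Ram" using S galois_Ram[OF \<sigma>] by auto
    \<comment> \<open>Starting from the stability of the class of \<open>D\<close>, remove the
      contribution of the principal divisor \<open>p = D - D1\<close> and the change of the base
      fibre; only the change of \<open>S\<close> is left.\<close>
    have "galois_divisor \<sigma> D - D - (galois_divisor \<sigma> p - p) - frag_cmul m (fib (galois_point \<sigma> P0) - fib P0) \<in> Prin"
      by (intro Prin_diff Dg[OF \<sigma>] galois_Prin[OF \<sigma>] p Prin_cmul fib_diff_Prin galois_CP[OF \<sigma>] P0)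
    also have "galois_divisor \<sigma> D - D - (galois_divisor \<sigma> p - p) - frag_cmul m (fib (galois_point \<sigma> P0) - fib P0) =
        dsum (galois_point \<sigma> ` S) - dsum S"
      unfolding p_def D1_def galois_divisor_diff galois_divisor_add galois_divisor_cmul galois_fib[OF \<sigma> P0]
        galois_dsum[OF \<sigma> S(1)]
      by (rule poly_mapping_eqI) (simp add: lookup_minus lookup_add algebra_simps)
    finally show "dsum (galois_point \<sigma> ` S) - dsum S \<in> Prin" .
  qed (use S in auto)
  ultimately show "\<exists>S. finite S \<and> S \<subseteq> Ram \<and> S \<noteq> {} \<and> even (card S) \<and> (\<forall>\<sigma>\<in>galois_group. galois_point \<sigma> ` S = S)"
    using S(1,2) ev by blast
next
  assume "\<exists>S. finite S \<and> S \<subseteq> Ram \<and> S \<noteq> {} \<and> even (card S) \<and> (\<forall>\<sigma>\<in>galois_group. galois_point \<sigma> ` S = S)"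
  then obtain S where S: "finite S" "S \<subseteq> Ram" "S \<noteq> {}" "even (card S)"
    and Sg: "\<forall>\<sigma>\<in>galois_group. galois_point \<sigma> ` S = S" by (elim exE conjE)
  obtain P0 where P0: "P0 \<in> CP" using CP_nonempty by blast
  obtain k where k: "card S = 2 * k" using S(4) by (rule evenE)
  define D where "D = dsum S + frag_cmul (- int k) (fib P0)"
  have SC: "S \<subseteq> CP" using S(2) by (auto simp: Ram_def)
  have "ks (frag_cmul (- int k) (fib P0)) \<subseteq> CP" by (rule order_trans[OF keys_cmul keys_fib[OF P0]])
  then have "ks D \<subseteq> CP" unfolding D_def using SC by (intro keys_add_CP) (simp_all add: keys_dsum[OF S(1)])
  moreover have "div_degree D = 0"
    by (simp add: D_def div_degree_add div_degree_dsum div_degree_cmul div_degree_fib k)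
  moreover have "D \<notin> Prin" using ramification_points_independent[OF S(1,2) P0] S(3) unfolding D_def by blast
  moreover have "D + D \<in> Prin"
  proof -
    \<comment> \<open>Twice a ramification point is its fibre, and \<open>S\<close> has
      \<open>2 k\<close> points, so \<open>D + D\<close> is a sum of differences of fibres.\<close>
    have "(\<Sum>Q\<in>S. fib Q - fib P0) \<in> Prin" using SC by (intro Prin_sum fib_diff_Prin P0) auto
    also have "(\<Sum>Q\<in>S. fib Q - fib P0) = D + D"
    proof (rule poly_mapping_eqI)
      fix P
      have fib: "lk (fib Q) P = 2 * (if Q = P then 1 else 0)" if "Q \<in> S" for Q
      proof -
        have "hyp_pt Q = Q" using that S by (auto simp: Ram_def)
        then show ?thesis by (auto simp: lookup_fib')
      qed
      have "lk (\<Sum>Q\<in>S. fib Q - fib P0) P = (\<Sum>Q\<in>S. 2 * (if Q = P then 1 else 0) - lk (fib P0) P)"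
        unfolding lookup_sum_frag by (intro sum.cong refl) (simp only: lookup_minus fib)
      also have "\<dots> = 2 * (if P \<in> S then 1 else 0) - int (card S) * lk (fib P0) P"
        using S by (simp add: sum_subtractf sum_distrib_left[symmetric])
      finally show "lk (\<Sum>Q\<in>S. fib Q - fib P0) P = lk (D + D) P"
        using S(1) by (simp add: D_def lookup_add lookup_dsum k)
    qed
    finally show ?thesis .
  qed
  moreover have "galois_divisor \<sigma> D - D \<in> Prin" if \<sigma>: "\<sigma> \<in> galois_group" for \<sigma>
  proof -
    have "galois_divisor \<sigma> D - D = frag_cmul (- int k) (fib (galois_point \<sigma> P0) - fib P0)"
      unfolding D_def galois_divisor_add galois_divisor_cmul galois_fib[OF \<sigma> P0] galois_dsum[OF \<sigma> S(1)] Sg[rule_format, OF \<sigma>]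
      by (rule poly_mapping_eqI) (simp add: lookup_minus lookup_add algebra_simps)
    then show ?thesis using Prin_cmul fib_diff_Prin galois_CP[OF \<sigma> P0] P0 by simp
  qed
  ultimately show "\<exists>D. ks D \<subseteq> CP \<and> div_degree D = 0 \<and> D \<notin> Prin \<and> D + D \<in> Prin \<and>
        (\<forall>\<sigma>\<in>galois_group. galois_divisor \<sigma> D - D \<in> Prin)" by blast
qed

end

section \<open>Factorization of binary forms\<close>

text \<open>A form in \<open>X\<close> and \<open>Z\<close> is a weighted form of degree 0 in
  \<open>Y\<close>; this carries the product rule over.\<close>

lemma homogeneous_iff_weighted: "homogeneous d P \<longleftrightarrow> weighted_form 0 d [:P:]"
  by (auto simp: weighted_form_pCons homogeneous_def)

lemma homogeneous_mult:
  fixes P Q :: "'a::comm_ring_1 poly poly"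
  assumes "homogeneous d P" "homogeneous e Q"
  shows "homogeneous (d + e) (P * Q)"
  using weighted_form_mult[of 0 d "[:P:]" e "[:Q:]"] assms
  by (simp add: homogeneous_iff_weighted mult.commute)

lemma homogeneous_power:
  fixes P :: "'a::comm_ring_1 poly poly"
  assumes "homogeneous d P"
  shows "homogeneous (n * d) (P ^ n)"
proof (induction n)
  case 0
  show ?case by (auto simp: homogeneous_def)
next
  case (Suc n)
  then show ?case using homogeneous_mult[OF assms Suc] by simp
qed

lemma homogeneous_const: "homogeneous 0 [:[:c:]:]"
  by (auto simp: homogeneous_def coeff_pCons split: nat.splits)

lemma homogeneous_degree_unique:
  assumes "homogeneous d P" "homogeneous e P" "P \<noteq> 0"
  shows "d = e"
proof -
  obtain j where "coeff P j \<noteq> 0" using assms(3) by (metis leading_coeff_0_iff)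
  then obtain i where "coeff (coeff P j) i \<noteq> 0" by (metis leading_coeff_0_iff)
  then show ?thesis using assms(1,2) by (auto simp: homogeneous_def)
qed

lemma total_degree_homogeneous:
  assumes "homogeneous d P" "P \<noteq> 0"
  shows "total_degree P = d"
proof -
  obtain j where "coeff P j \<noteq> 0" using assms(2) by (metis leading_coeff_0_iff)
  then obtain i where "coeff (coeff P j) i \<noteq> 0" by (metis leading_coeff_0_iff)
  then have "{i + j | i j. coeff (coeff P j) i \<noteq> 0} = {d}"
    using assms(1) by (fastforce simp: homogeneous_def)
  then show ?thesis by (simp add: total_degree_def)
qed

lemma homogeneous_dehomogenize_inj:
  fixes P Q :: "'a::comm_ring_1 poly poly"
  assumes "homogeneous d P" "homogeneous d Q" "dehomogenize P = dehomogenize Q"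
  shows "P = Q"
proof -
  have "coeff (coeff P (d - i)) i = coeff (coeff Q (d - i)) i" for i
    using assms coeff_dehomogenize by metis
  then show ?thesis
    by (subst homogeneous_expansion[OF assms(1)], subst homogeneous_expansion[OF assms(2)]) simp
qed

definition homogenize :: "nat \<Rightarrow> 'a::comm_ring_1 poly \<Rightarrow> 'a poly poly" where
  "homogenize d p = (\<Sum>i\<le>d. monom (monom (coeff p i) i) (d - i))"

lemma homogeneous_homogenize: "homogeneous d (homogenize d p)"
  unfolding homogeneous_def
proof (intro allI impI)
  fix i j assume "coeff (coeff (homogenize d p) j) i \<noteq> 0"
  then have "(\<Sum>k\<le>d. coeff (coeff (monom (monom (coeff p k) k) (d - k)) j) i) \<noteq> 0"
    unfolding homogenize_def coeff_sum .
  then obtain k where "k \<le> d" "coeff (coeff (monom (monom (coeff p k) k) (d - k)) j) i \<noteq> 0"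
    by (metis (no_types, lifting) sum.neutral atMost_iff)
  then show "i + j = d" by (auto split: if_splits)
qed

lemma dehomogenize_homogenize:
  assumes "degree p \<le> d"
  shows "dehomogenize (homogenize d p) = p"
proof -
  have "dehomogenize (homogenize d p) = (\<Sum>i\<le>d. monom (coeff p i) i)"
    unfolding homogenize_def rhom.sum[OF rhom_dehomogenize]
    unfolding dehomogenize_def eval2_monom[OF rhom_const]
    by (simp add: monom_altdef)
  also have "\<dots> = p" by (rule poly_as_sum_of_monoms'[OF assms])
  finally show ?thesis .
qed

lemma linear_power: "[:0, c:] ^ n = monom (c ^ n) n"
proof -
  have "[:0, c:] = monom c 1" by (simp add: monom_altdef)
  then show ?thesis by (simp add: monom_power)
qed

text \<open>Lowest exponents add up under multiplication just as degrees do. For a monomial product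
  both sums equal \<open>n\<close>, so in each factor the lowest exponent is the degree.\<close>

lemma monomial_factor:
  fixes p q :: "'a::idom poly"
  assumes "p * q = monom c n" "c \<noteq> 0"
  shows "\<exists>e. \<forall>i. coeff p i \<noteq> 0 \<longrightarrow> i = e"
proof -
  have nz: "p \<noteq> 0" "q \<noteq> 0" using assms by (auto simp: monom_eq_0_iff)
  have deg: "degree p + degree q = n"
    using degree_mult_eq[OF nz] assms by (simp add: degree_monom_eq)
  define e f where "e = (LEAST i. coeff p i \<noteq> 0)" and "f = (LEAST i. coeff q i \<noteq> 0)"
  have ex: "\<exists>i. coeff p i \<noteq> 0" "\<exists>i. coeff q i \<noteq> 0" using nz leading_coeff_0_iff by blast+
  have e: "coeff p e \<noteq> 0" "\<And>i. i < e \<Longrightarrow> coeff p i = 0"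
    unfolding e_def using LeastI_ex[OF ex(1)] not_less_Least by blast+
  have f: "coeff q f \<noteq> 0" "\<And>i. i < f \<Longrightarrow> coeff q i = 0"
    unfolding f_def using LeastI_ex[OF ex(2)] not_less_Least by blast+
  have "coeff (p * q) (e + f) = (\<Sum>i\<le>e + f. if i = e then coeff p e * coeff q f else 0)"
    unfolding coeff_mult
  proof (intro sum.cong refl)
    fix i assume "i \<in> {..e + f}"
    then show "coeff p i * coeff q (e + f - i) = (if i = e then coeff p e * coeff q f else 0)"
      using e(2)[of i] f(2)[of "e + f - i"] by (cases i e rule: linorder_cases) auto
  qed
  also have "\<dots> = coeff p e * coeff q f" by simp
  finally have "coeff (monom c n) (e + f) \<noteq> 0" using e f assms(1) by simp
  then have "e + f = n" by (auto split: if_splits)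
  moreover have "e \<le> degree p" "f \<le> degree q" using e f by (auto intro: le_degree)
  ultimately have "e = degree p" using deg by simp
  then have "i = e" if "coeff p i \<noteq> 0" for i
    using that e(2)[of i] le_degree[OF that] by (metis antisym_conv3 linorder_not_less)
  then show ?thesis by blast
qed

text \<open>Substituting \<open>X T\<close> and \<open>Z T\<close> for the variables turns a form into a monomial in \<open>T\<close>, and
  the factors of a monomial are monomials.\<close>

lemma homogeneous_factor:
  fixes P Q :: "'a::idom poly poly"
  assumes "homogeneous d (P * Q)" "P * Q \<noteq> 0"
  shows "\<exists>e. homogeneous e P"
proof -
  \<comment> \<open>Three layers of polynomials: \<open>X\<close> innermost, then \<open>Z\<close>,
    and the new variable \<open>T\<close> outermost. \<open>\<Theta> R\<close> is
    \<open>R(XT, ZT)\<close>.\<close>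
  define \<phi> where "\<phi> = (\<lambda>c::'a. [:[:[:c:]:]:])"
  have \<phi>: "rhom \<phi>"
    unfolding \<phi>_def by (rule rhom_comp[OF rhom_comp[OF rhom_const rhom_const] rhom_const])
  define \<Theta> where "\<Theta> R = eval2 \<phi> R [:0, [:[:0, 1:]:]:] [:0, [:0, 1:]:]" for R
  interpret \<Theta>: rhom \<Theta> unfolding \<Theta>_def by (rule rhom_eval2[OF \<phi>])
  have summand: "\<phi> c * [:0, [:[:0, 1:]:]:] ^ i * [:0, [:0, 1:]:] ^ j = monom (monom (monom c i) j) (i + j)" for c i j
  proof -
    have c: "[:[:0, 1::'a:]:] ^ i = [:monom 1 i:]" by (induction i) (simp_all add: one_pCons monom_Suc)
    have x: "[:0, [:[:0, 1:]:]:] ^ i = monom [:monom (1::'a) i:] i" unfolding linear_power c ..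
    have z: "[:0, [:0, 1:]:] ^ j = monom (monom (1::'a poly) j) j" unfolding linear_power by simp
    have "\<phi> c = monom [:[:c:]:] 0" by (simp add: \<phi>_def monom_0)
    then show ?thesis unfolding x z by (simp add: mult_monom smult_monom)
  qed
  have \<Theta>: "\<Theta> R = (\<Sum>j\<le>degree R. \<Sum>i\<le>degree (coeff R j). monom (monom (monom (coeff (coeff R j) i) i) j) (i + j))" for R
    unfolding \<Theta>_def eval2_altdef[OF \<phi>] summand ..
  have coeff: "coeff (coeff (coeff (\<Theta> R) (i + j)) j) i = coeff (coeff R j) i" for R i j
  proof -
    have "coeff (coeff (coeff (\<Theta> R) (i + j)) j) i =
        (\<Sum>j'\<le>degree R. \<Sum>i'\<le>degree (coeff R j'). if i' = i \<and> j' = j then coeff (coeff R j') i' else 0)"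
      unfolding \<Theta> coeff_sum by (intro sum.cong refl) auto
    also have "\<dots> = (\<Sum>j'\<le>degree R. if j' = j then \<Sum>i'\<le>degree (coeff R j). if i' = i then coeff (coeff R j) i' else 0 else 0)"
      by (intro sum.cong refl) auto
    also have "\<dots> = coeff (coeff R j) i"
      by (auto simp: sum.delta' coeff_eq_0 not_le)
    finally show ?thesis .
  qed
  have "[:0, [:[:0, 1:]:]:] = [:0, 1:] * [:[:[:0, 1::'a:]:]:]" "[:0, [:0, 1:]:] = [:0, 1:] * [:[:0, 1::'a poly:]:]"
    by simp_all
  then have "\<Theta> (P * Q) = [:0, 1:] ^ d * eval2 \<phi> (P * Q) [:[:[:0, 1:]:]:] [:[:0, 1:]:]"
    unfolding \<Theta>_def by (simp only: eval2_scale[OF \<phi> assms(1)])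
  also have "eval2 \<phi> (P * Q) [:[:[:0, 1:]:]:] [:[:0, 1:]:] = [:eval2 (\<lambda>c. [:[:c:]:]) (P * Q) [:[:0, 1:]:] [:0, 1:]:]"
    using hom_eval2[OF rhom_comp[OF rhom_const rhom_const] rhom_const, of "P * Q" "[:[:0, 1::'a:]:]" "[:0, 1:]"]
    by (simp add: \<phi>_def)
  finally obtain w where w: "\<Theta> P * \<Theta> Q = [:0, 1:] ^ d * [:w:]" by (simp only: \<Theta>.mult)
  then have mon: "\<Theta> P * \<Theta> Q = monom w d" by (simp add: monom_altdef)
  have "w \<noteq> 0"
  proof
    assume "w = 0"
    then have "\<Theta> (P * Q) = 0" using mon by (simp add: \<Theta>.mult)
    then have "coeff (coeff (P * Q) j) i = 0" for i j using coeff[of "P * Q" i j] by simp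
    then show False using assms(2) by (simp add: poly_eq_iff)
  qed
  from monomial_factor[OF mon this] obtain e where e: "\<And>i. coeff (\<Theta> P) i \<noteq> 0 \<Longrightarrow> i = e" by blast
  have "homogeneous e P"
    unfolding homogeneous_def
  proof (intro allI impI)
    fix i j assume "coeff (coeff P j) i \<noteq> 0"
    then have "coeff (\<Theta> P) (i + j) \<noteq> 0" using coeff[of P i j] by auto
    then show "i + j = e" by (rule e)
  qed
  then show ?thesis by blast
qed

lemma unit_poly_poly:
  fixes u :: "'a::field poly poly"
  assumes "u dvd 1"
  obtains c where "c \<noteq> 0" "u = [:[:c:]:]"
proof -
  obtain p where p: "u = [:p:]" "p dvd 1" using assms by (auto simp: is_unit_poly_iff)
  then obtain c where "p = [:c:]" "c dvd 1" by (auto simp: is_unit_poly_iff)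
  then have "c \<noteq> 0" by auto
  then show ?thesis using that p(1) \<open>p = [:c:]\<close> by simp
qed

lemma const_poly_poly_unit: "c \<noteq> 0 \<Longrightarrow> [:[:c::'a::field:]:] dvd 1"
  by (simp add: is_unit_poly_iff dvd_field_iff)

lemma homogeneous_0:
  fixes P :: "'a::comm_ring_1 poly poly"
  assumes "homogeneous 0 P"
  shows "\<exists>c. P = [:[:c:]:]"
  using homogeneous_expansion[OF assms] by (auto simp: monom_0)

text \<open>For a form that is not divisible by \<open>Z\<close>, irreducibility can be tested after setting
  \<open>Z = 1\<close>.\<close>

lemma irreducible_homogenize:
  fixes p :: "'a::field poly"
  assumes "irreducible p"
  shows "irreducible (homogenize (degree p) p)"
proof (rule irreducibleI)
  let ?P = "homogenize (degree p) p"
  interpret D: rhom "dehomogenize :: 'a poly poly \<Rightarrow> _" by (rule rhom_dehomogenize)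
  have dP: "dehomogenize ?P = p" by (rule dehomogenize_homogenize) simp
  have "p \<noteq> 0" using assms by auto
  then show P0: "?P \<noteq> 0" using dP by auto
  show "\<not> ?P dvd 1"
  proof
    assume "?P dvd 1"
    then have "p dvd 1" using D.dvd[of ?P 1] dP by simp
    then show False using assms by (auto simp: irreducible_def)
  qed
  have main: "A dvd 1" if AB: "?P = A * B" and A: "dehomogenize A dvd 1" for A B
  proof -
    have nz: "A * B \<noteq> 0" using P0 AB by simp
    have AB': "homogeneous (degree p) (A * B)" using homogeneous_homogenize AB by metis
    obtain e where e: "homogeneous e A" using homogeneous_factor[OF AB' nz] by blast
    obtain f where f: "homogeneous f B" using homogeneous_factor[of "degree p" B A] AB' nz by (auto simp: mult.commute)
    have "e + f = degree p" using homogeneous_degree_unique[OF homogeneous_mult[OF e f] AB' nz] .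
    moreover have p: "p = dehomogenize A * dehomogenize B" using dP unfolding AB D.mult by simp
    then have nz': "dehomogenize A \<noteq> 0" "dehomogenize B \<noteq> 0" using \<open>p \<noteq> 0\<close> by auto
    have "degree (dehomogenize A) = 0" using A nz' by (simp add: is_unit_iff_degree)
    then have "degree p = degree (dehomogenize B)" using degree_mult_eq[OF nz'] p by simp
    then have "degree p \<le> f" using degree_dehomogenize_le[OF f] by simp
    ultimately have "e = 0" by simp
    then obtain c where "A = [:[:c:]:]" using homogeneous_0 e by blast
    moreover from this nz have "c \<noteq> 0" by auto
    ultimately show ?thesis using const_poly_poly_unit by blast
  qed
  fix A B assume AB: "?P = A * B"
  then have "p = dehomogenize A * dehomogenize B" using dP by (simp add: D.mult)
  then have "dehomogenize A dvd 1 \<or> dehomogenize B dvd 1" using assms by (auto simp: irreducible_def)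
  then show "A dvd 1 \<or> B dvd 1"
    using main[OF AB] main[of B A] AB by (auto simp: mult.commute)
qed

lemma irreducible_Z: "irreducible ([:0, 1:] :: 'a::field poly poly)"
proof (rule irreducibleI)
  show "[:0, 1:] \<noteq> (0 :: 'a poly poly)" by simp
  show "\<not> [:0, 1:] dvd (1 :: 'a poly poly)" by (auto simp: is_unit_poly_iff)
  fix A B :: "'a poly poly" assume AB: "[:0, 1:] = A * B"
  then have nz: "A \<noteq> 0" "B \<noteq> 0" by auto
  have unit: "C dvd 1" if CD: "[:0, 1:] = C * D" "degree C = 0" for C D :: "'a poly poly"
  proof -
    obtain c where c: "C = [:c:]" using CD(2) by (rule degree_eq_zeroE)
    have "coeff [:0, 1:] 1 = coeff (C * D) 1" using CD(1) by simp
    then have "1 = c * coeff D 1" by (simp add: c)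
    then have "c dvd 1" by (rule dvdI)
    then show ?thesis by (auto simp: c is_unit_poly_iff)
  qed
  have "degree A + degree B = 1" using degree_mult_eq[OF nz] unfolding AB[symmetric] by simp
  then have "degree A = 0 \<or> degree B = 0" by auto
  then show "A dvd 1 \<or> B dvd 1" using unit[OF AB] unit[of B A] AB by (auto simp: mult.commute)
qed

text \<open>A missing term \<open>X^d\<close> would make \<open>Z\<close> a factor of
  \<open>P\<close>, so \<open>P\<close> would be a multiple of \<open>Z\<close> by a constant and
  its dehomogenization constant. So no degree is lost, and a factorization on \<open>Z = 1\<close>
  homogenizes to one of \<open>P\<close>.\<close>

lemma irreducible_dehomogenize:
  fixes P :: "'a::field poly poly"
  assumes P: "irreducible P" "homogeneous d P" and deg: "degree (dehomogenize P) > 0"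
  shows "irreducible (dehomogenize P)" "degree (dehomogenize P) = d"
proof -
  interpret D: rhom "dehomogenize :: 'a poly poly \<Rightarrow> _" by (rule rhom_dehomogenize)
  have "coeff (dehomogenize P) d \<noteq> 0"
  proof
    assume c: "coeff (dehomogenize P) d = 0"
    have "coeff (coeff P 0) i = 0" for i
    proof (cases "i = d")
      case True
      then show ?thesis using c coeff_dehomogenize[OF P(2), of d] by simp
    next
      case False
      then show ?thesis using P(2)[unfolded homogeneous_def, rule_format, of 0 i] by auto
    qed
    then have "coeff P 0 = 0" by (simp add: poly_eq_iff)
    then obtain w where w: "P = [:0, 1:] * w"
      by (metis add_0 mult_pCons_left mult_zero_left one_pCons pCons_0_0 pCons_cases coeff_pCons_0 mult_1 smult_1_left smult_0_left)
    then have "[:0, 1:] dvd (1 :: 'a poly poly) \<or> w dvd 1" using P(1) unfolding irreducible_def by blast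
    then have "w dvd 1" using irreducible_Z[where 'a = 'a] unfolding irreducible_def by blast
    then obtain c where "w = [:[:c:]:]" using unit_poly_poly by blast
    then have "P = [:0, [:c:]:]" using w by simp
    then have "dehomogenize P = [:c:]"
      by (simp add: dehomogenize_def eval2_pCons[OF rhom_const] map_poly_pCons)
    then show False using deg by simp
  qed
  then have "d \<le> degree (dehomogenize P)" by (rule le_degree)
  then show d: "degree (dehomogenize P) = d" using degree_dehomogenize_le[OF P(2)] by simp
  show "irreducible (dehomogenize P)"
  proof (rule irreducibleI)
    show "dehomogenize P \<noteq> 0" using deg by auto
    then show "\<not> dehomogenize P dvd 1" using deg by (simp add: is_unit_iff_degree)
    fix a b assume ab: "dehomogenize P = a * b"
    then have nz: "a \<noteq> 0" "b \<noteq> 0" using deg by auto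
    let ?A = "homogenize (degree a) a" and ?B = "homogenize (degree b) b"
    have "homogeneous d (?A * ?B)"
      using homogeneous_mult[OF homogeneous_homogenize homogeneous_homogenize, of "degree a" "degree b" a b]
        degree_mult_eq[OF nz] d ab by simp
    moreover have "dehomogenize P = dehomogenize (?A * ?B)"
      by (simp add: D.mult dehomogenize_homogenize ab)
    ultimately have "P = ?A * ?B" by (rule homogeneous_dehomogenize_inj[OF P(2)])
    then have "?A dvd 1 \<or> ?B dvd 1" using P(1) by (auto simp: irreducible_def)
    then show "a dvd 1 \<or> b dvd 1"
      using D.dvd[of ?A 1] D.dvd[of ?B 1] by (auto simp: dehomogenize_homogenize)
  qed
qed

subsection \<open>Separability over perfect fields\<close>

lemma card_simple_roots:
  fixes p :: "'a::alg_closed_field poly"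
  assumes "\<And>a. poly p a = 0 \<Longrightarrow> poly (pderiv p) a \<noteq> 0" "p \<noteq> 0"
  shows "card {a. poly p a = 0} = degree p"
  using assms
proof (induction "degree p" arbitrary: p rule: less_induct)
  case less
  show ?case
  proof (cases "degree p = 0")
    case True
    then obtain c where "p = [:c:]" by (rule degree_eq_zeroE)
    then show ?thesis using less.prems by simp
  next
    case False
    then obtain a where a: "poly p a = 0" using alg_closed_imp_poly_has_root by blast
    then obtain q where q: "p = [:- a, 1:] * q" by (auto simp: poly_eq_0_iff_dvd dvd_def)
    have "q \<noteq> 0" using less.prems q by auto
    have deg: "degree p = Suc (degree q)" unfolding q by (subst degree_mult_eq) (use \<open>q \<noteq> 0\<close> in auto)
    have pd: "poly (pderiv p) b = poly q b + (b - a) * poly (pderiv q) b" for b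
      unfolding q pderiv_mult by (simp add: pderiv_pCons algebra_simps)
    have "poly q a \<noteq> 0" using less.prems(1)[OF a] pd[of a] by simp
    have "card {b. poly q b = 0} = degree q"
    proof (rule less.hyps)
      show "degree q < degree p" using deg by simp
      fix b assume b: "poly q b = 0"
      show "poly (pderiv q) b \<noteq> 0"
      proof
        assume "poly (pderiv q) b = 0"
        then have "poly (pderiv p) b = 0" using pd[of b] b by simp
        moreover have "poly p b = 0" using b by (simp add: q)
        ultimately show False using less.prems(1) by blast
      qed
    qed fact
    moreover have "{b. poly p b = 0} = insert a {b. poly q b = 0}" by (auto simp: q)
    moreover have "finite {b. poly q b = 0}" by (rule poly_roots_finite[OF \<open>q \<noteq> 0\<close>])
    ultimately show ?thesis using \<open>poly q a \<noteq> 0\<close> deg by simp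
  qed
qed

text \<open>A zero derivative leaves only even exponents, perfectness supplies square roots of the
  coefficients, and squaring is additive in characteristic 2.\<close>

lemma pderiv_eq_0_imp_square:
  fixes p :: "'a::field poly"
  assumes char: "CHAR('a) = 2" and perfect: "perfect_field TYPE('a)" and "pderiv p = 0"
  shows "\<exists>r. p = r * r"
proof -
  have two: "(2 :: 'a) = 0" using of_nat_CHAR[where 'a = 'a] by (simp add: char)
  have "\<forall>c::'a. \<exists>b. b ^ 2 = c" using perfect char by (simp add: perfect_field_def)
  then obtain s where s: "\<And>c::'a. s c ^ 2 = c" by metis
  have ss: "s c * s c = c" for c using s[of c] by (simp only: power2_eq_square)
  have add_self: "(f :: 'a poly) + f = 0" for f
  proof -
    have "f + f = smult 2 f" by (metis smult_1_left smult_add_left one_add_one)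
    then show ?thesis by (simp add: two)
  qed
  interpret sq: rhom "\<lambda>f::'a poly. f * f"
  proof
    fix f h :: "'a poly"
    have "(f + h) * (f + h) = f * f + h * h + (f * h + f * h)" by (simp add: algebra_simps)
    then show "(f + h) * (f + h) = f * f + h * h" by (simp only: add_self add.right_neutral)
  qed (simp_all add: algebra_simps)
  define r where "r = (\<Sum>i\<le>degree p. monom (s (coeff p (2 * i))) i)"
  have "r * r = (\<Sum>i\<le>degree p. monom (s (coeff p (2 * i))) i * monom (s (coeff p (2 * i))) i)"
    unfolding r_def by (rule sq.sum)
  also have "\<dots> = (\<Sum>i\<le>degree p. monom (coeff p (2 * i)) (2 * i))"
    by (intro sum.cong refl) (simp only: mult_monom ss mult_2)
  finally have r: "r * r = (\<Sum>i\<le>degree p. monom (coeff p (2 * i)) (2 * i))" .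
  have "p = r * r"
  proof (rule poly_eqI)
    fix n
    have "coeff (r * r) n = (\<Sum>i\<le>degree p. if 2 * i = n then coeff p n else 0)"
      unfolding r coeff_sum by (intro sum.cong) auto
    also have "\<dots> = coeff p n"
    proof (cases "even n")
      case True
      then obtain m where m: "n = 2 * m" by (rule evenE)
      have "(\<Sum>i\<le>degree p. if 2 * i = n then coeff p n else 0) = (\<Sum>i\<le>degree p. if i = m then coeff p n else 0)"
        by (intro sum.cong) (auto simp: m)
      also have "\<dots> = (if m \<le> degree p then coeff p n else 0)" by simp
      also have "\<dots> = coeff p n" using coeff_eq_0[of p n] m by auto
      finally show ?thesis .
    next
      case False
      then obtain m where m: "n = Suc (2 * m)" by (metis oddE Suc_eq_plus1)
      have "of_nat (Suc (2 * m)) * coeff p (Suc (2 * m)) = 0"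
        using assms(3) coeff_pderiv[of p "2 * m"] by simp
      moreover have "(of_nat (Suc (2 * m)) :: 'a) = 1" using two by simp
      ultimately have "coeff p n = 0" unfolding m by (metis mult_1)
      then show ?thesis by (auto intro!: sum.neutral)
    qed
    finally show "coeff p n = coeff (r * r) n" ..
  qed
  then show ?thesis by blast
qed

definition rt :: "'a::field poly \<Rightarrow> 'a alg_closure set" where
  "rt p = {a. poly (map_poly to_ac p) a = 0}"

lemma map_to_ac_nz: "p \<noteq> 0 \<Longrightarrow> map_poly to_ac p \<noteq> 0"
  by (auto simp: poly_eq_iff coeff_map_poly)

lemma finite_rt: "p \<noteq> 0 \<Longrightarrow> finite (rt p)"
  unfolding rt_def by (intro poly_roots_finite map_to_ac_nz)

lemma degree_map_to_ac: "degree (map_poly to_ac p) = degree p"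
  by (rule degree_map_poly) simp

lemma rt_nonempty: "degree p > 0 \<Longrightarrow> rt p \<noteq> {}"
  using alg_closed_imp_poly_has_root[of "map_poly to_ac p"] by (auto simp: rt_def degree_map_to_ac)

lemma rt_mult: "rt (p * q) = rt p \<union> rt q"
  by (auto simp: rt_def rhom.mult[OF rhom.map_poly[OF rhom_to_ac]])

lemma rt_dvd: "p dvd q \<Longrightarrow> rt p \<subseteq> rt q"
  by (auto simp: dvd_def rt_mult)

lemma rt_power: "n > 0 \<Longrightarrow> rt (p ^ n) = rt p"
  by (auto simp: rt_def rhom.power[OF rhom.map_poly[OF rhom_to_ac]])

lemma rt_const: "c \<noteq> 0 \<Longrightarrow> rt [:c:] = {}"
  by (auto simp: rt_def map_poly_pCons)

lemma pderiv_map_to_ac: "pderiv (map_poly to_ac p) = map_poly to_ac (pderiv p)"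
  by (rule poly_eqI) (simp add: coeff_pderiv coeff_map_poly)

lemma irreducible_common_root: "irreducible p \<Longrightarrow> rt p \<inter> rt q \<noteq> {} \<Longrightarrow> p dvd q"
  using irreducible_dvd_if_common_root[OF rhom_to_ac] by (auto simp: rt_def)

text \<open>Where perfectness enters: an irreducible polynomial is not a square, so its derivative
  is nonzero and, having smaller degree, shares no root with it. Parity of the degree thus becomes
  parity of the number of ramification points.\<close>

lemma card_rt_irreducible:
  fixes p :: "'a::field poly"
  assumes char: "CHAR('a) = 2" and perfect: "perfect_field TYPE('a)" and p: "irreducible p"
  shows "card (rt p) = degree p"
proof -
  have p0: "p \<noteq> 0" using p by auto
  have "pderiv p \<noteq> 0"
  proof
    assume "pderiv p = 0"
    then obtain r where r: "p = r * r" using pderiv_eq_0_imp_square[OF char perfect] by blast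
    then have "r dvd 1" using p by (auto simp: irreducible_def)
    then have "p dvd 1" unfolding r using mult_dvd_mono[of r 1 r 1] by simp
    then show False using p by (auto simp: irreducible_def)
  qed
  have "degree p \<noteq> 0"
  proof
    assume "degree p = 0"
    then have "p dvd 1" using p0 by (simp add: is_unit_iff_degree)
    then show False using p by (auto simp: irreducible_def)
  qed
  have "\<not> p dvd pderiv p"
  proof
    assume "p dvd pderiv p"
    then have "degree p \<le> degree (pderiv p)" using \<open>pderiv p \<noteq> 0\<close> by (rule dvd_imp_degree_le)
    moreover have "degree (pderiv p) \<le> degree p - 1"
      by (rule degree_le) (auto simp: coeff_pderiv coeff_eq_0)
    ultimately show False using \<open>degree p \<noteq> 0\<close> by linarith
  qed
  then have disj: "rt p \<inter> rt (pderiv p) = {}" using irreducible_common_root[OF p] by blast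
  have "card {a. poly (map_poly to_ac p) a = 0} = degree (map_poly to_ac p)"
  proof (rule card_simple_roots[OF _ map_to_ac_nz[OF p0]])
    fix a assume "poly (map_poly to_ac p) a = 0"
    then show "poly (pderiv (map_poly to_ac p)) a \<noteq> 0"
      using disj by (auto simp: rt_def pderiv_map_to_ac)
  qed
  then show ?thesis by (simp add: rt_def degree_map_to_ac)
qed

lemma galois_transitive:
  assumes "irreducible p" "a \<in> rt p" "b \<in> rt p"
  shows "\<exists>\<sigma>\<in>galois_group. \<sigma> a = b"
proof -
  obtain \<sigma> where \<sigma>: "rhom \<sigma>" "bij \<sigma>" "\<forall>c. \<sigma> (to_ac c) = to_ac c" "\<sigma> a = b"
    using alg_closure_automorphism_extension[OF rhom_id(1) bij_id[unfolded id_def] assms(1), of a b] assms(2,3)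
    by (auto simp: rt_def)
  then have "\<sigma> \<in> galois_group" by (auto simp: galois_group_def rhom.add rhom.mult)
  then show ?thesis using \<sigma>(4) by blast
qed

lemma galois_rt:
  assumes \<sigma>: "\<sigma> \<in> galois_group" and a: "a \<in> rt p"
  shows "\<sigma> a \<in> rt p"
proof -
  have fixes_k: "\<And>c. \<sigma> (to_ac c) = to_ac c" using \<sigma> by (simp add: galois_group_def)
  have "\<sigma> 1 = 1" using fixes_k[of 1] by simp
  then have r: "rhom \<sigma>" using \<sigma> by (simp add: galois_group_def rhom_def)
  have "\<sigma> (poly (map_poly to_ac p) a) = poly (map_poly to_ac p) (\<sigma> a)"
    by (simp add: rhom.poly[OF r] map_poly_map_poly rhom.zero[OF r] o_def fixes_k)
  then show ?thesis using a rhom.zero[OF r] by (simp add: rt_def)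
qed

lemma irreducible_factor_exists:
  fixes p :: "'a::field poly"
  assumes "degree p > 0"
  shows "\<exists>q. irreducible q \<and> q dvd p"
  using assms
proof (induction "degree p" arbitrary: p rule: less_induct)
  case less
  show ?case
  proof (cases "irreducible p")
    case False
    moreover have "p \<noteq> 0" using less.prems by auto
    moreover from this have "\<not> p dvd 1" using less.prems by (simp add: is_unit_iff_degree)
    ultimately obtain a b where ab: "p = a * b" "\<not> a dvd 1" "\<not> b dvd 1" by (auto simp: irreducible_def)
    then have nz: "a \<noteq> 0" "b \<noteq> 0" using \<open>p \<noteq> 0\<close> by auto
    then have "degree a > 0" "degree b > 0" using ab by (auto simp: is_unit_iff_degree)
    then have "degree a < degree p" using degree_mult_eq[OF nz] ab by simp
    then obtain q where "irreducible q" "q dvd a" using less.hyps \<open>degree a > 0\<close> by blast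
    then show ?thesis using ab(1) by (meson dvd_mult2)
  qed auto
qed

text \<open>Divide by \<open>p\<close> as long as the degree is positive: some irreducible factor
  remains, and \<open>p\<close> divides it.\<close>

lemma power_of_irreducible:
  fixes f p :: "'a::field poly"
  assumes "f \<noteq> 0" "degree p > 0" "\<And>q. irreducible q \<Longrightarrow> q dvd f \<Longrightarrow> p dvd q"
  shows "\<exists>c n. c \<noteq> 0 \<and> f = [:c:] * p ^ n"
  using assms(1,3)
proof (induction "degree f" arbitrary: f rule: less_induct)
  case less
  show ?case
  proof (cases "degree f = 0")
    case True
    then obtain c where "f = [:c:]" by (rule degree_eq_zeroE)
    then show ?thesis using less.prems(1) by (intro exI[of _ c] exI[of _ 0]) simp
  next
    case False
    then obtain q where q: "irreducible q" "q dvd f" using irreducible_factor_exists by blast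
    then have "p dvd f" using less.prems(2) dvd_trans by blast
    then obtain h where h: "f = p * h" by (auto simp: dvd_def)
    then have nz: "p \<noteq> 0" "h \<noteq> 0" using less.prems(1) by auto
    then have deg: "degree h < degree f" using degree_mult_eq[OF nz] h assms(2) by simp
    have "p dvd q" if "irreducible q" "q dvd h" for q
      using less.prems(2)[OF that(1)] that(2) h by simp
    from less.hyps[OF deg nz(2) this] obtain c n where cn: "c \<noteq> 0" "h = [:c:] * p ^ n" by blast
    have "f = [:c:] * p ^ Suc n" unfolding h cn(2) power_Suc by (rule mult.left_commute)
    then show ?thesis using cn(1) by blast
  qed
qed

subsection \<open>Ramification points\<close>

context curve begin

definition sq :: "'k alg_closure \<Rightarrow> 'k alg_closure" where
  "sq c = (SOME y. y\<^sup>2 = c)"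

lemma sq: "(sq c)\<^sup>2 = c"
  unfolding sq_def by (rule someI_ex[OF sqrt_exists])

lemma sq_unique: "y\<^sup>2 = c \<Longrightarrow> y = sq c"
proof -
  assume "y\<^sup>2 = c"
  then have "(y + sq c)\<^sup>2 = c + c + 2 * (y * sq c)" by (simp add: power2_sum sq)
  then have "(y + sq c)\<^sup>2 = 0" by (simp add: two_eq_0 add_self)
  then have "y + sq c = 0" by simp
  then show ?thesis using uminus_eq by (metis add_eq_0_iff2)
qed

text \<open>Over a zero \<open>a\<close> of \<open>H1\<close> the equation is
  \<open>y^2 = H0\<close>, whose root is unique in characteristic 2. For other \<open>a\<close> this
  is only a placeholder.\<close>

definition aff :: "'k alg_closure \<Rightarrow> 'k alg_closure wpoint" where
  "aff a = wproj g (a, sq (h0 a 1), 1)"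

definition infpt :: "'k alg_closure wpoint" where
  "infpt = wproj g (1, sq (h0 1 0), 0)"

definition hh :: "'k poly" where "hh = dehomogenize H1"

lemma hh_nz: "hh \<noteq> 0" and degree_hh: "degree hh \<le> g + 1"
  using dehomogenize_H1_nz degree_dehomogenize_le[OF hom1] by (simp_all add: hh_def)

lemma rt_hh: "a \<in> rt hh \<longleftrightarrow> h1 a 1 = 0"
  by (simp add: rt_def hh_def h1_def eval2_at_one[OF rhom_to_ac])

lemma h1_infinity: "h1 1 0 = 0 \<longleftrightarrow> degree hh < g + 1"
proof -
  have "h1 1 0 = to_ac (coeff hh (g + 1))" by (simp add: h1_def hh_def eval2_at_infinity[OF rhom_to_ac hom1])
  moreover have "coeff hh (g + 1) = 0 \<longleftrightarrow> degree hh < g + 1"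
    using degree_hh hh_nz coeff_eq_0[of hh "g + 1"] by (metis le_neq_implies_less leading_coeff_0_iff)
  ultimately show ?thesis by simp
qed

lemma Ram_iff:
  assumes "(x, z) \<noteq> (0, 0)"
  shows "wproj g (x, y, z) \<in> Ram \<longleftrightarrow> h1 x z = 0 \<and> y = sq (h0 x z)"
proof
  assume R: "wproj g (x, y, z) \<in> Ram"
  then have h: "h1 x z = 0" using hyp_fixed_iff[OF assms] by (simp add: Ram_def)
  obtain x' y' z' where *: "on_curve (x', y', z')" "wproj g (x', y', z') = wproj g (x, y, z)"
    using R by (auto simp: Ram_def curve_points_eq)
  obtain c where c: "c \<noteq> 0" "x = c * x'" "y = c ^ (g + 1) * y'" "z = c * z'"
    using *(2) unfolding wproj_eq_iff by blast
  have h': "h1 x' z' = 0" using h c h_scale(1)[of c x' z'] by simp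
  have pow: "c ^ (g + 1) * c ^ (g + 1) = c ^ (2 * g + 2)" by (simp add: power_add[symmetric] mult_2)
  have "y\<^sup>2 = (c ^ (g + 1) * c ^ (g + 1)) * y'\<^sup>2"
    unfolding c(3) power2_eq_square by (simp only: ac_simps)
  also have "\<dots> = c ^ (2 * g + 2) * y'\<^sup>2" unfolding pow ..
  also have "y'\<^sup>2 = h0 x' z'" using *(1) h' by (simp add: on_curve_def)
  finally have "y\<^sup>2 = h0 x z" by (simp only: c h_scale)
  then show "h1 x z = 0 \<and> y = sq (h0 x z)" using h sq_unique by blast
next
  assume *: "h1 x z = 0 \<and> y = sq (h0 x z)"
  then have "on_curve (x, y, z)" using assms by (simp add: on_curve_def sq)
  then show "wproj g (x, y, z) \<in> Ram"
    using * hyp_fixed_iff[OF assms] by (auto simp: Ram_def curve_points_eq)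
qed

lemma aff_Ram: "aff a \<in> Ram \<longleftrightarrow> a \<in> rt hh"
  unfolding aff_def rt_hh by (subst Ram_iff) auto

lemma infpt_Ram: "infpt \<in> Ram \<longleftrightarrow> degree hh < g + 1"
  unfolding infpt_def h1_infinity[symmetric] by (subst Ram_iff) auto

lemma Ram_cases:
  assumes "P \<in> Ram"
  obtains a where "a \<in> rt hh" "P = aff a" | "P = infpt" "degree hh < g + 1"
proof -
  obtain x y z where P: "P = wproj g (x, y, z)" "on_curve (x, y, z)"
    using assms by (auto simp: Ram_def curve_points_eq)
  show ?thesis
  proof (cases "z = 0")
    case False
    have "P = wproj g (z * (x / z), z ^ (g + 1) * (y / z ^ (g + 1)), z * 1)" using False by (simp add: P)
    also have "\<dots> = wproj g (x / z, y / z ^ (g + 1), 1)" by (rule wproj_eqI[OF False])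
    finally have P': "P = wproj g (x / z, y / z ^ (g + 1), 1)" .
    have "P = aff (x / z)" using assms Ram_iff[of "x / z" 1 "y / z ^ (g + 1)"] unfolding P' aff_def by simp
    then show ?thesis using that(1) assms aff_Ram by blast
  next
    case True
    then have x: "x \<noteq> 0" using P(2) by (auto simp: on_curve_def)
    have "P = wproj g (x * 1, x ^ (g + 1) * (y / x ^ (g + 1)), x * 0)" using x True by (simp add: P)
    also have "\<dots> = wproj g (1, y / x ^ (g + 1), 0)" by (rule wproj_eqI[OF x])
    finally have P': "P = wproj g (1, y / x ^ (g + 1), 0)" .
    have "P = infpt" using assms Ram_iff[of 1 0 "y / x ^ (g + 1)"] unfolding P' infpt_def by simp
    then show ?thesis using that(2) assms infpt_Ram by blast
  qed
qed

lemma aff_inj: "inj aff"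
  by (rule injI) (auto simp: aff_def wproj_eq_iff)

lemma infpt_not_aff: "infpt \<noteq> aff a"
  by (auto simp: aff_def infpt_def wproj_eq_iff)

text \<open>The image is again a ramification point with affine coordinate
  \<open>\<sigma> a\<close>, and there is only one such point. So the action on ramification points
  is the action on zeros of \<open>H1\<close>.\<close>

lemma galois_aff:
  assumes \<sigma>: "\<sigma> \<in> galois_group" and "a \<in> rt hh"
  shows "galois_point \<sigma> (aff a) = aff (\<sigma> a)"
proof -
  have r: "rhom \<sigma>" "bij \<sigma>" using \<sigma> by (auto simp: galois_group_iff)
  have gp: "galois_point \<sigma> (aff a) = wproj g (\<sigma> a, \<sigma> (sq (h0 a 1)), 1)"
    unfolding aff_def galois_wproj[OF r] by (simp add: rhom.one[OF r(1)])
  have "galois_point \<sigma> (aff a) \<in> Ram" using galois_Ram[OF \<sigma>] aff_Ram assms(2) by blast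
  then have "\<sigma> (sq (h0 a 1)) = sq (h0 (\<sigma> a) 1)" unfolding gp by (subst (asm) Ram_iff) auto
  then show ?thesis by (simp only: gp aff_def[of "\<sigma> a"])
qed

lemma galois_infpt:
  assumes \<sigma>: "\<sigma> \<in> galois_group" and "degree hh < g + 1"
  shows "galois_point \<sigma> infpt = infpt"
proof -
  have r: "rhom \<sigma>" "bij \<sigma>" using \<sigma> by (auto simp: galois_group_iff)
  have gp: "galois_point \<sigma> infpt = wproj g (1, \<sigma> (sq (h0 1 0)), 0)"
    unfolding infpt_def galois_wproj[OF r] by (simp add: rhom.one[OF r(1)] rhom.zero[OF r(1)])
  have "galois_point \<sigma> infpt \<in> Ram" using galois_Ram[OF \<sigma>] infpt_Ram assms(2) by blast
  then have "\<sigma> (sq (h0 1 0)) = sq (h0 1 0)" unfolding gp by (subst (asm) Ram_iff) auto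
  then show ?thesis unfolding gp by (simp only: infpt_def)
qed

lemma galois_stable_rt:
  assumes \<sigma>: "\<sigma> \<in> galois_group" and p: "p dvd hh"
  shows "galois_point \<sigma> ` aff ` rt p = aff ` rt p"
proof -
  have sub: "rt p \<subseteq> rt hh" by (rule rt_dvd[OF p])
  have "\<sigma> ` rt p = rt p"
  proof
    show "\<sigma> ` rt p \<subseteq> rt p" using galois_rt[OF \<sigma>] by blast
    show "rt p \<subseteq> \<sigma> ` rt p"
    proof
      fix a assume "a \<in> rt p"
      then have "inv_into UNIV \<sigma> a \<in> rt p" by (rule galois_rt[OF galois_inv[OF \<sigma>]])
      moreover have "\<sigma> (inv_into UNIV \<sigma> a) = a"
        using \<sigma> by (simp add: galois_group_iff bij_is_surj surj_f_inv_f)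
      ultimately show "a \<in> \<sigma> ` rt p" by (metis imageI)
    qed
  qed
  moreover have "galois_point \<sigma> ` aff ` rt p = aff ` \<sigma> ` rt p"
    unfolding image_image using sub galois_aff[OF \<sigma>] by (intro image_cong) auto
  ultimately show ?thesis by simp
qed

definition stable_even :: "'k alg_closure wpoint set \<Rightarrow> bool" where
  "stable_even S \<longleftrightarrow> finite S \<and> S \<subseteq> Ram \<and> S \<noteq> {} \<and> even (card S) \<and> (\<forall>\<sigma>\<in>galois_group. galois_point \<sigma> ` S = S)"

text \<open>If \<open>P\<close> is \<open>Z\<close> up to a constant, the only ramification point
  lies at infinity. Otherwise none lies there, and by transitivity a nonempty stable set contains
  all roots of \<open>p\<close>, an odd number. In neither case can the set be even.\<close>

lemma stable_even_imp_not_power: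
  assumes perfect: "perfect_field TYPE('k)" and S: "stable_even S"
    and u: "u dvd 1" and P: "irreducible P" "odd (total_degree P)" and H1: "H1 = u * P ^ n"
  shows False
proof -
  interpret D: rhom "dehomogenize :: 'k poly poly \<Rightarrow> _" by (rule rhom_dehomogenize)
  obtain c where c: "c \<noteq> 0" "u = [:[:c:]:]" using unit_poly_poly[OF u] by blast
  have P0: "P \<noteq> 0" using P by auto
  have n: "n > 0"
  proof (rule ccontr)
    assume "\<not> n > 0"
    then have "H1 = [:[:c:]:]" using H1 c by simp
    \<comment> \<open>The exponent cannot be 0, as a nonzero constant is not a form of degree
      \<open>g + 1\<close>.\<close>
    then have "g + 1 = 0" using homogeneous_degree_unique[OF hom1 _ H1_nz] homogeneous_const by metis
    then show False by simp
  qed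
  have fac: "P * (u * P ^ (n - 1)) = H1" using n H1 by (cases n) (simp_all add: mult_ac)
  obtain d where d: "homogeneous d P"
    using homogeneous_factor[of "g + 1" P "u * P ^ (n - 1)"] fac hom1 H1_nz by auto
  have odd: "odd d" using P(2) total_degree_homogeneous[OF d P0] by simp
  define p where "p = dehomogenize P"
  have dehu: "dehomogenize u = [:c:]"
    by (simp add: c dehomogenize_def eval2_pCons[OF rhom_const] map_poly_pCons)
  have "hh = dehomogenize (u * P ^ n)" unfolding hh_def by (rule arg_cong[OF H1])
  then have hh: "hh = [:c:] * p ^ n" by (simp only: D.mult D.power dehu p_def)
  have SR: "finite S" "S \<subseteq> Ram" "S \<noteq> {}" "even (card S)" using S by (auto simp: stable_even_def)
  have Sg: "galois_point \<sigma> ` S = S" if "\<sigma> \<in> galois_group" for \<sigma> using S that by (simp add: stable_even_def)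
  have rt_hh: "rt hh = rt p" unfolding hh rt_mult rt_const[OF c(1)] rt_power[OF n] by simp
  show False
  proof (cases "degree p = 0")
    case True
    then obtain e where e: "p = [:e:]" by (rule degree_eq_zeroE)
    moreover have "p \<noteq> 0" using hh_nz hh n by (auto simp: power_0_left)
    ultimately have "rt hh = {}" unfolding rt_hh using rt_const by simp
    then have "S \<subseteq> {infpt}" using SR(2) Ram_cases by blast
    then have "S = {infpt}" using SR(3) by blast
    then show False using SR(4) by simp
  next
    case False
    then have p: "irreducible p" "degree p = d"
      using irreducible_dehomogenize[OF P(1) d] by (simp_all add: p_def)
    have p0: "p \<noteq> 0" using p by auto
    have "homogeneous (0 + n * d) (u * P ^ n)"
      unfolding c by (intro homogeneous_mult homogeneous_power homogeneous_const d)
    then have "n * d = g + 1" using homogeneous_degree_unique[OF _ hom1 H1_nz, of "n * d"] H1 by simp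
    moreover have "degree hh = n * d"
      using c p p0 by (simp add: hh degree_mult_eq degree_power_eq)
    ultimately have top: "\<not> degree hh < g + 1" by simp
    have SA: "S \<subseteq> aff ` rt p" using SR(2) Ram_cases top rt_hh by blast
    obtain a where a: "a \<in> rt p" "aff a \<in> S" using SA SR(3) by blast
    have "aff b \<in> S" if b: "b \<in> rt p" for b
    proof -
      obtain \<sigma> where \<sigma>: "\<sigma> \<in> galois_group" "\<sigma> a = b" using galois_transitive[OF p(1) a(1) b] by blast
      have "galois_point \<sigma> (aff a) = aff b" using galois_aff[OF \<sigma>(1)] a(1) \<sigma>(2) rt_hh by simp
      then show ?thesis using Sg[OF \<sigma>(1)] a(2) by (metis imageI)
    qed
    then have "S = aff ` rt p" using SA by blast
    then have "card S = card (rt p)" using aff_inj by (simp add: card_image inj_on_subset)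
    also have "\<dots> = d" using card_rt_irreducible[OF char2 perfect p(1)] p(2) by simp
    finally show False using SR(4) odd by simp
  qed
qed

text \<open>Three kinds of even stable sets have to be absent: the roots of one factor of even
  degree, the point at infinity with the roots of an odd factor, and the roots of two coprime odd
  factors. What remains is a power of \<open>Z\<close> or of one irreducible form of odd degree, up
  to a constant.\<close>

lemma no_stable_even_imp_power:
  assumes perfect: "perfect_field TYPE('k)" and none: "\<And>S. \<not> stable_even S"
  shows "\<exists>u P n. u dvd 1 \<and> irreducible P \<and> odd (total_degree P) \<and> H1 = u * P ^ n"
proof (cases "degree hh = 0")
  case True
  then obtain c where c: "hh = [:c:]" by (rule degree_eq_zeroE)
  then have c0: "c \<noteq> 0" using hh_nz by auto
  have Z: "homogeneous 1 ([:0, 1:] :: 'k poly poly)"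
    by (auto simp: homogeneous_def coeff_pCons coeff_1 split: nat.splits if_splits)
  interpret D: rhom "dehomogenize :: 'k poly poly \<Rightarrow> _" by (rule rhom_dehomogenize)
  have dZ: "dehomogenize ([:0, 1:] :: 'k poly poly) = 1" "dehomogenize [:[:c:]:] = [:c:]"
    by (simp_all add: dehomogenize_def eval2_pCons[OF rhom_const] map_poly_pCons one_pCons)
  have "homogeneous (0 + (g + 1) * 1) ([:[:c:]:] * [:0, 1:] ^ (g + 1))"
    by (intro homogeneous_mult homogeneous_power homogeneous_const Z)
  then have hom: "homogeneous (g + 1) ([:[:c:]:] * [:0, 1:] ^ (g + 1))"
    by (simp only: add_0 mult_1_right)
  have "dehomogenize H1 = dehomogenize ([:[:c:]:] * [:0, 1:] ^ (g + 1))"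
    unfolding hh_def[symmetric] D.mult D.power dZ c by simp
  \<comment> \<open>A form of known degree is determined by its values on \<open>Z = 1\<close>; here
    these are constant, so only \<open>Z^(g+1)\<close> is left, with \<open>Z\<close> irreducible of
    degree 1.\<close>
  then have "H1 = [:[:c:]:] * [:0, 1:] ^ (g + 1)" by (rule homogeneous_dehomogenize_inj[OF hom1 hom])
  moreover have "total_degree ([:0, 1:] :: 'k poly poly) = 1" by (rule total_degree_homogeneous[OF Z]) simp
  ultimately show ?thesis
    using const_poly_poly_unit[OF c0] irreducible_Z by (metis odd_one)
next
  case False
  then obtain p where p: "irreducible p" "p dvd hh" using irreducible_factor_exists by blast
  have RamI: "aff ` rt q \<subseteq> Ram" if "q dvd hh" for q using rt_dvd[OF that] aff_Ram by blast
  have irr: "q \<noteq> 0" "degree q > 0" if "irreducible q" for q :: "'k poly"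
  proof -
    show "q \<noteq> 0" using that by auto
    then show "degree q > 0" using that by (auto simp: irreducible_def is_unit_iff_degree)
  qed
  have fin: "finite (rt q)" if "irreducible q" for q :: "'k poly" using finite_rt[OF irr(1)[OF that]] .
  have card: "card (aff ` rt q) = degree q" if "irreducible q" for q
    using card_rt_irreducible[OF char2 perfect that] aff_inj by (simp add: card_image inj_on_subset)
  have odd: "odd (degree q)" if q: "irreducible q" "q dvd hh" for q
  proof (rule ccontr)
    assume "\<not> odd (degree q)"
    then have "stable_even (aff ` rt q)"
      unfolding stable_even_def using fin q RamI card galois_stable_rt rt_nonempty[OF irr(2)] by auto
    then show False using none by blast
  qed
  have top: "degree hh = g + 1"
  proof (rule ccontr)
    assume "degree hh \<noteq> g + 1"
    then have lt: "degree hh < g + 1" using degree_hh by simp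
    have "infpt \<notin> aff ` rt p" using infpt_not_aff by blast
    then have "card (insert infpt (aff ` rt p)) = Suc (degree p)" using fin[OF p(1)] card[OF p(1)] by simp
    moreover have "galois_point \<sigma> ` insert infpt (aff ` rt p) = insert infpt (aff ` rt p)" if "\<sigma> \<in> galois_group" for \<sigma>
      using galois_infpt[OF that lt] galois_stable_rt[OF that p(2)] by simp
    ultimately have "stable_even (insert infpt (aff ` rt p))"
      unfolding stable_even_def using fin[OF p(1)] RamI[OF p(2)] infpt_Ram lt odd[OF p] by simp
    then show False using none by blast
  qed
  have "p dvd q" if q: "irreducible q" "q dvd hh" for q
  proof (rule ccontr)
    assume "\<not> p dvd q"
    then have disj: "rt p \<inter> rt q = {}" using irreducible_common_root[OF p(1)] by blast
    have "aff ` rt p \<inter> aff ` rt q = {}" using disj aff_inj by (auto dest: injD)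
    then have "card (aff ` rt p \<union> aff ` rt q) = degree p + degree q"
      using fin p q card by (subst card_Un_disjoint) auto
    moreover have "galois_point \<sigma> ` (aff ` rt p \<union> aff ` rt q) = aff ` rt p \<union> aff ` rt q" if "\<sigma> \<in> galois_group" for \<sigma>
      unfolding image_Un using galois_stable_rt[OF that] p q by simp
    ultimately have "stable_even (aff ` rt p \<union> aff ` rt q)"
      unfolding stable_even_def using fin p q RamI odd rt_nonempty[OF irr(2)] by simp
    then show False using none by blast
  qed
  then obtain c n where cn: "c \<noteq> 0" "hh = [:c:] * p ^ n"
    using power_of_irreducible[OF hh_nz irr(2)[OF p(1)]] by blast
  define P where "P = homogenize (degree p) p"
  interpret D: rhom "dehomogenize :: 'k poly poly \<Rightarrow> _" by (rule rhom_dehomogenize)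
  have dP: "dehomogenize P = p" "dehomogenize [:[:c:]:] = [:c:]"
    by (simp_all add: P_def dehomogenize_homogenize)
       (simp add: dehomogenize_def eval2_pCons[OF rhom_const] map_poly_pCons)
  have hP: "homogeneous (degree p) P" unfolding P_def by (rule homogeneous_homogenize)
  have irrP: "irreducible P" unfolding P_def by (rule irreducible_homogenize[OF p(1)])
  have "P \<noteq> 0" using irrP by auto
  then have "total_degree P = degree p" by (rule total_degree_homogeneous[OF hP])
  then have oddP: "odd (total_degree P)" using odd[OF p] by simp
  have "homogeneous (0 + n * degree p) ([:[:c:]:] * P ^ n)"
    by (intro homogeneous_mult homogeneous_power homogeneous_const hP)
  moreover have "0 + n * degree p = g + 1"
    using top cn irr[OF p(1)] by (simp add: degree_mult_eq degree_power_eq)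
  ultimately have hom: "homogeneous (g + 1) ([:[:c:]:] * P ^ n)" by simp
  have "H1 = [:[:c:]:] * P ^ n"
    by (rule homogeneous_dehomogenize_inj[OF hom1 hom]) (simp only: D.mult D.power dP hh_def[symmetric] cn)
  then show ?thesis using const_poly_poly_unit[OF cn(1)] irrP oddP by blast
qed

end

text \<open>The unit \<open>u\<close> is a nonzero constant of \<open>k\<close>: being a power of an
  irreducible polynomial is understood up to units.\<close>

theorem theorem23:
  fixes g :: nat and H1 H0 :: "'k::field poly poly"
  assumes "perfect_field TYPE('k)" and "CHAR('k) = 2"
    and "g \<ge> 2"
    and "homogeneous (g + 1) H1" and "homogeneous (2 * g + 2) H0"
    and "smooth_model H1 H0"
  shows "\<not> (\<exists>c \<in> jacobian_rational_points g H1 H0. group.ord (jacobian g H1 H0) c = 2) \<longleftrightarrow>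
         (\<exists>u P n. u dvd 1 \<and> irreducible P \<and> odd (total_degree P) \<and> H1 = u * P ^ n)"
proof -
  interpret curve g H1 H0 using assms by unfold_locales
  have "(\<exists>c \<in> jacobian_rational_points g H1 H0. group.ord (jacobian g H1 H0) c = 2) \<longleftrightarrow> (\<exists>S. stable_even S)"
    unfolding rational_order_2_iff_stable_set stable_even_def ..
  then show ?thesis
    using stable_even_imp_not_power[OF assms(1)] no_stable_even_imp_power[OF assms(1)] by blast
qed

end
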